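(* Let $N_1<N_2<\cdots$ be an increasing sequence of positive integers with $L/N_L\to 1$ as $L\to\infty$, and let $(\lambda(N_L))_{L\ge1}\in\prod_{L\ge 1}\mathrm{Sign}_{N_L}$ be a Vershik--Kerov sequence converging to $\omega\in\Omega$. For each $L$ let $(\pi_{N_L},V_{N_L})$ be the irreducible representation of $U(N_L)$ associated with $\lambda(N_L)$ and $\psi_{N_L}\in V_{N_L}$ a unit vector. Then for any integer partition $\mu$ and any $t>0$, $$\lim_{L\to\infty}\frac{\langle\Lambda_t(\mathbb{S}_{\mu|N_L})\rangle_{N_L,t}}{N_L^{|\mu|}}=s_\mu(\omega)\,t,$$ where $L$ is taken large enough that $N_L$ is at least the length of $\mu$.
   Context: Fock space. Inner products are linear in the first variable. $\mathcal{F}(\mathfrak{h})=\bigoplus_{n\ge 0}\mathfrak{h}^{\odot n}$ is the symmetric Fock space of a complex Hilbert space $\mathfrak h$, with exponential vectors $e(\psi)=\sum_{n\ge0}\frac{1}{\sqrt{n!}}\psi^{\odot n}$. For bounded self-adjoint $H$, $\Lambda(H)$ is the self-adjoint generator of the unitary group determined by $e^{\mathrm{i}r\Lambda(H)}e(\psi)=e(e^{\mathrm{i}rH}\psi)$; for $H\in B(\mathfrak{h})$, $\Lambda(H):=\Lambda\left(\frac{H+H^*}{2}\right)+\mathrm{i}\Lambda\left(\frac{H-H^*}{2\mathrm{i}}\right)$. For $\mathfrak{h}=L^2(\mathbb{R}_{\ge0};V)\cong L^2(\mathbb{R}_{\ge 0})\otimes V$ and $\mathsf{h}\in B(V)$ put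 $\Lambda_t(1\otimes\mathsf{h}):=\Lambda((1\otimes\mathsf{h})_t)$, where $(1\otimes\mathsf{h})_t$ is $1\otimes\mathsf{h}$ composed with multiplication by $\mathbb{1}_{[0,t]}$. For $\varphi\in\mathfrak{h}$, $\langle X\rangle_\varphi:=\langle Xe(\varphi),e(\varphi)\rangle/\langle e(\varphi),e(\varphi)\rangle$. For $\psi\in V$, $\psi_t:=\mathbb{1}_{[0,t)}\otimes\psi$. Here $V=V_{N_L}$, $\mathfrak{h}_{N_L}=L^2(\mathbb{R}_{\ge0};V_{N_L})$, and $\langle\,\cdot\,\rangle_{N_L,t}:=\langle\,\cdot\,\rangle_{(\psi_{N_L})_t}$. Representations. $\mathrm{Sign}_N=\{\lambda=(\lambda_1\ge\dots\ge\lambda_N)\in\mathbb{Z}^N\}$ parametrizes the irreducible representations $(\pi_\lambda,V_\lambda)$ of $U(N)$ by highest weight; $\widetilde\pi_\lambda$ is the induced representation of the universal enveloping algebra $U(\mathfrak{gl}_N)$ on $V_\lambda$, and $Z(\mathfrak{gl}_N)$ is the center of $U(\mathfrak{gl}_N)$. For $X\in U(\mathfrak{gl}_{N_L})$ put $\Lambda_t(X):=\Lambda_t(1\otimes\widetilde\pi_{N_L}(X))$, with $\widetilde\pi_{N_L}:=\widetilde\pi_{\lambda(N_L)}$. For a partition $\mu$ of length at most $N$ (padded by zeros to $N$ entries), the shifted Schur polynomial is $$s^*_\mu(x_1,\dots,x_N)=\frac{\det[(x_i+N-i)^{\downarrow\mu_j+N-j}]_{i,j=1}^N}{\det[(x_i+N-i)^{\downarrow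 N-j}]_{i,j=1}^N},\quad x^{\downarrow k}=x(x-1)\cdots(x-k+1),\ x^{\downarrow 0}=1,$$ and the quantum immanant $\mathbb{S}_{\mu|N}\in Z(\mathfrak{gl}_N)$ is the element with $\widetilde\pi_\lambda(\mathbb{S}_{\mu|N})=s^*_\mu(\lambda)1_{V_\lambda}$ for all $\lambda\in\mathrm{Sign}_N$. $|\mu|$ is the sum of the parts of $\mu$. Parameters. $\Omega$ is the set of $\omega=(\alpha^+,\alpha^-,\beta^+,\beta^-,\gamma^+,\gamma^-)\in(\mathbb{R}_{\ge0}^\infty)^4\times\mathbb{R}_{\ge0}^2$ with $\alpha^\pm=(\alpha^\pm_1\ge\alpha^\pm_2\ge\cdots)$, $\beta^\pm=(\beta^\pm_1\ge\beta^\pm_2\ge\cdots)$, $\sum_i(\alpha^\pm_i+\beta^\pm_i)<\infty$, $\beta^+_1+\beta^-_1\le1$. Put $$\Phi_\omega(z)=e^{\gamma^+(z-1)+\gamma^-(z^{-1}-1)}\prod_{j\ge1}\frac{1+\beta^+_j(z-1)}{1-\alpha^+_j(z-1)}\,\frac{1+\beta^-_j(z^{-1}-1)}{1-\alpha^-_j(z^{-1}-1)}.$$ Define $h_k(\omega)$ by $\sum_{k\ge0}h_k(\omega)x^k=\Phi_\omega(1+x)$ (power series at $x=0$), $h_k(\omega)=0$ for $k<0$, and $s_\mu(\omega)=\det[h_{\mu_i-i+j}(\omega)]_{i,j=1}^n$ for a partition $\mu$ of length at most $n$. Vershik--Kerov sequences. For $\lambda\in\mathrm{Sign}_N$ write $\lambda=(\lambda^+_1,\lambda^+_2,\dots,-\lambda^-_2,-\lambda^-_1)$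 with $\lambda^+,\lambda^-$ the partitions formed by the positive and negative parts; $\lambda^{\pm\prime}$ is the transposed diagram of $\lambda^\pm$, $a^\pm_i=\lambda^\pm_i-i+\frac12$, $b^\pm_i=\lambda^{\pm\prime}_i-i+\frac12$. The sequence $(\lambda(N_L))_L$ is a Vershik--Kerov sequence converging to $\omega$ if, with $a_i^\pm(N_L),b_i^\pm(N_L)$ computed from $\lambda(N_L)$, as $L\to\infty$: $a^\pm_i(N_L)/N_L\to\alpha^\pm_i$ and $b^\pm_i(N_L)/N_L\to\beta^\pm_i$ for all $i$, $|\lambda^\pm(N_L)|/N_L\to\delta^\pm$, and $\gamma^\pm=\delta^\pm-\sum_i(\alpha^\pm_i+\beta^\pm_i)$. *)

theory Defs
  imports
    "HOL-Complex_Analysis.Complex_Analysis"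
    "HOL-Algebra.QuotRing"
    "Jordan_Normal_Form.Schur_Decomposition"
begin

section \<open>Complex Hilbert spaces\<close>

text \<open>As usual for \<^typ>\<open>(complex, 'a) module\<close>, the fields \<^const>\<open>mult\<close> and
  \<^const>\<open>one\<close> are not used. The inner product is linear in the first variable.\<close>

record 'a hilb = "(complex, 'a) module" +
  ip :: "'a \<Rightarrow> 'a \<Rightarrow> complex"

definition hdiff :: "('a, 'm) hilb_scheme \<Rightarrow> 'a \<Rightarrow> 'a \<Rightarrow> 'a" where
  "hdiff H x y = x \<oplus>\<^bsub>H\<^esub> ((-1) \<odot>\<^bsub>H\<^esub> y)"

definition hnorm :: "('a, 'm) hilb_scheme \<Rightarrow> 'a \<Rightarrow> real" where
  "hnorm H x = sqrt (Re (ip H x x))"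

definition hlim :: "('a, 'm) hilb_scheme \<Rightarrow> ('i \<Rightarrow> 'a) \<Rightarrow> 'a \<Rightarrow> 'i filter \<Rightarrow> bool" where
  "hlim H f x F \<longleftrightarrow> ((\<lambda>i. hnorm H (hdiff H (f i) x)) \<longlongrightarrow> 0) F"

definition hadjoint :: "('a, 'm) hilb_scheme \<Rightarrow> ('a \<Rightarrow> 'a) \<Rightarrow> 'a \<Rightarrow> 'a" where
  "hadjoint H A y =
    (THE z. z \<in> carrier H \<and> (\<forall>x\<in>carrier H. ip H (A x) y = ip H x z))"

definition op_scale :: "('a, 'm) hilb_scheme \<Rightarrow> complex \<Rightarrow> ('a \<Rightarrow> 'a) \<Rightarrow> 'a \<Rightarrow> 'a" where
  "op_scale H c A x = c \<odot>\<^bsub>H\<^esub> A x"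

definition op_add :: "('a, 'm) hilb_scheme \<Rightarrow> ('a \<Rightarrow> 'a) \<Rightarrow> ('a \<Rightarrow> 'a) \<Rightarrow> 'a \<Rightarrow> 'a" where
  "op_add H A B x = A x \<oplus>\<^bsub>H\<^esub> B x"

definition op_exp :: "('a, 'm) hilb_scheme \<Rightarrow> ('a \<Rightarrow> 'a) \<Rightarrow> 'a \<Rightarrow> 'a" where
  "op_exp H A x =
    (THE y. y \<in> carrier H \<and>
      hlim H (\<lambda>n. \<Oplus>\<^bsub>H\<^esub>k\<in>{..n}. (1 / fact k) \<odot>\<^bsub>H\<^esub> (A ^^ k) x) y sequentially)"

definition unitary_op :: "('a, 'm) hilb_scheme \<Rightarrow> ('a \<Rightarrow> 'a) \<Rightarrow> bool" where
  "unitary_op H U \<longleftrightarrow>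
    bij_betw U (carrier H) (carrier H) \<and>
    (\<forall>x\<in>carrier H. \<forall>y\<in>carrier H. U (x \<oplus>\<^bsub>H\<^esub> y) = U x \<oplus>\<^bsub>H\<^esub> U y) \<and>
    (\<forall>c. \<forall>x\<in>carrier H. U (c \<odot>\<^bsub>H\<^esub> x) = c \<odot>\<^bsub>H\<^esub> U x) \<and>
    (\<forall>x\<in>carrier H. \<forall>y\<in>carrier H. ip H (U x) (U y) = ip H x y)"

definition unitary_one_param_group :: "('a, 'm) hilb_scheme \<Rightarrow> (real \<Rightarrow> 'a \<Rightarrow> 'a) \<Rightarrow> bool" where
  "unitary_one_param_group H U \<longleftrightarrow>
    (\<forall>r. unitary_op H (U r)) \<and>
    (\<forall>x\<in>carrier H. U 0 x = x) \<and>
    (\<forall>r s. \<forall>x\<in>carrier H. U (r + s) x = U r (U s x)) \<and>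
    (\<forall>x\<in>carrier H. hlim H (\<lambda>r. U r x) x (at 0))"

text \<open>Unbounded operators are partial functions; \<^const>\<open>dom\<close> is the domain of the operator.
  The self-adjoint generator $A$ of $U_r = e^{\mathrm{i} r A}$ is given by Stone's theorem.\<close>

definition generator :: "('a, 'm) hilb_scheme \<Rightarrow> (real \<Rightarrow> 'a \<Rightarrow> 'a) \<Rightarrow> 'a \<rightharpoonup> 'a" where
  "generator H U x =
    (let is_deriv = (\<lambda>y. y \<in> carrier H \<and>
           hlim H (\<lambda>r. (1 / (\<i> * complex_of_real r)) \<odot>\<^bsub>H\<^esub> hdiff H (U r x) x) y (at 0))
     in if x \<in> carrier H \<and> (\<exists>y. is_deriv y) then Some (THE y. is_deriv y) else None)"

definition pop_add :: "('a, 'm) hilb_scheme \<Rightarrow> ('a \<rightharpoonup> 'a) \<Rightarrow> ('a \<rightharpoonup> 'a) \<Rightarrow> 'a \<rightharpoonup> 'a" where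
  "pop_add H A B x =
    (case (A x, B x) of (Some y, Some z) \<Rightarrow> Some (y \<oplus>\<^bsub>H\<^esub> z) | _ \<Rightarrow> None)"

definition pop_scale :: "('a, 'm) hilb_scheme \<Rightarrow> complex \<Rightarrow> ('a \<rightharpoonup> 'a) \<Rightarrow> 'a \<rightharpoonup> 'a" where
  "pop_scale H c A x = map_option (\<lambda>y. c \<odot>\<^bsub>H\<^esub> y) (A x)"

definition hilb_sum :: "(nat \<Rightarrow> 'a hilb) \<Rightarrow> (nat \<Rightarrow> 'a) hilb" where
  "hilb_sum H =
    \<lparr>carrier = {x. (\<forall>n. x n \<in> carrier (H n)) \<and> summable (\<lambda>n. (hnorm (H n) (x n))\<^sup>2)},
     mult = undefined, one = undefined,
     zero = (\<lambda>n. \<zero>\<^bsub>H n\<^esub>),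
     add = (\<lambda>x y n. x n \<oplus>\<^bsub>H n\<^esub> y n),
     smult = (\<lambda>c x n. c \<odot>\<^bsub>H n\<^esub> x n),
     ip = (\<lambda>x y. \<Sum>n. ip (H n) (x n) (y n))\<rparr>"


section \<open>Symmetric Fock space\<close>

text \<open>The $n$-fold Hilbert tensor power of $H$ is realised as the space of Hilbert--Schmidt
  conjugate-multilinear functionals on $H^n$, the elementary tensor $x_1\otimes\dots\otimes x_n$
  being $(y_1,\dots,y_n)\mapsto\prod_i\langle x_i,y_i\rangle$. Arguments are lists of length $n$
  over the carrier; elsewhere a functional is put equal to 0. The squared norm is
  $\sum_{b\in B^n}|F(b)|^2$ for any orthonormal basis $B$ of $H$, i.e. the supremum of these
  sums over finite orthonormal systems; the inner product is obtained by polarization.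
  The symmetric tensor power is the subspace of symmetric functionals.\<close>

definition tuples :: "'a set \<Rightarrow> nat \<Rightarrow> 'a list set" where
  "tuples A n = {xs. set xs \<subseteq> A \<and> length xs = n}"

definition conj_multilinear :: "('a, 'm) hilb_scheme \<Rightarrow> nat \<Rightarrow> ('a list \<Rightarrow> complex) \<Rightarrow> bool" where
  "conj_multilinear H n F \<longleftrightarrow>
    (\<forall>xs. xs \<notin> tuples (carrier H) n \<longrightarrow> F xs = 0) \<and>
    (\<forall>xs\<in>tuples (carrier H) n. \<forall>i<n. \<forall>x\<in>carrier H. \<forall>y\<in>carrier H.
       F (xs[i := x \<oplus>\<^bsub>H\<^esub> y]) = F (xs[i := x]) + F (xs[i := y])) \<and>
    (\<forall>xs\<in>tuples (carrier H) n. \<forall>i<n. \<forall>c. \<forall>x\<in>carrier H.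
       F (xs[i := c \<odot>\<^bsub>H\<^esub> x]) = cnj c * F (xs[i := x]))"

definition orthonormal :: "('a, 'm) hilb_scheme \<Rightarrow> 'a set \<Rightarrow> bool" where
  "orthonormal H E \<longleftrightarrow>
    E \<subseteq> carrier H \<and> (\<forall>x\<in>E. \<forall>y\<in>E. ip H x y = (if x = y then 1 else 0))"

definition hs_sums :: "('a, 'm) hilb_scheme \<Rightarrow> nat \<Rightarrow> ('a list \<Rightarrow> complex) \<Rightarrow> real set" where
  "hs_sums H n F =
    {\<Sum>b\<in>tuples E n. (cmod (F b))\<^sup>2 | E. finite E \<and> orthonormal H E}"

definition hs_norm2 :: "('a, 'm) hilb_scheme \<Rightarrow> nat \<Rightarrow> ('a list \<Rightarrow> complex) \<Rightarrow> real" where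
  "hs_norm2 H n F = Sup (hs_sums H n F)"

definition sym_power :: "('a, 'm) hilb_scheme \<Rightarrow> nat \<Rightarrow> ('a list \<Rightarrow> complex) hilb" where
  "sym_power H n =
    \<lparr>carrier = {F. conj_multilinear H n F \<and> bdd_above (hs_sums H n F) \<and>
                   (\<forall>xs ys. mset xs = mset ys \<longrightarrow> F xs = F ys)},
     mult = undefined, one = undefined,
     zero = (\<lambda>xs. 0),
     add = (\<lambda>F G xs. F xs + G xs),
     smult = (\<lambda>c F xs. c * F xs),
     ip = (\<lambda>F G. (\<Sum>k<4. \<i> ^ k * complex_of_real (hs_norm2 H n (\<lambda>xs. F xs + \<i> ^ k * G xs))) / 4)\<rparr>"

definition tensor_pow :: "('a, 'm) hilb_scheme \<Rightarrow> nat \<Rightarrow> 'a \<Rightarrow> 'a list \<Rightarrow> complex" where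
  "tensor_pow H n x ys = (if ys \<in> tuples (carrier H) n then \<Prod>y\<leftarrow>ys. ip H x y else 0)"

definition fock :: "('a, 'm) hilb_scheme \<Rightarrow> (nat \<Rightarrow> 'a list \<Rightarrow> complex) hilb" where
  "fock H = hilb_sum (sym_power H)"

definition exp_vec :: "('a, 'm) hilb_scheme \<Rightarrow> 'a \<Rightarrow> nat \<Rightarrow> 'a list \<Rightarrow> complex" where
  "exp_vec H x n = complex_of_real (1 / sqrt (fact n)) \<odot>\<^bsub>sym_power H n\<^esub> tensor_pow H n x"

text \<open>Exponential vectors are total, so the unitary group chosen by \<open>SOME\<close> is determined on
  the Fock space.\<close>

definition Lambda_sa ::
    "('a, 'm) hilb_scheme \<Rightarrow> ('a \<Rightarrow> 'a) \<Rightarrow> (nat \<Rightarrow> 'a list \<Rightarrow> complex) \<rightharpoonup> (nat \<Rightarrow> 'a list \<Rightarrow> complex)" where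
  "Lambda_sa H A =
    generator (fock H)
      (SOME U. unitary_one_param_group (fock H) U \<and>
        (\<forall>r. \<forall>x\<in>carrier H.
          U r (exp_vec H x) = exp_vec H (op_exp H (op_scale H (\<i> * complex_of_real r) A) x)))"

definition Lambda ::
    "('a, 'm) hilb_scheme \<Rightarrow> ('a \<Rightarrow> 'a) \<Rightarrow> (nat \<Rightarrow> 'a list \<Rightarrow> complex) \<rightharpoonup> (nat \<Rightarrow> 'a list \<Rightarrow> complex)" where
  "Lambda H A =
    pop_add (fock H)
      (Lambda_sa H (op_scale H (1 / 2) (op_add H A (hadjoint H A))))
      (pop_scale (fock H) \<i>
        (Lambda_sa H (op_scale H (1 / (2 * \<i>)) (op_add H A (op_scale H (-1) (hadjoint H A))))))"

definition expect ::
    "('a, 'm) hilb_scheme \<Rightarrow> ((nat \<Rightarrow> 'a list \<Rightarrow> complex) \<rightharpoonup> (nat \<Rightarrow> 'a list \<Rightarrow> complex)) \<Rightarrow> 'a \<Rightarrow> complex" where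
  "expect H X x =
    ip (fock H) (the (X (exp_vec H x))) (exp_vec H x) / ip (fock H) (exp_vec H x) (exp_vec H x)"


section \<open>The space of square-integrable functions on the half-line with values in a
  finite-dimensional space\<close>

type_synonym L2_elem = "(real \<Rightarrow> complex vec) set"

abbreviation half_line :: "real measure" where
  "half_line \<equiv> lebesgue_on {0..}"

definition L2_fun :: "nat \<Rightarrow> (real \<Rightarrow> complex vec) set" where
  "L2_fun d = {f. (\<forall>s. f s \<in> carrier_vec d) \<and>
     (\<forall>i<d. (\<lambda>s. vec_index (f s) i) \<in> borel_measurable half_line \<and>
            integrable half_line (\<lambda>s. (cmod (vec_index (f s) i))\<^sup>2))}"

definition L2_class :: "nat \<Rightarrow> (real \<Rightarrow> complex vec) \<Rightarrow> L2_elem" where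
  "L2_class d f = {g \<in> L2_fun d. AE s in half_line. g s = f s}"

definition L2_rep :: "L2_elem \<Rightarrow> real \<Rightarrow> complex vec" where
  "L2_rep X = (SOME f. f \<in> X)"

definition L2 :: "nat \<Rightarrow> L2_elem hilb" where
  "L2 d =
    \<lparr>carrier = L2_class d ` L2_fun d,
     mult = undefined, one = undefined,
     zero = L2_class d (\<lambda>s. 0\<^sub>v d),
     add = (\<lambda>X Y. L2_class d (\<lambda>s. L2_rep X s + L2_rep Y s)),
     smult = (\<lambda>c X. L2_class d (\<lambda>s. c \<cdot>\<^sub>v L2_rep X s)),
     ip = (\<lambda>X Y. \<integral>s. (L2_rep X s \<bullet>c L2_rep Y s) \<partial>half_line)\<rparr>"

definition one_tensor :: "nat \<Rightarrow> complex mat \<Rightarrow> L2_elem \<Rightarrow> L2_elem" where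
  "one_tensor d A X = L2_class d (\<lambda>s. A *\<^sub>v L2_rep X s)"

definition cutoff :: "nat \<Rightarrow> real \<Rightarrow> L2_elem \<Rightarrow> L2_elem" where
  "cutoff d t X = L2_class d (\<lambda>s. if s \<in> {0..t} then L2_rep X s else 0\<^sub>v d)"

definition step_vec :: "nat \<Rightarrow> real \<Rightarrow> complex vec \<Rightarrow> L2_elem" where
  "step_vec d t \<psi> = L2_class d (\<lambda>s. if s \<in> {0..<t} then \<psi> else 0\<^sub>v d)"

definition Lambda_t ::
    "nat \<Rightarrow> real \<Rightarrow> complex mat \<Rightarrow> (nat \<Rightarrow> L2_elem list \<Rightarrow> complex) \<rightharpoonup> (nat \<Rightarrow> L2_elem list \<Rightarrow> complex)" where
  "Lambda_t d t A = Lambda (L2 d) (one_tensor d A \<circ> cutoff d t)"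


section \<open>Irreducible representations of the unitary group\<close>

definition Sign :: "nat \<Rightarrow> int list set" where
  "Sign N = {lam. length lam = N \<and> sorted_wrt (\<ge>) lam}"

definition unitary_group :: "nat \<Rightarrow> complex mat set" where
  "unitary_group N = {U \<in> carrier_mat N N. mat_adjoint U * U = 1\<^sub>m N}"

text \<open>The representation space is $\mathbb{C}^d$ with its standard inner product.\<close>

definition unitary_rep :: "nat \<Rightarrow> nat \<Rightarrow> (complex mat \<Rightarrow> complex mat) \<Rightarrow> bool" where
  "unitary_rep N d \<pi> \<longleftrightarrow>
    (\<forall>U\<in>unitary_group N. \<pi> U \<in> unitary_group d) \<and>
    \<pi> (1\<^sub>m N) = 1\<^sub>m d \<and>
    (\<forall>U\<in>unitary_group N. \<forall>V\<in>unitary_group N. \<pi> (U * V) = \<pi> U * \<pi> V) \<and>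
    (\<forall>U V. (\<forall>n. U n \<in> unitary_group N) \<and> V \<in> unitary_group N \<and>
       (\<forall>i<N. \<forall>j<N. (\<lambda>n. U n $$ (i, j)) \<longlonglongrightarrow> V $$ (i, j)) \<longrightarrow>
       (\<forall>a<d. \<forall>b<d. (\<lambda>n. \<pi> (U n) $$ (a, b)) \<longlonglongrightarrow> \<pi> V $$ (a, b)))"

definition irreducible_rep :: "nat \<Rightarrow> nat \<Rightarrow> (complex mat \<Rightarrow> complex mat) \<Rightarrow> bool" where
  "irreducible_rep N d \<pi> \<longleftrightarrow>
    unitary_rep N d \<pi> \<and> d > 0 \<and>
    (\<forall>W \<subseteq> carrier_vec d.
       0\<^sub>v d \<in> W \<and> (\<forall>v\<in>W. \<forall>w\<in>W. v + w \<in> W) \<and> (\<forall>c. \<forall>v\<in>W. c \<cdot>\<^sub>v v \<in> W) \<and>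
       (\<forall>U\<in>unitary_group N. \<forall>v\<in>W. \<pi> U *\<^sub>v v \<in> W) \<longrightarrow>
       W = {0\<^sub>v d} \<or> W = carrier_vec d)"

definition mat_exp :: "nat \<Rightarrow> complex mat \<Rightarrow> complex mat" where
  "mat_exp N A = Matrix.mat N N (\<lambda>(i, j). \<Sum>k. (A ^\<^sub>m k) $$ (i, j) / fact k)"

definition diff_rep :: "nat \<Rightarrow> nat \<Rightarrow> (complex mat \<Rightarrow> complex mat) \<Rightarrow> complex mat \<Rightarrow> complex mat" where
  "diff_rep N d \<pi> A =
    Matrix.mat d d (\<lambda>(a, b).
      vector_derivative (\<lambda>r. \<pi> (mat_exp N (complex_of_real r \<cdot>\<^sub>m A)) $$ (a, b)) (at 0))"

text \<open>Complexification, via $\mathfrak{gl}_N=\mathfrak{u}(N)\oplus\mathrm{i}\,\mathfrak{u}(N)$: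
  $A=\frac{A-A^*}{2}+\mathrm{i}\,\frac{A+A^*}{2\mathrm{i}}$.\<close>

definition gl_rep :: "nat \<Rightarrow> nat \<Rightarrow> (complex mat \<Rightarrow> complex mat) \<Rightarrow> complex mat \<Rightarrow> complex mat" where
  "gl_rep N d \<pi> A =
    diff_rep N d \<pi> ((1 / 2) \<cdot>\<^sub>m (A - mat_adjoint A)) +
    \<i> \<cdot>\<^sub>m diff_rep N d \<pi> ((1 / (2 * \<i>)) \<cdot>\<^sub>m (A + mat_adjoint A))"

definition unit_mat :: "nat \<Rightarrow> nat \<times> nat \<Rightarrow> complex mat" where
  "unit_mat N ij = Matrix.mat N N (\<lambda>kl. if kl = ij then 1 else 0)"

definition highest_weight ::
    "nat \<Rightarrow> nat \<Rightarrow> (complex mat \<Rightarrow> complex mat) \<Rightarrow> int list \<Rightarrow> bool" where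
  "highest_weight N d \<pi> lam \<longleftrightarrow>
    (\<exists>v\<in>carrier_vec d. v \<noteq> 0\<^sub>v d \<and>
      (\<forall>j<N. \<forall>i<j. gl_rep N d \<pi> (unit_mat N (i, j)) *\<^sub>v v = 0\<^sub>v d) \<and>
      (\<forall>i<N. gl_rep N d \<pi> (unit_mat N (i, i)) *\<^sub>v v = of_int (lam ! i) \<cdot>\<^sub>v v))"


section \<open>The universal enveloping algebra of gl(N) and quantum immanants\<close>

text \<open>The free algebra on generators $E_{ij}$, $i,j<N$: finitely supported functions on words.\<close>

definition free_alg :: "nat \<Rightarrow> ((nat \<times> nat) list \<Rightarrow> complex) ring" where
  "free_alg N =
    \<lparr>carrier = {f. finite {w. f w \<noteq> 0} \<and> (\<forall>w. f w \<noteq> 0 \<longrightarrow> set w \<subseteq> {..<N} \<times> {..<N})},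
     mult = (\<lambda>f g w. \<Sum>k\<le>length w. f (take k w) * g (drop k w)),
     one = (\<lambda>w. if w = [] then 1 else 0),
     zero = (\<lambda>w. 0),
     add = (\<lambda>f g w. f w + g w)\<rparr>"

definition word :: "(nat \<times> nat) list \<Rightarrow> (nat \<times> nat) list \<Rightarrow> complex" where
  "word v = (\<lambda>w. if w = v then 1 else 0)"

text \<open>$E_{ij}E_{kl}-E_{kl}E_{ij}-\delta_{jk}E_{il}+\delta_{li}E_{kj}$\<close>

definition gl_relation :: "nat \<Rightarrow> nat \<Rightarrow> nat \<Rightarrow> nat \<Rightarrow> (nat \<times> nat) list \<Rightarrow> complex" where
  "gl_relation i j k l = (\<lambda>w. word [(i, j), (k, l)] w - word [(k, l), (i, j)] w
     - (if j = k then word [(i, l)] w else 0) + (if l = i then word [(k, j)] w else 0))"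

definition gl_ideal :: "nat \<Rightarrow> ((nat \<times> nat) list \<Rightarrow> complex) set" where
  "gl_ideal N = Idl\<^bsub>free_alg N\<^esub> {gl_relation i j k l | i j k l. i < N \<and> j < N \<and> k < N \<and> l < N}"

definition U_gl :: "nat \<Rightarrow> ((nat \<times> nat) list \<Rightarrow> complex) set ring" where
  "U_gl N = free_alg N Quot gl_ideal N"

definition Z_gl :: "nat \<Rightarrow> ((nat \<times> nat) list \<Rightarrow> complex) set set" where
  "Z_gl N = {z \<in> carrier (U_gl N). \<forall>x\<in>carrier (U_gl N). z \<otimes>\<^bsub>U_gl N\<^esub> x = x \<otimes>\<^bsub>U_gl N\<^esub> z}"

definition free_rep ::
    "nat \<Rightarrow> nat \<Rightarrow> (complex mat \<Rightarrow> complex mat) \<Rightarrow> ((nat \<times> nat) list \<Rightarrow> complex) \<Rightarrow> complex mat" where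
  "free_rep N d \<pi> f =
    Matrix.mat d d (\<lambda>(a, b). \<Sum>w | f w \<noteq> 0.
      f w * foldr (\<lambda>ij M. gl_rep N d \<pi> (unit_mat N ij) * M) w (1\<^sub>m d) $$ (a, b))"

definition U_rep ::
    "nat \<Rightarrow> nat \<Rightarrow> (complex mat \<Rightarrow> complex mat) \<Rightarrow> ((nat \<times> nat) list \<Rightarrow> complex) set \<Rightarrow> complex mat" where
  "U_rep N d \<pi> X = the_elem (free_rep N d \<pi> ` X)"

definition falling :: "real \<Rightarrow> nat \<Rightarrow> real" where
  "falling x k = (\<Prod>i<k. x - real i)"

definition is_partition :: "nat list \<Rightarrow> bool" where
  "is_partition \<mu> \<longleftrightarrow> sorted_wrt (\<ge>) \<mu> \<and> 0 \<notin> set \<mu>"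

definition part :: "nat list \<Rightarrow> nat \<Rightarrow> nat" where
  "part \<mu> i = (if i < length \<mu> then \<mu> ! i else 0)"

text \<open>Indices start from 0 here and below, so that $N-i$ becomes \<^term>\<open>N - Suc i\<close>.\<close>

definition shifted_schur :: "nat \<Rightarrow> nat list \<Rightarrow> (nat \<Rightarrow> real) \<Rightarrow> real" where
  "shifted_schur N \<mu> x =
    Determinant.det (Matrix.mat N N (\<lambda>(i, j).
      falling (x i + real (N - Suc i)) (part \<mu> j + (N - Suc j)))) /
    Determinant.det (Matrix.mat N N (\<lambda>(i, j).
      falling (x i + real (N - Suc i)) (N - Suc j)))"

text \<open>The defining property of the quantum immanant; the irreducible representations separate
  the points of the enveloping algebra, so it holds for one element only.\<close>

definition quantum_immanant ::
    "nat \<Rightarrow> nat list \<Rightarrow> ((nat \<times> nat) list \<Rightarrow> complex) set \<Rightarrow> bool" where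
  "quantum_immanant N \<mu> S \<longleftrightarrow>
    S \<in> Z_gl N \<and>
    (\<forall>lam\<in>Sign N. \<forall>d \<pi>. irreducible_rep N d \<pi> \<and> highest_weight N d \<pi> lam \<longrightarrow>
      U_rep N d \<pi> S =
        complex_of_real (shifted_schur N \<mu> (\<lambda>i. real_of_int (lam ! i))) \<cdot>\<^sub>m 1\<^sub>m d)"


section \<open>Boundary parameters and Vershik--Kerov sequences\<close>

record param =
  alpha_p :: "nat \<Rightarrow> real"
  alpha_m :: "nat \<Rightarrow> real"
  beta_p :: "nat \<Rightarrow> real"
  beta_m :: "nat \<Rightarrow> real"
  gamma_p :: real
  gamma_m :: real

definition Omega :: "param set" where
  "Omega = {\<omega>.
    (\<forall>i. alpha_p \<omega> i \<ge> 0 \<and> alpha_m \<omega> i \<ge> 0 \<and> beta_p \<omega> i \<ge> 0 \<and> beta_m \<omega> i \<ge> 0) \<and>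
    gamma_p \<omega> \<ge> 0 \<and> gamma_m \<omega> \<ge> 0 \<and>
    decseq (alpha_p \<omega>) \<and> decseq (alpha_m \<omega>) \<and> decseq (beta_p \<omega>) \<and> decseq (beta_m \<omega>) \<and>
    summable (\<lambda>i. alpha_p \<omega> i + beta_p \<omega> i) \<and> summable (\<lambda>i. alpha_m \<omega> i + beta_m \<omega> i) \<and>
    beta_p \<omega> 0 + beta_m \<omega> 0 \<le> 1}"

definition Phi :: "param \<Rightarrow> complex \<Rightarrow> complex" where
  "Phi \<omega> z =
    exp (of_real (gamma_p \<omega>) * (z - 1) + of_real (gamma_m \<omega>) * (inverse z - 1)) *
    prodinf (\<lambda>j.
      (1 + of_real (beta_p \<omega> j) * (z - 1)) / (1 - of_real (alpha_p \<omega> j) * (z - 1)) *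
      ((1 + of_real (beta_m \<omega> j) * (inverse z - 1)) / (1 - of_real (alpha_m \<omega> j) * (inverse z - 1))))"

definition h_param :: "param \<Rightarrow> int \<Rightarrow> complex" where
  "h_param \<omega> k =
    (if k < 0 then 0 else fps_nth (fps_expansion (\<lambda>x. Phi \<omega> (1 + x)) 0) (nat k))"

text \<open>The determinant does not change when \<open>\<mu>\<close> is padded by zeros; we take the size to be
  the length of \<open>\<mu>\<close>.\<close>

definition schur_param :: "nat list \<Rightarrow> param \<Rightarrow> complex" where
  "schur_param \<mu> \<omega> =
    Determinant.det (Matrix.mat (length \<mu>) (length \<mu>)
      (\<lambda>(i, j). h_param \<omega> (int (part \<mu> i) - int i + int j)))"

definition sig_pos :: "int list \<Rightarrow> nat \<Rightarrow> nat" where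
  "sig_pos lam i = (if i < length lam then nat (lam ! i) else 0)"

definition sig_neg :: "int list \<Rightarrow> nat \<Rightarrow> nat" where
  "sig_neg lam = sig_pos (map uminus (rev lam))"

definition transposed :: "(nat \<Rightarrow> nat) \<Rightarrow> nat \<Rightarrow> nat" where
  "transposed p i = card {j. i < p j}"

text \<open>$p_i-i+\frac12$ for indices $i$ starting from 1\<close>

definition half_coord :: "(nat \<Rightarrow> nat) \<Rightarrow> nat \<Rightarrow> real" where
  "half_coord p i = real (p i) - real (Suc i) + 1 / 2"

definition vershik_kerov :: "(nat \<Rightarrow> nat) \<Rightarrow> (nat \<Rightarrow> int list) \<Rightarrow> param \<Rightarrow> bool" where
  "vershik_kerov N lam \<omega> \<longleftrightarrow>
    (\<forall>i. (\<lambda>L. half_coord (sig_pos (lam L)) i / real (N L)) \<longlonglongrightarrow> alpha_p \<omega> i) \<and>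
    (\<forall>i. (\<lambda>L. half_coord (sig_neg (lam L)) i / real (N L)) \<longlonglongrightarrow> alpha_m \<omega> i) \<and>
    (\<forall>i. (\<lambda>L. half_coord (transposed (sig_pos (lam L))) i / real (N L)) \<longlonglongrightarrow> beta_p \<omega> i) \<and>
    (\<forall>i. (\<lambda>L. half_coord (transposed (sig_neg (lam L))) i / real (N L)) \<longlonglongrightarrow> beta_m \<omega> i) \<and>
    (\<exists>\<delta>p \<delta>m.
      (\<lambda>L. real (\<Sum>i<N L. sig_pos (lam L) i) / real (N L)) \<longlonglongrightarrow> \<delta>p \<and>
      (\<lambda>L. real (\<Sum>i<N L. sig_neg (lam L) i) / real (N L)) \<longlonglongrightarrow> \<delta>m \<and>
      gamma_p \<omega> = \<delta>p - (\<Sum>i. alpha_p \<omega> i + beta_p \<omega> i) \<and>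
      gamma_m \<omega> = \<delta>m - (\<Sum>i. alpha_m \<omega> i + beta_m \<omega> i))"

end

theory Submission
  imports Defs
begin

text \<open>
  The quantum immanant acts in an irreducible representation by the scalar
  $c = s^*_\mu(\lambda)$, and for real $c$ the operator $\Lambda(c P)$, $P$ the multiplication by
  the indicator function of $[0,t]$, generates the second quantization of
  $1 + (e^{\mathrm{i} r c} - 1) P$. Differentiating $e(\varphi) \mapsto e(e^{\mathrm{i} r c}\varphi)$
  for $\varphi = \psi_t$ in the range of $P$ gives the expectation $c \langle\varphi,\varphi\rangle = c t$.

  It remains to see that $s^*_\mu(\lambda(N)) / N^{|\mu|} \to s_\mu(\omega)$. Put $z_i = \lambda_i - i$.
  Multiplying numerator and denominator of $s^*_\mu$ by the matrix
  $(z_a^i / \prod_{b \ne a} (z_a - z_b))_{i,a}$ turns all entries into divided differences of polynomials,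
  which are coefficients of $\prod_{k<m} (1 + (N-k) x) \prod_a (1 - z_a x)^{-1}$; the determinant collapses
  to one of size $\ell(\mu)$. The logarithmic coefficients of these series are, up to bounded errors, the sums
  $\sum_i ((\lambda_i - i)^k - (-i)^k)$. They are polynomial statistics of the contents of the boxes of
  $\lambda^\pm$, and converge after scaling by dominated convergence over arms and legs. The limits are
  the logarithmic coefficients of $\Phi_\omega(1+x)$, so that the coefficients converge to $h_k(\omega)$ by
  Newton's recursion.
\<close>

section \<open>Divided differences and the Jacobi--Trudi form of shifted Schur polynomials\<close>

text \<open>The determinants in \<open>shifted_schur\<close> grow with N, so no limit can be taken
  entry by entry. What makes the reduction to a fixed size possible is that numerator and
  denominator have the same columns beyond the length of \<open>\<mu>\<close>; after the
  multiplication these form a unitriangular block. In the content sums only the number of boxes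
  resists dominated convergence: mass can escape into rows and columns of vanishing relative length.
  The lost mass is \<gamma>, so this one moment is read off from the definition of a Vershik--Kerov
  sequence. On the operator side, \<open>generator\<close> is undefined where its limit does not
  exist, and the unitary group is picked by \<open>SOME\<close>. An explicit group has therefore to
  be exhibited on the whole Fock space, strong continuity included; afterwards every admissible
  choice has the same orbit through an exponential vector. The inner product of the symmetric powers
  is the polarization of a supremum. It is evaluated only on multiples of one functional; elsewhere
  invariance of \<open>hs_norm2\<close> is enough.\<close>

definition node_weight :: "'a::field set \<Rightarrow> 'a \<Rightarrow> 'a" where
  "node_weight A a = (\<Prod>b\<in>A - {a}. a - b)"

abbreviation geom_fps :: "'a::field \<Rightarrow> 'a fps" where
  "geom_fps a \<equiv> inverse (1 - fps_const a * fps_X)"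

lemma node_weight_insert:
  assumes "finite A" "z \<notin> A" "a \<in> A"
  shows "node_weight (insert z A) a = node_weight A a * (a - z)"
proof -
  have "insert z A - {a} = insert z (A - {a})" using assms by auto
  then show ?thesis using assms by (simp add: node_weight_def)
qed

lemma node_weight_insert_self:
  assumes "z \<notin> A"
  shows "node_weight (insert z A) z = (\<Prod>a\<in>A. z - a)"
  using assms by (simp add: node_weight_def)

lemma node_weight_nonzero:
  assumes "finite A"
  shows "node_weight A a \<noteq> 0"
  using assms by (auto simp: node_weight_def)

text \<open>Adjoining a node \<open>w\<close> adds a term at \<open>w\<close>, which the induction
  hypothesis, used at the point \<open>w\<close>, turns into a sum over \<open>A\<close>. The
  summands then combine by 1/((w-a)(z-w)) - 1/((w-a)(z-a)) = 1/((z-a)(z-w)).\<close>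

lemma partial_fractions:
  fixes A :: "'a::field set"
  assumes "finite A" "A \<noteq> {}" "z \<notin> A"
  shows "(\<Sum>a\<in>A. 1 / (node_weight A a * (z - a))) = 1 / (\<Prod>a\<in>A. z - a)"
  using assms
proof (induction A arbitrary: z rule: finite_ne_induct)
  case (singleton a)
  then show ?case by (simp add: node_weight_def)
next
  case (insert w A)
  have zw: "z \<noteq> w" "z \<notin> A" using insert by auto
  have IHz: "(\<Sum>a\<in>A. 1 / (node_weight A a * (z - a))) = 1 / (\<Prod>a\<in>A. z - a)"
    and IHw: "(\<Sum>a\<in>A. 1 / (node_weight A a * (w - a))) = 1 / (\<Prod>a\<in>A. w - a)"
    using insert zw by auto
  have "(\<Sum>a\<in>insert w A. 1 / (node_weight (insert w A) a * (z - a))) =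
     1 / ((\<Prod>a\<in>A. w - a) * (z - w)) + (\<Sum>a\<in>A. 1 / (node_weight A a * (a - w) * (z - a)))"
    using insert by (simp add: node_weight_insert node_weight_insert_self)
  also have "1 / ((\<Prod>a\<in>A. w - a) * (z - w)) = (\<Sum>a\<in>A. 1 / (node_weight A a * (w - a))) / (z - w)"
    by (simp add: IHw)
  also have "\<dots> = (\<Sum>a\<in>A. 1 / (node_weight A a * (w - a) * (z - w)))"
    by (simp add: sum_divide_distrib)
  also have "\<dots> + (\<Sum>a\<in>A. 1 / (node_weight A a * (a - w) * (z - a)))
     = (\<Sum>a\<in>A. 1 / (node_weight A a * (z - a)) / (z - w))"
    unfolding sum.distrib [symmetric]
  proof (rule sum.cong)
    fix a assume a: "a \<in> A"
    have nz: "node_weight A a \<noteq> 0" "w - a \<noteq> 0" "a - w \<noteq> 0" "z - a \<noteq> 0" "z - w \<noteq> 0"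
      using a zw insert node_weight_nonzero by auto
    have "1 / (node_weight A a * (w - a) * (z - w)) + 1 / (node_weight A a * (a - w) * (z - a))
       = 1 / node_weight A a * (1 / ((w - a) * (z - w)) + 1 / ((a - w) * (z - a)))"
      by (simp only: distrib_left times_divide_times_eq mult_1 mult.assoc)
    also have "1 / ((w - a) * (z - w)) + 1 / ((a - w) * (z - a)) = 1 / ((z - a) * (z - w))"
    proof -
      have "1 / ((a - w) * (z - a)) = - (1 / ((w - a) * (z - a)))"
        using minus_divide_right minus_mult_left by (metis minus_diff_eq)
      then show ?thesis using nz by (simp add: divide_simps) (simp add: algebra_simps)
    qed
    finally show "1 / (node_weight A a * (w - a) * (z - w)) + 1 / (node_weight A a * (a - w) * (z - a))
       = 1 / (node_weight A a * (z - a)) / (z - w)" by simp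
  qed simp
  also have "\<dots> = (1 / (\<Prod>a\<in>A. z - a)) / (z - w)"
    by (simp only: sum_divide_distrib [symmetric] IHz)
  finally show ?case using insert by simp
qed

lemma geom_fps_unit: "(1 - fps_const a * fps_X) * geom_fps a = (1::'a::field fps)"
  by (rule inverse_mult_eq_1') simp

lemma fps_const_sum: "fps_const (\<Sum>a\<in>A. f a) = (\<Sum>a\<in>A. fps_const (f a))"
  by (rule fps_ext) (simp add: fps_sum_nth)

text \<open>The resolvent identity for geometric series: clearing both denominators leaves (1 - zX)
  - (1 - aX) = (a - z)X.\<close>

lemma geom_fps_mult:
  fixes a z :: "'a::field"
  assumes "a \<noteq> z"
  shows "fps_X * geom_fps z * geom_fps a = fps_const (1 / (a - z)) * (geom_fps a - geom_fps z)"
proof -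
  let ?p = "\<lambda>a::'a. 1 - fps_const a * fps_X"
  have aux: "q * (p * x) - p * (q * y) = p * q * (x - y)" for p q x y :: "'a fps"
    by (simp add: algebra_simps)
  have "?p a * ?p z * (fps_const (a - z) * (fps_X * geom_fps z * geom_fps a))
      = fps_const (a - z) * fps_X * (?p a * geom_fps a) * (?p z * geom_fps z)"
    by (simp only: mult_ac)
  also have "\<dots> = fps_const (a - z) * fps_X" by (simp only: geom_fps_unit mult_1_right)
  also have "\<dots> = ?p z * (?p a * geom_fps a) - ?p a * (?p z * geom_fps z)"
    unfolding geom_fps_unit mult_1_right by (simp add: left_diff_distrib flip: fps_const_sub)
  also have "\<dots> = ?p a * ?p z * (geom_fps a - geom_fps z)"
    by (rule aux)
  finally have "?p a * ?p z * (fps_const (a - z) * (fps_X * geom_fps z * geom_fps a))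
     = ?p a * ?p z * (geom_fps a - geom_fps z)" .
  moreover have "?p a \<noteq> 0" for a :: 'a
    by (metis geom_fps_unit mult_zero_left zero_neq_one)
  ultimately have *: "fps_const (a - z) * (fps_X * geom_fps z * geom_fps a) = geom_fps a - geom_fps z"
    by simp
  have "fps_const (1 / (a - z)) * (geom_fps a - geom_fps z)
     = (fps_const (1 / (a - z)) * fps_const (a - z)) * (fps_X * geom_fps z * geom_fps a)"
    by (simp only: * [symmetric] mult.assoc)
  then show ?thesis using assms by simp
qed

text \<open>Node weights are the denominators in Lagrange's formula for divided differences. Read
  coefficientwise, the divided difference of the n-th power is the complete homogeneous polynomial
  of degree n - (card A - 1) in the nodes.\<close>

lemma partial_fractions_fps:
  fixes A :: "'a::field set"
  assumes "finite A" "A \<noteq> {}"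
  shows "(\<Sum>a\<in>A. fps_const (1 / node_weight A a) * geom_fps a) =
    fps_X ^ (card A - 1) * (\<Prod>a\<in>A. geom_fps a)"
  using assms
proof (induction A rule: finite_ne_induct)
  case (singleton a)
  then show ?case by (simp add: node_weight_def)
next
  case (insert z A)
  obtain k where card: "card A = Suc k" using insert by (cases "card A") auto
  have "fps_X ^ (card (insert z A) - 1) * (\<Prod>a\<in>insert z A. geom_fps a)
     = fps_X * geom_fps z * (fps_X ^ (card A - 1) * (\<Prod>a\<in>A. geom_fps a))"
    using insert card by (simp add: mult_ac)
  also have "\<dots> = (\<Sum>a\<in>A. fps_const (1 / node_weight A a) * (fps_X * geom_fps z * geom_fps a))"
    unfolding insert.IH [symmetric] sum_distrib_left by (simp only: mult_ac)
  also have "\<dots> = (\<Sum>a\<in>A. fps_const (1 / node_weight (insert z A) a) * (geom_fps a - geom_fps z))"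
  proof (rule sum.cong)
    fix a assume a: "a \<in> A"
    then have "a \<noteq> z" using insert by auto
    then show "fps_const (1 / node_weight A a) * (fps_X * geom_fps z * geom_fps a)
      = fps_const (1 / node_weight (insert z A) a) * (geom_fps a - geom_fps z)"
      using a insert by (simp add: geom_fps_mult node_weight_insert mult.assoc [symmetric])
  qed simp
  also have "\<dots> = (\<Sum>a\<in>A. fps_const (1 / node_weight (insert z A) a) * geom_fps a)
     - fps_const (\<Sum>a\<in>A. 1 / node_weight (insert z A) a) * geom_fps z"
    by (simp only: right_diff_distrib sum_subtractf sum_distrib_right fps_const_sum)
  \<comment> \<open>The coefficient collected at \<open>geom_fps z\<close> has to be the missing
    weight \<open>1 / node_weight (insert z A) z\<close>; this is \<open>partial_fractions\<close>
    at the point \<open>z\<close>.\<close>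
  also have "(\<Sum>a\<in>A. 1 / node_weight (insert z A) a) = - (\<Sum>a\<in>A. 1 / (node_weight A a * (z - a)))"
    unfolding sum_negf [symmetric]
  proof (rule sum.cong)
    fix a assume a: "a \<in> A"
    show "1 / node_weight (insert z A) a = - (1 / (node_weight A a * (z - a)))"
    proof -
      have "a - z = - (z - a)" by simp
      then show ?thesis
        unfolding node_weight_insert [OF \<open>finite A\<close> \<open>z \<notin> A\<close> a]
        by (simp only: mult_minus_right minus_divide_right [symmetric])
    qed
  qed simp
  also have "\<dots> = - (1 / node_weight (insert z A) z)"
    using insert by (simp add: partial_fractions node_weight_insert_self)
  finally show ?case using insert by (simp flip: fps_const_neg)
qed

lemma fps_nth_geom_fps: "fps_nth (geom_fps (a::'a::field)) n = a ^ n"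
proof -
  have "(1 - fps_const a * fps_X) * Abs_fps (\<lambda>n. a ^ n) = 1"
  proof (rule fps_ext)
    fix n show "fps_nth ((1 - fps_const a * fps_X) * Abs_fps (\<lambda>n. a ^ n)) n = fps_nth 1 n"
      by (cases n) (auto simp: ring_distribs mult.assoc)
  qed
  then have "geom_fps a = Abs_fps (\<lambda>n. a ^ n)"
    by (metis fps_inverse_unique)
  then show ?thesis by simp
qed

lemma fps_nth_mult_linear:
  "fps_nth (Q * (1 + fps_const c * fps_X)) (Suc n) = fps_nth Q (Suc n) + c * fps_nth Q n"
  for c :: "'a::comm_ring_1"
proof -
  have "Q * (1 + fps_const c * fps_X) = Q + fps_const c * (Q * fps_X)"
    by (simp add: algebra_simps)
  then show ?thesis by simp
qed

text \<open>A further factor \<open>a + c m\<close> gives the sum with one more power of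
  \<open>a\<close> plus \<open>c m\<close> times the old sum. Coefficients follow the same rule
  under multiplication by 1 + (c m) X, which drives the induction on \<open>m\<close>.\<close>

lemma node_sum_eq_fps_nth:
  fixes A :: "'a::field set" and c :: "nat \<Rightarrow> 'a"
  assumes "finite A" "A \<noteq> {}"
  shows "(\<Sum>a\<in>A. a ^ i * (\<Prod>k<m. a + c k) / node_weight A a) =
    fps_nth (fps_X ^ (card A - 1) * ((\<Prod>k<m. 1 + fps_const (c k) * fps_X) * (\<Prod>a\<in>A. geom_fps a))) (i + m)"
proof (induction m arbitrary: i)
  case 0
  have "(\<Sum>a\<in>A. a ^ i / node_weight A a) = fps_nth (\<Sum>a\<in>A. fps_const (1 / node_weight A a) * geom_fps a) i"
    by (simp add: fps_sum_nth fps_nth_geom_fps)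
  then show ?case using partial_fractions_fps [OF assms] by simp
next
  case (Suc m)
  let ?Q = "fps_X ^ (card A - 1) * ((\<Prod>k<m. 1 + fps_const (c k) * fps_X) * (\<Prod>a\<in>A. geom_fps a))"
  have "(\<Sum>a\<in>A. a ^ i * (\<Prod>k<Suc m. a + c k) / node_weight A a)
     = (\<Sum>a\<in>A. a ^ Suc i * (\<Prod>k<m. a + c k) / node_weight A a)
       + c m * (\<Sum>a\<in>A. a ^ i * (\<Prod>k<m. a + c k) / node_weight A a)"
    unfolding sum_distrib_left sum.distrib [symmetric]
    by (rule sum.cong) (simp_all add: algebra_simps add_divide_distrib)
  also have "\<dots> = fps_nth ?Q (Suc i + m) + c m * fps_nth ?Q (i + m)"
    by (simp only: Suc.IH)
  also have "\<dots> = fps_nth (?Q * (1 + fps_const (c m) * fps_X)) (i + Suc m)"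
    by (simp only: fps_nth_mult_linear add_Suc add_Suc_right)
  finally show ?case by (simp add: mult_ac)
qed

text \<open>The nodes are \<lambda>_i - i with i counted from 1. The linear factors come from the
  falling factorial, whose k-th factor \<open>x a + (N - Suc a) - k\<close> is the node plus
  \<open>N - k\<close>.\<close>

definition shifted_schur_series :: "nat \<Rightarrow> (nat \<Rightarrow> real) \<Rightarrow> nat \<Rightarrow> real fps" where
  "shifted_schur_series N x m =
    (\<Prod>k<m. 1 + fps_const (real N - real k) * fps_X) * (\<Prod>a<N. geom_fps (x a - real (Suc a)))"

lemma fps_nth_0_shifted_schur_series: "fps_nth (shifted_schur_series N x m) 0 = 1"
  by (simp add: shifted_schur_series_def fps_prod_nth' fps_nth_geom_fps)

lemma det_lower_unitriangular:
  fixes A :: "'a::comm_ring_1 mat"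
  assumes "A \<in> carrier_mat n n"
    and "\<And>i j. i < j \<Longrightarrow> j < n \<Longrightarrow> A $$ (i, j) = 0"
    and "\<And>i. i < n \<Longrightarrow> A $$ (i, i) = 1"
  shows "Determinant.det A = 1"
proof -
  have "Determinant.det A = prod_list (diag_mat A)"
    using assms by (intro det_lower_triangular)
  also have "diag_mat A = map (\<lambda>i. 1) [0..<n]"
    using assms by (auto simp: diag_mat_def)
  also have "prod_list (map (\<lambda>i. 1) [0..<n]) = (1::'a)"
    by (induction n) auto
  finally show ?thesis .
qed

text \<open>Numerator and denominator are multiplied by the same matrix \<open>B\<close>, whose
  determinant cancels. The product with the denominator is unitriangular, so no Vandermonde
  determinant has to be evaluated.\<close>

lemma shifted_schur_eq_det:
  fixes x :: "nat \<Rightarrow> real"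
  assumes len: "length \<mu> \<le> N" and "N > 0"
    and inj: "inj_on (\<lambda>a. x a - real (Suc a)) {..<N}"
  defines "m \<equiv> \<lambda>j. part \<mu> j + (N - Suc j)"
  shows "shifted_schur N \<mu> x = Determinant.det (Matrix.mat (length \<mu>) (length \<mu>)
    (\<lambda>(i, j). fps_nth (fps_X ^ (N - 1) * shifted_schur_series N x (m j)) (i + m j)))"
proof -
  define n where "n = length \<mu>"
  define z where "z = (\<lambda>a. x a - real (Suc a))"
  define Z where "Z = z ` {..<N}"
  define e where "e = (\<lambda>i m. fps_nth (fps_X ^ (N - 1) * shifted_schur_series N x m) (i + m))"
  define A where "A = (\<lambda>m. Matrix.mat N N (\<lambda>(a, j). falling (x a + real (N - Suc a)) (m j)))"
  define B where "B = Matrix.mat N N (\<lambda>(i, a). z a ^ i / node_weight Z (z a))"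
  have injz: "inj_on z {..<N}" using inj by (simp add: z_def)
  have Z: "finite Z" "Z \<noteq> {}" "card Z = N"
    using \<open>N > 0\<close> by (auto simp: Z_def card_image [OF injz])
  have falling_z: "falling (x a + real (N - Suc a)) m = (\<Prod>k<m. z a + (real N - real k))"
    if "a < N" for a m
    unfolding falling_def z_def using that
    by (intro prod.cong) (auto simp: of_nat_diff)
  have BA: "B * A m = Matrix.mat N N (\<lambda>(i, j). e i (m j))" for m
  proof (rule eq_matI)
    fix i j assume ij: "i < dim_row (Matrix.mat N N (\<lambda>(i, j). e i (m j)))"
      "j < dim_col (Matrix.mat N N (\<lambda>(i, j). e i (m j)))"
    then have "(B * A m) $$ (i, j) = (\<Sum>a<N. z a ^ i / node_weight Z (z a) * falling (x a + real (N - Suc a)) (m j))"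
      by (simp add: B_def A_def scalar_prod_def lessThan_atLeast0)
    also have "\<dots> = (\<Sum>a<N. z a ^ i / node_weight Z (z a) * (\<Prod>k<m j. z a + (real N - real k)))"
      by (intro sum.cong refl arg_cong2 [where f = "(*)"] falling_z) auto
    also have "\<dots> = (\<Sum>a\<in>Z. a ^ i * (\<Prod>k<m j. a + (real N - real k)) / node_weight Z a)"
      unfolding Z_def by (subst sum.reindex [OF injz]) (simp add: mult_ac)
    also have "\<dots> = fps_nth (fps_X ^ (N - 1) *
        ((\<Prod>k<m j. 1 + fps_const (real N - real k) * fps_X) * (\<Prod>a\<in>Z. geom_fps a))) (i + m j)"
      using node_sum_eq_fps_nth [OF Z(1,2)] Z(3) by simp
    also have "(\<Prod>a\<in>Z. geom_fps a) = (\<Prod>a<N. geom_fps (z a))"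
      unfolding Z_def by (subst prod.reindex [OF injz]) simp
    finally show "(B * A m) $$ (i, j) = Matrix.mat N N (\<lambda>(i, j). e i (m j)) $$ (i, j)"
      using ij by (simp add: e_def shifted_schur_series_def z_def)
  qed (auto simp: B_def A_def)
  \<comment> \<open>Behind the factor X^(N-1) the series starts with 1. For
    \<open>m0 j = N - Suc j\<close> the conditions \<open>i + m < N - 1\<close> and
    \<open>i + m = N - 1\<close> become \<open>i < j\<close> and \<open>i = j\<close>.\<close>
  have e0: "e i m = 0" if "i + m < N - 1" for i m
    using that by (simp add: e_def fps_X_power_mult_nth)
  have e1: "e i m = 1" if "i + m = N - 1" for i m
    using that by (simp add: e_def fps_X_power_mult_nth fps_nth_0_shifted_schur_series)
  define m0 where "m0 = (\<lambda>j. N - Suc j)"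
  have carr: "B \<in> carrier_mat N N" "\<And>m. A m \<in> carrier_mat N N"
    by (auto simp: B_def A_def)
  have det0: "Determinant.det B * Determinant.det (A m0) = 1"
    unfolding det_mult [OF carr, symmetric] BA
    by (rule det_lower_unitriangular) (auto simp: m0_def intro!: e0 e1)
  define A4 where "A4 = Matrix.mat (N - n) (N - n) (\<lambda>(i, j). e (i + n) (m (j + n)))"
  define A3 where "A3 = Matrix.mat (N - n) n (\<lambda>(i, j). e (i + n) (m j))"
  define A1 where "A1 = Matrix.mat n n (\<lambda>(i, j). e i (m j))"
  have m_ge: "m j = N - Suc j" if "n \<le> j" for j
    using that by (simp add: m_def part_def n_def)
  \<comment> \<open>Columns from \<open>n\<close> on coincide with those of the denominator, so they
    vanish above the diagonal and the upper right block is 0.\<close>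
  have block: "Matrix.mat N N (\<lambda>(i, j). e i (m j)) = four_block_mat A1 (0\<^sub>m n (N - n)) A3 A4"
  proof (rule eq_matI)
    fix i j assume "i < dim_row (four_block_mat A1 (0\<^sub>m n (N - n)) A3 A4)"
      "j < dim_col (four_block_mat A1 (0\<^sub>m n (N - n)) A3 A4)"
    then have ij: "i < N" "j < N" using len by (auto simp: A1_def A4_def n_def)
    have "e i (m j) = 0" if "i < n" "n \<le> j"
      using that ij by (simp add: m_ge e0)
    then show "Matrix.mat N N (\<lambda>(i, j). e i (m j)) $$ (i, j) = four_block_mat A1 (0\<^sub>m n (N - n)) A3 A4 $$ (i, j)"
      using ij len by (auto simp: A1_def A3_def A4_def n_def)
  qed (use len in \<open>auto simp: A1_def A4_def n_def\<close>)
  have "Determinant.det A4 = 1"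
    unfolding A4_def
    by (rule det_lower_unitriangular) (auto simp: m_ge intro!: e0 e1)
  then have det1: "Determinant.det B * Determinant.det (A m) = Determinant.det A1"
    unfolding det_mult [OF carr, symmetric] BA block
    by (subst det_four_block_mat_upper_right_zero [where n = n and m = "N - n"])
       (auto simp: A1_def A3_def A4_def)
  have "shifted_schur N \<mu> x = Determinant.det (A m) / Determinant.det (A m0)"
    by (simp add: shifted_schur_def A_def m_def m0_def)
  also have "\<dots> = (Determinant.det B * Determinant.det (A m)) / (Determinant.det B * Determinant.det (A m0))"
    using det0 by (metis mult_divide_mult_cancel_left mult_zero_left zero_neq_one)
  also have "\<dots> = Determinant.det A1" by (simp add: det0 det1)
  finally show ?thesis by (simp add: A1_def e_def n_def)
qed

section \<open>Logarithmic derivatives and Newton's recursion\<close>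

lemma fps_deriv_geom_fps:
  "fps_deriv (geom_fps a) = geom_fps a * (fps_const a * geom_fps a)" for a :: "'a::field_char_0"
  by (subst fps_inverse_deriv) (simp_all add: power2_eq_square mult_ac)

lemma fps_deriv_prod_logarithmic:
  fixes f g :: "'i \<Rightarrow> 'a::comm_ring_1 fps"
  assumes "finite A" "\<And>i. i \<in> A \<Longrightarrow> fps_deriv (f i) = f i * g i"
  shows "fps_deriv (prod f A) = prod f A * sum g A"
  using assms by (induction A rule: finite_induct) (simp_all add: algebra_simps)

text \<open>Since 1 + (N - i)X = 1 - (i - N)X is the reciprocal of a geometric series, the numbers i
  - N enter with the opposite sign: the logarithmic coefficients are differences of two power
  sums.\<close>

lemma fps_deriv_shifted_schur_series:
  "fps_deriv (shifted_schur_series N x m) = shifted_schur_series N x m *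
    Abs_fps (\<lambda>k. (\<Sum>a<N. (x a - real (Suc a)) ^ Suc k) - (\<Sum>i<m. (real i - real N) ^ Suc k))"
proof -
  let ?g1 = "\<lambda>i::nat. fps_const (real N - real i) * geom_fps (real i - real N)"
  let ?g2 = "\<lambda>a. fps_const (x a - real (Suc a)) * geom_fps (x a - real (Suc a))"
  have "fps_deriv (1 + fps_const c * fps_X) = (1 + fps_const c * fps_X) * (fps_const c * geom_fps (- c))"
    for c :: real
    using geom_fps_unit [of "- c"] by (simp add: mult.left_commute flip: fps_const_neg)
  then have lin: "fps_deriv (1 + fps_const (real N - real i) * fps_X)
      = (1 + fps_const (real N - real i) * fps_X) * ?g1 i" for i
    by (metis minus_diff_eq)
  have 1: "fps_deriv (\<Prod>i<m. 1 + fps_const (real N - real i) * fps_X)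
      = (\<Prod>i<m. 1 + fps_const (real N - real i) * fps_X) * sum ?g1 {..<m}"
    by (rule fps_deriv_prod_logarithmic) (auto simp only: lin finite_lessThan)
  have 2: "fps_deriv (\<Prod>a<N. geom_fps (x a - real (Suc a)))
      = (\<Prod>a<N. geom_fps (x a - real (Suc a))) * sum ?g2 {..<N}"
    by (rule fps_deriv_prod_logarithmic) (auto simp only: fps_deriv_geom_fps finite_lessThan)
  have "sum ?g1 {..<m} + sum ?g2 {..<N} = Abs_fps (\<lambda>k. (\<Sum>a<N. (x a - real (Suc a)) ^ Suc k) - (\<Sum>i<m. (real i - real N) ^ Suc k))"
  proof (rule fps_ext)
    fix k
    have "(real N - real i) * (real i - real N) ^ k = - ((real i - real N) ^ Suc k)" for i
      by (simp add: algebra_simps)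
    then show "fps_nth (sum ?g1 {..<m} + sum ?g2 {..<N}) k = fps_nth (Abs_fps
        (\<lambda>k. (\<Sum>a<N. (x a - real (Suc a)) ^ Suc k) - (\<Sum>i<m. (real i - real N) ^ Suc k))) k"
      by (simp only: fps_sum_nth fps_add_nth fps_mult_left_const_nth fps_nth_geom_fps fps_nth_Abs_fps
            sum_negf power_Suc [symmetric])
  qed
  moreover have "fps_deriv (shifted_schur_series N x m) = shifted_schur_series N x m * (sum ?g1 {..<m} + sum ?g2 {..<N})"
    unfolding shifted_schur_series_def fps_deriv_mult 1 2 by (simp only: algebra_simps)
  ultimately show ?thesis by simp
qed

lemma fps_nth_deriv_mult:
  fixes F P :: "'a::comm_ring_1 fps"
  assumes "fps_deriv F = F * P"
  shows "of_nat (Suc n) * fps_nth F (Suc n) = (\<Sum>j\<le>n. fps_nth P j * fps_nth F (n - j))"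
proof -
  have "of_nat (Suc n) * fps_nth F (Suc n) = fps_nth (P * F) n"
    using arg_cong [OF assms, of "\<lambda>G. fps_nth G n"] by (simp add: mult.commute)
  then show ?thesis by (simp add: fps_mult_nth atMost_atLeast0)
qed

text \<open>Newton's recursion is homogeneous if coefficient k of \<open>F\<close> has weight k and
  coefficient j of \<open>P\<close> has weight j + 1. Scaling by powers of \<open>s\<close>
  therefore commutes with it, and strong induction on k passes to the limit.\<close>

lemma tendsto_fps_nth_logarithmic:
  fixes F P :: "nat \<Rightarrow> real fps" and h :: "complex fps" and s :: "nat \<Rightarrow> real"
  assumes F: "\<And>L. fps_deriv (F L) = F L * P L" "\<And>L. fps_nth (F L) 0 = 1"
    and h: "fps_deriv h = h * Q" "fps_nth h 0 = 1"
    and s: "eventually (\<lambda>L. s L \<noteq> 0) sequentially"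
    and P: "\<And>k. (\<lambda>L. complex_of_real (fps_nth (P L) k / s L ^ Suc k)) \<longlonglongrightarrow> fps_nth Q k"
  shows "(\<lambda>L. complex_of_real (fps_nth (F L) k / s L ^ k)) \<longlonglongrightarrow> fps_nth h k"
proof (induction k rule: less_induct)
  case (less k)
  show ?case
  proof (cases k)
    case 0
    then show ?thesis by (simp add: F h)
  next
    case (Suc n)
    have "(\<lambda>L. (\<Sum>j\<le>n. complex_of_real (fps_nth (P L) j / s L ^ Suc j) *
        complex_of_real (fps_nth (F L) (n - j) / s L ^ (n - j))) / of_nat (Suc n))
      \<longlonglongrightarrow> (\<Sum>j\<le>n. fps_nth Q j * fps_nth h (n - j)) / of_nat (Suc n)"
      by (intro tendsto_intros P less.IH) (auto simp: Suc simp del: of_nat_Suc)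
    also have "(\<Sum>j\<le>n. fps_nth Q j * fps_nth h (n - j)) / of_nat (Suc n) = fps_nth h k"
      unfolding fps_nth_deriv_mult [OF h(1), symmetric] Suc
      by (rule nonzero_mult_div_cancel_left) (rule of_nat_neq_0)
    finally show ?thesis
    proof (rule Lim_transform_eventually)
      show "\<forall>\<^sub>F L in sequentially. (\<Sum>j\<le>n. complex_of_real (fps_nth (P L) j / s L ^ Suc j) *
          complex_of_real (fps_nth (F L) (n - j) / s L ^ (n - j))) / of_nat (Suc n)
        = complex_of_real (fps_nth (F L) k / s L ^ k)"
        using s
      proof eventually_elim
        case (elim L)
        have "(\<Sum>j\<le>n. (fps_nth (P L) j / s L ^ Suc j) * (fps_nth (F L) (n - j) / s L ^ (n - j)))
            = (\<Sum>j\<le>n. fps_nth (P L) j * fps_nth (F L) (n - j) / s L ^ Suc n)"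
        proof (rule sum.cong)
          fix j assume "j \<in> {..n}"
          then have "s L ^ Suc n = s L ^ Suc j * s L ^ (n - j)"
            by (simp flip: power_add)
          then show "(fps_nth (P L) j / s L ^ Suc j) * (fps_nth (F L) (n - j) / s L ^ (n - j))
             = fps_nth (P L) j * fps_nth (F L) (n - j) / s L ^ Suc n"
            by (simp only: times_divide_times_eq)
        qed simp
        also have "\<dots> = of_nat (Suc n) * fps_nth (F L) (Suc n) / s L ^ Suc n"
          unfolding fps_nth_deriv_mult [OF F(1)] by (simp only: sum_divide_distrib)
        finally have *: "fps_nth (F L) k / s L ^ k =
            (\<Sum>j\<le>n. (fps_nth (P L) j / s L ^ Suc j) * (fps_nth (F L) (n - j) / s L ^ (n - j))) / of_nat (Suc n)"
          by (simp add: Suc del: of_nat_Suc)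
        show ?case
          unfolding * by (simp only: of_real_sum of_real_mult of_real_divide of_real_of_nat_eq)
      qed
    qed
  qed
qed

section \<open>Contents of diagrams along a Vershik--Kerov sequence\<close>

lemma transposed_lessThan:
  assumes "antimono p" "\<forall>i\<ge>n. p i = 0"
  shows "{i. m < p i} = {..<transposed p m}" "transposed p m \<le> n"
proof -
  have sub: "{i. m < p i} \<subseteq> {..<n}"
    using assms(2) by (metis lessThan_iff mem_Collect_eq not_less not_less_zero subsetI)
  then show "transposed p m \<le> n"
    using card_mono [OF _ sub] by (simp add: transposed_def)
  have fin: "finite {i. m < p i}" using sub finite_subset by blast
  have "\<exists>k. {i. m < p i} = {..<k}"
  proof (cases "{i. m < p i} = {}")
    case False
    have "{i. m < p i} = {..<Suc (Max {i. m < p i})}"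
    proof (intro equalityI subsetI)
      fix i assume "i \<in> {..<Suc (Max {i. m < p i})}"
      then have "p (Max {i. m < p i}) \<le> p i"
        using assms(1) by (auto simp: antimono_def)
      moreover have "m < p (Max {i. m < p i})"
        using Max_in [OF fin False] by simp
      ultimately show "i \<in> {i. m < p i}" by simp
    next
      fix i assume "i \<in> {i. m < p i}"
      then show "i \<in> {..<Suc (Max {i. m < p i})}"
        using fin by (simp add: less_Suc_eq_le)
    qed
    then show ?thesis by blast
  qed auto
  then obtain k where "{i. m < p i} = {..<k}" by blast
  then show "{i. m < p i} = {..<transposed p m}" by (simp add: transposed_def)
qed

text \<open>Boxes of content at least 0 are collected along rows, the others along columns, as in
  Frobenius coordinates. With indices from 0, row \<open>i\<close> has \<open>p i - i\<close> boxes
  weakly to the right of the diagonal, and \<open>transposed p i - i\<close> also counts the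
  diagonal box, hence the range from 1. Truncated subtraction discards rows and columns past the
  diagonal.\<close>

lemma sum_contents_eq:
  fixes f :: "real \<Rightarrow> real"
  assumes "antimono p" "\<forall>i\<ge>n. p i = 0"
  shows "(\<Sum>i<n. \<Sum>m<p i. f (real m - real i)) =
    (\<Sum>i<n. \<Sum>c<p i - i. f (real c)) + (\<Sum>i<n. \<Sum>c=1..<transposed p i - i. f (- real c))"
proof -
  have row: "(\<Sum>m<p i. f (real m - real i)) =
      (\<Sum>c<p i - i. f (real c)) + (\<Sum>m | m < i \<and> m < p i. f (real m - real i))" for i
  proof -
    have eq: "{..<p i} = {i..<p i} \<union> {m. m < i \<and> m < p i}" by auto
    have "(\<Sum>m<p i. f (real m - real i)) =
        (\<Sum>m=i..<p i. f (real m - real i)) + (\<Sum>m | m < i \<and> m < p i. f (real m - real i))"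
      by (subst eq, rule sum.union_disjoint) auto
    also have "(\<Sum>m=i..<p i. f (real m - real i)) = (\<Sum>c<p i - i. f (real c))"
      by (rule sum.reindex_bij_witness [where i = "\<lambda>c. c + i" and j = "\<lambda>m. m - i"]) auto
    finally show ?thesis .
  qed
  have "(\<Sum>i<n. \<Sum>m | m < i \<and> m < p i. f (real m - real i))
      = (\<Sum>i<n. \<Sum>m | m \<in> {..<n} \<and> (m < i \<and> m < p i). f (real m - real i))"
    by (intro sum.cong) auto
  also have "\<dots> = (\<Sum>m<n. \<Sum>i | i \<in> {..<n} \<and> (m < i \<and> m < p i). f (real m - real i))"
    by (rule sum.swap_restrict) auto
  also have "\<dots> = (\<Sum>m<n. \<Sum>c=1..<transposed p m - m. f (- real c))"
  proof (rule sum.cong)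
    fix m
    have "{i \<in> {..<n}. m < i \<and> m < p i} = {i \<in> {..<n}. m < i} \<inter> {i. m < p i}" by auto
    also have "\<dots> = {Suc m..<transposed p m}"
      using transposed_lessThan [of p n m] assms by auto
    finally have eq: "{i \<in> {..<n}. m < i \<and> m < p i} = {Suc m..<transposed p m}" .
    show "(\<Sum>i | i \<in> {..<n} \<and> (m < i \<and> m < p i). f (real m - real i)) =
        (\<Sum>c=1..<transposed p m - m. f (- real c))"
      unfolding eq by (rule sum.reindex_bij_witness [where i = "\<lambda>c. c + m" and j = "\<lambda>i. i - m"]) auto
  qed simp
  finally show ?thesis
    by (simp only: row sum.distrib)
qed

text \<open>Both bounds telescope from (q+1) a^q \<le> (a+1)^(q+1) - a^(q+1) \<le> (q+1) (a+1)^q.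
  The difference of powers is a sum of q + 1 mixed products, each of which lies between a^q and
  (a+1)^q.\<close>

lemma sum_powers_bounds:
  "real (Suc q) * (\<Sum>c<a. real c ^ q) \<le> real a ^ Suc q"
  "real a ^ Suc q \<le> real (Suc q) * ((\<Sum>c<a. real c ^ q) + real a ^ q)"
proof -
  have step: "real (Suc q) * real a ^ q \<le> real (Suc a) ^ Suc q - real a ^ Suc q"
    "real (Suc a) ^ Suc q - real a ^ Suc q \<le> real (Suc q) * real (Suc a) ^ q" for a
  proof -
    have eq: "real (Suc a) ^ Suc q - real a ^ Suc q = (\<Sum>i<Suc q. real (Suc a) ^ i * real a ^ (q - i))"
      using diff_power_eq_sum [of "real (Suc a)" q "real a"]
      by (simp del: sum.lessThan_Suc power_Suc)
    have le: "real a ^ q \<le> real (Suc a) ^ i * real a ^ (q - i)"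
      "real (Suc a) ^ i * real a ^ (q - i) \<le> real (Suc a) ^ q" if "i < Suc q" for i
    proof -
      have "real a ^ q = real a ^ i * real a ^ (q - i)" "real (Suc a) ^ q = real (Suc a) ^ i * real (Suc a) ^ (q - i)"
        using that by (simp_all flip: power_add)
      then show "real a ^ q \<le> real (Suc a) ^ i * real a ^ (q - i)"
        "real (Suc a) ^ i * real a ^ (q - i) \<le> real (Suc a) ^ q"
        by (auto intro!: mult_mono power_mono simp del: of_nat_Suc) 
    qed
    show "real (Suc q) * real a ^ q \<le> real (Suc a) ^ Suc q - real a ^ Suc q"
      unfolding eq using sum_bounded_below [of "{..<Suc q}" "real a ^ q"] le by (simp del: sum.lessThan_Suc of_nat_Suc)
    show "real (Suc a) ^ Suc q - real a ^ Suc q \<le> real (Suc q) * real (Suc a) ^ q"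
      unfolding eq using sum_bounded_above [of "{..<Suc q}" _ "real (Suc a) ^ q"] le by (simp del: sum.lessThan_Suc of_nat_Suc)
  qed
  show "real (Suc q) * (\<Sum>c<a. real c ^ q) \<le> real a ^ Suc q"
  proof (induction a)
    case (Suc a)
    then show ?case using step(1) [of a] by (simp only: sum.lessThan_Suc distrib_left)
  qed simp
  show "real a ^ Suc q \<le> real (Suc q) * ((\<Sum>c<a. real c ^ q) + real a ^ q)"
  proof (induction a)
    case (Suc a)
    then show ?case using step(2) [of a] by (simp only: sum.lessThan_Suc distrib_left)
  qed simp
qed

text \<open>A Riemann sum for the integral of x^q over [0, \<alpha>]. The two bounds differ by
  \<open>a ^ q / s ^ Suc q\<close>, a convergent quantity times 1/s.\<close>

lemma tendsto_sum_powers: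
  fixes a :: "nat \<Rightarrow> nat" and s :: "nat \<Rightarrow> real"
  assumes s: "filterlim s at_top sequentially" and a: "(\<lambda>L. real (a L) / s L) \<longlonglongrightarrow> \<alpha>"
  shows "(\<lambda>L. (\<Sum>c<a L. real c ^ q) / s L ^ Suc q) \<longlonglongrightarrow> \<alpha> ^ Suc q / real (Suc q)"
proof (rule tendsto_sandwich)
  have inv: "(\<lambda>L. 1 / s L) \<longlonglongrightarrow> 0"
    by (rule tendsto_divide_0 [OF tendsto_const filterlim_at_top_imp_at_infinity [OF s]])
  have pos: "eventually (\<lambda>L. s L > 0) sequentially"
    using s by (simp add: filterlim_at_top_dense)
  have "(\<lambda>L. (real (a L) / s L) ^ Suc q / real (Suc q) - (real (a L) / s L) ^ q * (1 / s L))
     \<longlonglongrightarrow> \<alpha> ^ Suc q / real (Suc q) - \<alpha> ^ q * 0"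
    by (intro tendsto_intros a inv) (auto simp del: of_nat_Suc)
  then show "(\<lambda>L. (real (a L) / s L) ^ Suc q / real (Suc q) - (real (a L) / s L) ^ q * (1 / s L))
     \<longlonglongrightarrow> \<alpha> ^ Suc q / real (Suc q)" by simp
  show "(\<lambda>L. (real (a L) / s L) ^ Suc q / real (Suc q)) \<longlonglongrightarrow> \<alpha> ^ Suc q / real (Suc q)"
    by (intro tendsto_intros a) (auto simp del: of_nat_Suc)
  show "\<forall>\<^sub>F L in sequentially. (real (a L) / s L) ^ Suc q / real (Suc q) - (real (a L) / s L) ^ q * (1 / s L)
      \<le> (\<Sum>c<a L. real c ^ q) / s L ^ Suc q"
    using pos
  proof eventually_elim
    case (elim L)
    have "real (a L) ^ Suc q / real (Suc q) \<le> (\<Sum>c<a L. real c ^ q) + real (a L) ^ q"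
      using sum_powers_bounds(2) [of "a L" q] by (subst pos_divide_le_eq) (auto simp: mult.commute)
    then have "(real (a L) ^ Suc q / real (Suc q) - real (a L) ^ q) / s L ^ Suc q \<le> (\<Sum>c<a L. real c ^ q) / s L ^ Suc q"
      using elim by (intro divide_right_mono) auto
    then show ?case using elim by (simp add: power_divide diff_divide_distrib mult_ac)
  qed
  show "\<forall>\<^sub>F L in sequentially. (\<Sum>c<a L. real c ^ q) / s L ^ Suc q \<le> (real (a L) / s L) ^ Suc q / real (Suc q)"
    using pos
  proof eventually_elim
    case (elim L)
    have "(\<Sum>c<a L. real c ^ q) \<le> real (a L) ^ Suc q / real (Suc q)"
      using sum_powers_bounds(1) [where a = "a L" and q = q] by (subst pos_le_divide_eq) (auto simp: mult.commute)
    then have "(\<Sum>c<a L. real c ^ q) / s L ^ Suc q \<le> real (a L) ^ Suc q / real (Suc q) / s L ^ Suc q"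
      using elim by (intro divide_right_mono) auto
    then show ?case by (simp add: power_divide mult_ac)
  qed
qed

text \<open>Row \<open>i\<close> and all rows above it contain at least \<open>p i\<close> boxes,
  and similarly for columns. This is the source of domination: relative to the number of boxes, rows
  and columns decay like 1/(i+1), uniformly in the diagram.\<close>

lemma row_and_column_bounds:
  assumes "antimono p" "\<forall>i\<ge>n. p i = 0"
  shows "Suc i * p i \<le> (\<Sum>j<n. p j)" "Suc i * transposed p i \<le> (\<Sum>j<n. p j)"
proof -
  show "Suc i * p i \<le> (\<Sum>j<n. p j)"
  proof (cases "i < n")
    case True
    have "Suc i * p i = (\<Sum>j<Suc i. p i)" by simp
    also have "\<dots> \<le> (\<Sum>j<Suc i. p j)"
      using assms(1) by (intro sum_mono) (auto simp: antimono_def)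
    also have "\<dots> \<le> (\<Sum>j<n. p j)"
      using True by (intro sum_mono2) auto
    finally show ?thesis .
  qed (use assms(2) in simp)
  note tr = transposed_lessThan [where n = n and m = i, OF assms]
  have "Suc i * transposed p i = (\<Sum>j<transposed p i. Suc i)" by simp
  also have "\<dots> \<le> (\<Sum>j<transposed p i. p j)"
  proof (rule sum_mono)
    fix j assume "j \<in> {..<transposed p i}"
    then have "j \<in> {j. i < p j}" unfolding tr(1) .
    then show "Suc i \<le> p j" by simp
  qed
  also have "\<dots> \<le> (\<Sum>j<n. p j)"
    using tr(2) by (intro sum_mono2) auto
  finally show "Suc i * transposed p i \<le> (\<Sum>j<n. p j)" .
qed

text \<open>The natural subtraction cuts off negative values, which does no harm as the limit is
  nonnegative; the summand 1/2 disappears under scaling.\<close>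

lemma tendsto_half_coord:
  fixes n :: "nat \<Rightarrow> nat"
  assumes n: "filterlim (\<lambda>L. real (n L)) at_top sequentially"
    and lim: "(\<lambda>L. half_coord (p L) i / real (n L)) \<longlonglongrightarrow> \<alpha>" and "\<alpha> \<ge> 0"
  shows "(\<lambda>L. real (p L i - i) / real (n L)) \<longlonglongrightarrow> \<alpha>"
proof -
  have "(\<lambda>L. max 0 (half_coord (p L) i / real (n L) + (1 / 2) / real (n L))) \<longlonglongrightarrow> max 0 (\<alpha> + 0)"
    by (intro tendsto_intros lim tendsto_divide_0 [OF tendsto_const] filterlim_at_top_imp_at_infinity n)
  also have "(\<lambda>L. max 0 (half_coord (p L) i / real (n L) + (1 / 2) / real (n L)))
      = (\<lambda>L. real (p L i - i) / real (n L))"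
  proof
    fix L
    have "half_coord (p L) i / real (n L) + (1 / 2) / real (n L) = (real (p L i) - real i) / real (n L)"
      by (simp add: half_coord_def diff_divide_distrib add_divide_distrib)
    then show "max 0 (half_coord (p L) i / real (n L) + (1 / 2) / real (n L)) = real (p L i - i) / real (n L)"
      by (cases "i \<le> p L i") (auto simp: of_nat_diff max_def divide_le_0_iff zero_le_divide_iff)
  qed
  finally show ?thesis using \<open>\<alpha> \<ge> 0\<close> by simp
qed

text \<open>Dominated convergence over the index of arms and legs, with a bound of order
  \<open>1 / Suc i ^ Suc q\<close>. It is summable because \<open>q \<ge> 1\<close>; at order 0 the
  harmonic bound would not exclude loss of mass.\<close>

lemma tendsto_contents_moment:
  fixes p :: "nat \<Rightarrow> nat \<Rightarrow> nat" and n :: "nat \<Rightarrow> nat" and \<alpha> \<beta> :: "nat \<Rightarrow> real"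
  assumes anti: "\<And>L. L \<ge> 1 \<Longrightarrow> antimono (p L)"
    and supp: "\<And>L. L \<ge> 1 \<Longrightarrow> \<forall>i\<ge>n L. p L i = 0"
    and n: "filterlim (\<lambda>L. real (n L)) at_top sequentially"
    and \<alpha>: "\<And>i. (\<lambda>L. half_coord (p L) i / real (n L)) \<longlonglongrightarrow> \<alpha> i" "\<And>i. \<alpha> i \<ge> 0"
    and \<beta>: "\<And>i. (\<lambda>L. half_coord (transposed (p L)) i / real (n L)) \<longlonglongrightarrow> \<beta> i" "\<And>i. \<beta> i \<ge> 0"
    and \<delta>: "(\<lambda>L. real (\<Sum>i<n L. p L i) / real (n L)) \<longlonglongrightarrow> \<delta>"
    and q: "q \<ge> 1"
  shows "(\<lambda>L. (\<Sum>i<n L. \<Sum>m<p L i. (real m - real i) ^ q) / real (n L) ^ Suc q)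
    \<longlonglongrightarrow> (\<Sum>i. \<alpha> i ^ Suc q + (-1) ^ q * \<beta> i ^ Suc q) / real (Suc q)"
proof -
  let ?M = "\<lambda>L. \<Sum>i<n L. \<Sum>m<p L i. (real m - real i) ^ q"
  define S where "S = (\<lambda>a. \<Sum>c<a. real c ^ q)"
  define t where "t = (\<lambda>i L. (S (p L i - i) + (-1) ^ q * S (transposed (p L) i - i)) / real (n L) ^ Suc q)"
  define C where "C = \<bar>\<delta>\<bar> + 1"
  let ?B = "\<lambda>i. C ^ Suc q * (1 / real (Suc i) ^ 2)"
  have S: "0 \<le> S a" "S a \<le> real a ^ Suc q" for a
  proof -
    show "0 \<le> S a" by (auto simp: S_def intro: sum_nonneg)
    then have "1 * S a \<le> real (Suc q) * S a" by (intro mult_right_mono) auto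
    also have "\<dots> \<le> real a ^ Suc q" unfolding S_def by (rule sum_powers_bounds)
    finally show "S a \<le> real a ^ Suc q" by simp
  qed
  have moment: "?M L / real (n L) ^ Suc q = (\<Sum>i. t i L)"
    if "L \<ge> 1" for L
  proof -
    note part = anti [OF that] supp [OF that]
    have "(\<Sum>c = 1..<b. (- real c) ^ q) = (-1) ^ q * S b" for b
    proof -
      have "(-1) ^ q * S b = (\<Sum>c<b. (- real c) ^ q)"
        unfolding S_def sum_distrib_left by (simp flip: power_mult_distrib)
      \<comment> \<open>The term with \<open>c = 0\<close> is \<open>0 ^ q\<close>, which vanishes
        because \<open>q \<ge> 1\<close>.\<close>
      also have "\<dots> = (\<Sum>c = 1..<b. (- real c) ^ q)"
        using q by (intro sum.mono_neutral_right) (auto simp: not_le)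
      finally show ?thesis by simp
    qed
    then have "?M L
        = (\<Sum>i<n L. S (p L i - i) + (-1) ^ q * S (transposed (p L) i - i))"
      using sum_contents_eq [OF part, where f = "\<lambda>x. x ^ q"] by (simp add: S_def sum.distrib)
    then have "?M L / real (n L) ^ Suc q = (\<Sum>i<n L. t i L)"
      by (simp only: t_def sum_divide_distrib)
    also have "\<dots> = (\<Sum>i. t i L)"
    proof (rule suminf_finite [symmetric])
      fix i assume "i \<notin> {..<n L}"
      then have "p L i = 0" "transposed (p L) i - i = 0"
        using part(2) transposed_lessThan(2) [OF part, where m = i] by auto
      then show "t i L = 0" by (simp add: t_def S_def)
    qed simp
    finally show ?thesis .
  qed
  define b where "b = (\<lambda>i. (\<alpha> i ^ Suc q + (-1) ^ q * \<beta> i ^ Suc q) / real (Suc q))"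
  have "eventually (\<lambda>L. summable (\<lambda>i. norm (t i L))) sequentially \<and> summable (\<lambda>i. norm (b i)) \<and>
      (\<lambda>L. \<Sum>i. t i L) \<longlonglongrightarrow> (\<Sum>i. b i)"
  proof (rule tannerys_theorem)
    fix i
    have "(\<lambda>L. S (p L i - i) / real (n L) ^ Suc q + (-1) ^ q * (S (transposed (p L) i - i) / real (n L) ^ Suc q))
       \<longlonglongrightarrow> \<alpha> i ^ Suc q / real (Suc q) + (-1) ^ q * (\<beta> i ^ Suc q / real (Suc q))"
      unfolding S_def
      by (intro tendsto_add tendsto_mult tendsto_const tendsto_sum_powers n tendsto_half_coord \<alpha> \<beta>)
    then show "(\<lambda>L. t i L) \<longlonglongrightarrow> b i"
      by (simp only: t_def b_def add_divide_distrib times_divide_eq_right)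
  next
    have "eventually (\<lambda>L. real (\<Sum>i<n L. p L i) / real (n L) < C) sequentially"
      by (rule order_tendstoD(2) [OF \<delta>]) (simp add: C_def)
    moreover have "eventually (\<lambda>L. L \<ge> 1) sequentially" by (rule eventually_ge_at_top)
    moreover have "eventually (\<lambda>L. real (n L) > 0) sequentially"
      using n unfolding filterlim_at_top_dense by blast
    \<comment> \<open>One threshold in \<open>L\<close> has to serve all \<open>i\<close>. Since
      \<open>C\<close> exceeds the limit \<delta>, it eventually bounds the number of boxes divided
      by \<open>n L\<close>, and \<open>row_and_column_bounds\<close> does the rest for every index
      at once.\<close>
    ultimately have ev: "eventually (\<lambda>L. \<forall>i. norm (t i L) \<le> 2 * ?B i) sequentially"
    proof eventually_elim
      case (elim L)
      have bd: "S (a - i) / real (n L) ^ Suc q \<le> ?B i"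
        if "Suc i * a \<le> (\<Sum>i<n L. p L i)" for a i
      proof -
        have "real (Suc i) * real a \<le> real (\<Sum>i<n L. p L i)"
          using that by (metis of_nat_le_iff of_nat_mult)
        also have "\<dots> \<le> C * real (n L)" using elim by (simp add: divide_less_eq)
        finally have a: "real a / real (n L) \<le> C / real (Suc i)"
          using elim by (simp add: divide_simps mult_ac del: of_nat_Suc)
        have "S (a - i) / real (n L) ^ Suc q \<le> real (a - i) ^ Suc q / real (n L) ^ Suc q"
          by (intro divide_right_mono S) auto
        also have "\<dots> = (real (a - i) / real (n L)) ^ Suc q" by (simp only: power_divide)
        also have "\<dots> \<le> (real a / real (n L)) ^ Suc q"
          by (intro power_mono divide_right_mono) auto
        also have "\<dots> \<le> (C / real (Suc i)) ^ Suc q"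
          using a by (intro power_mono) auto
        also have "\<dots> = C ^ Suc q * (1 / real (Suc i) ^ Suc q)" by (simp add: power_divide)
        also have "\<dots> \<le> ?B i"
        proof -
          have "real (Suc i) ^ 2 \<le> real (Suc i) ^ Suc q"
            using q by (intro power_increasing) auto
          then show ?thesis
            by (intro mult_left_mono divide_left_mono) (auto simp: C_def)
        qed
        finally show ?thesis .
      qed
      show ?case
      proof
        fix i
        note rc = row_and_column_bounds [of "p L" "n L" i, OF anti [OF elim(2)] supp [OF elim(2)]]
        have "norm (t i L) \<le> \<bar>S (p L i - i) / real (n L) ^ Suc q\<bar> + \<bar>S (transposed (p L) i - i) / real (n L) ^ Suc q\<bar>"
          unfolding t_def add_divide_distrib real_norm_def
          by (rule order_trans [OF abs_triangle_ineq]) (simp add: abs_mult power_abs)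
        also have "\<dots> = S (p L i - i) / real (n L) ^ Suc q + S (transposed (p L) i - i) / real (n L) ^ Suc q"
          using S(1) by (intro arg_cong2 [where f = "(+)"] abs_of_nonneg divide_nonneg_nonneg) auto
        also have "\<dots> \<le> ?B i + ?B i"
          using rc by (intro add_mono bd)
        finally show "norm (t i L) \<le> 2 * ?B i"
          by simp
      qed
    qed
    show "\<forall>\<^sub>F (k, L) in sequentially \<times>\<^sub>F sequentially. norm (t k L) \<le> 2 * ?B k"
      unfolding eventually_prod_filter
      by (rule exI [where x = "\<lambda>_. True"], rule exI, rule conjI, simp, rule conjI, rule ev) auto
    show "summable (\<lambda>k. 2 * ?B k)"
      using inverse_squares_sums by (intro summable_mult) (auto simp: sums_iff add.commute)
  qed simp
  then have summ: "summable (\<lambda>i. norm (b i))" and lim: "(\<lambda>L. \<Sum>i. t i L) \<longlonglongrightarrow> (\<Sum>i. b i)"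
    by simp_all
  have "summable (\<lambda>i. real (Suc q) * b i)"
    by (rule summable_mult [OF summable_norm_cancel [OF summ]])
  then have "summable (\<lambda>i. \<alpha> i ^ Suc q + (-1) ^ q * \<beta> i ^ Suc q)"
    unfolding b_def times_divide_eq_right nonzero_mult_div_cancel_left [OF of_nat_neq_0] .
  then have "(\<Sum>i. b i) = (\<Sum>i. \<alpha> i ^ Suc q + (-1) ^ q * \<beta> i ^ Suc q) / real (Suc q)"
    unfolding b_def by (rule suminf_divide)
  then have "(\<lambda>L. \<Sum>i. t i L) \<longlonglongrightarrow> (\<Sum>i. \<alpha> i ^ Suc q + (-1) ^ q * \<beta> i ^ Suc q) / real (Suc q)"
    using lim by simp
  then show ?thesis
    by (rule Lim_transform_eventually) (use moment in \<open>auto intro!: eventually_sequentiallyI [of 1]\<close>)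
qed

text \<open>In the binomial expansion of the difference the moment of order \<open>j < k\<close> is
  of size at most \<open>s ^ Suc j\<close>, too small to survive division by
  \<open>s ^ Suc k\<close>. Only the leading term -(k+1) y^k contributes.\<close>

lemma tendsto_sum_power_step:
  fixes B :: "nat \<Rightarrow> 'b set" and y :: "nat \<Rightarrow> 'b \<Rightarrow> real" and s :: "nat \<Rightarrow> real"
  assumes s: "filterlim s at_top sequentially"
    and M: "\<And>q. (\<lambda>L. (\<Sum>b\<in>B L. y L b ^ q) / s L ^ Suc q) \<longlonglongrightarrow> M q"
  shows "(\<lambda>L. (\<Sum>b\<in>B L. (y L b - 1) ^ Suc k - y L b ^ Suc k) / s L ^ Suc k) \<longlonglongrightarrow> - real (Suc k) * M k"
proof -
  let ?m = "\<lambda>j L. (\<Sum>b\<in>B L. y L b ^ j) / s L ^ Suc j"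
  define C where "C = (\<lambda>j. real (Suc k choose j) * (-1) ^ (Suc k - j))"
  have inv: "(\<lambda>L. 1 / s L) \<longlonglongrightarrow> 0"
    by (rule tendsto_divide_0 [OF tendsto_const filterlim_at_top_imp_at_infinity [OF s]])
  have "(\<lambda>L. \<Sum>j\<le>k. C j * ?m j L * (1 / s L) ^ (k - j))
    \<longlonglongrightarrow> (\<Sum>j\<le>k. C j * M j * 0 ^ (k - j))"
    by (intro tendsto_sum tendsto_mult tendsto_const tendsto_power M inv)
  also have "(\<Sum>j\<le>k. C j * M j * 0 ^ (k - j)) = (\<Sum>j\<le>k. if j = k then C k * M k else 0)"
    by (intro sum.cong) auto
  also have "\<dots> = - real (Suc k) * M k" by (simp add: C_def)
  finally show ?thesis
  proof (rule Lim_transform_eventually)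
    have "eventually (\<lambda>L. s L > 0) sequentially"
      using s unfolding filterlim_at_top_dense by blast
    then show "\<forall>\<^sub>F L in sequentially. (\<Sum>j\<le>k. C j * ?m j L * (1 / s L) ^ (k - j))
       = (\<Sum>b\<in>B L. (y L b - 1) ^ Suc k - y L b ^ Suc k) / s L ^ Suc k"
    proof eventually_elim
      case (elim L)
      have "(\<Sum>b\<in>B L. (y L b - 1) ^ Suc k - y L b ^ Suc k) = (\<Sum>b\<in>B L. \<Sum>j\<le>k. C j * y L b ^ j)"
      proof (rule sum.cong)
        fix b
        have "(y L b - 1) ^ Suc k = (\<Sum>j\<le>Suc k. real (Suc k choose j) * y L b ^ j * (-1) ^ (Suc k - j))"
          by (simp only: binomial_ring [symmetric] diff_conv_add_uminus)
        also have "\<dots> = (\<Sum>j\<le>k. C j * y L b ^ j) + y L b ^ Suc k"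
          by (simp add: C_def mult_ac del: binomial_Suc_Suc)
        finally show "(y L b - 1) ^ Suc k - y L b ^ Suc k = (\<Sum>j\<le>k. C j * y L b ^ j)" by simp
      qed simp
      also have "\<dots> = (\<Sum>j\<le>k. C j * (\<Sum>b\<in>B L. y L b ^ j))"
        unfolding sum_distrib_left by (rule sum.swap)
      also have "\<dots> / s L ^ Suc k = (\<Sum>j\<le>k. C j * (\<Sum>b\<in>B L. y L b ^ j) / s L ^ Suc k)"
        by (rule sum_divide_distrib)
      also have "\<dots> = (\<Sum>j\<le>k. C j * ?m j L * (1 / s L) ^ (k - j))"
      proof (rule sum.cong)
        fix j assume "j \<in> {..k}"
        then have eq: "s L ^ Suc k = s L ^ Suc j * s L ^ (k - j)"
          by (simp flip: power_add)
        show "C j * (\<Sum>b\<in>B L. y L b ^ j) / s L ^ Suc k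
          = C j * ?m j L * (1 / s L) ^ (k - j)"
          unfolding eq by (simp only: power_divide power_one times_divide_times_eq mult_1_right times_divide_eq_right divide_divide_eq_left)
      qed simp
      finally show ?case by simp
    qed
  qed
qed

text \<open>The shift by \<open>s\<close> has the same order as \<open>y\<close>, so every binomial
  term survives in the limit. This serves the negative parts of a signature, where a box of content
  c acts at the coordinate -(n + c).\<close>

lemma tendsto_sum_power_shift:
  fixes B :: "nat \<Rightarrow> 'b set" and y :: "nat \<Rightarrow> 'b \<Rightarrow> real" and s :: "nat \<Rightarrow> real"
  assumes s: "filterlim s at_top sequentially"
    and M: "\<And>q. (\<lambda>L. (\<Sum>b\<in>B L. y L b ^ q) / s L ^ Suc q) \<longlonglongrightarrow> M q"
  shows "(\<lambda>L. (\<Sum>b\<in>B L. (- (s L + y L b)) ^ q) / s L ^ Suc q)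
    \<longlonglongrightarrow> (-1) ^ q * (\<Sum>j\<le>q. real (q choose j) * M j)"
proof -
  let ?m = "\<lambda>j L. (\<Sum>b\<in>B L. y L b ^ j) / s L ^ Suc j"
  have "(\<lambda>L. (-1) ^ q * (\<Sum>j\<le>q. real (q choose j) * ?m j L))
    \<longlonglongrightarrow> (-1) ^ q * (\<Sum>j\<le>q. real (q choose j) * M j)"
    by (intro tendsto_sum tendsto_mult tendsto_const M)
  then show ?thesis
  proof (rule Lim_transform_eventually)
    have "eventually (\<lambda>L. s L > 0) sequentially"
      using s unfolding filterlim_at_top_dense by blast
    then show "\<forall>\<^sub>F L in sequentially. (-1) ^ q * (\<Sum>j\<le>q. real (q choose j) * ?m j L)
       = (\<Sum>b\<in>B L. (- (s L + y L b)) ^ q) / s L ^ Suc q"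
    proof eventually_elim
      case (elim L)
      have "(- (s L + y L b)) ^ q = (-1) ^ q * (\<Sum>j\<le>q. real (q choose j) * y L b ^ j * s L ^ (q - j))" for b
        unfolding binomial_ring [of "y L b" "s L" q, symmetric] power_mult_distrib [symmetric]
        by (simp only: mult_minus1 add.commute)
      then have "(\<Sum>b\<in>B L. (- (s L + y L b)) ^ q)
          = (-1) ^ q * (\<Sum>b\<in>B L. \<Sum>j\<le>q. real (q choose j) * y L b ^ j * s L ^ (q - j))"
        by (simp only: sum_distrib_left)
      also have "(\<Sum>b\<in>B L. \<Sum>j\<le>q. real (q choose j) * y L b ^ j * s L ^ (q - j))
          = (\<Sum>j\<le>q. real (q choose j) * (\<Sum>b\<in>B L. y L b ^ j) * s L ^ (q - j))"
        unfolding sum_distrib_left sum_distrib_right by (rule sum.swap)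
      finally have "(\<Sum>b\<in>B L. (- (s L + y L b)) ^ q) / s L ^ Suc q
          = (-1) ^ q * (\<Sum>j\<le>q. real (q choose j) * (\<Sum>b\<in>B L. y L b ^ j) * s L ^ (q - j) / s L ^ Suc q)"
        by (simp only: times_divide_eq_right [symmetric] sum_divide_distrib)
      also have "(\<Sum>j\<le>q. real (q choose j) * (\<Sum>b\<in>B L. y L b ^ j) * s L ^ (q - j) / s L ^ Suc q)
          = (\<Sum>j\<le>q. real (q choose j) * ?m j L)"
      proof (rule sum.cong)
        fix j assume "j \<in> {..q}"
        then have eq: "s L ^ Suc q = s L ^ Suc j * s L ^ (q - j)"
          by (simp flip: power_add)
        have nz: "s L ^ (q - j) \<noteq> 0" using elim by simp
        show "real (q choose j) * (\<Sum>b\<in>B L. y L b ^ j) * s L ^ (q - j) / s L ^ Suc q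
            = real (q choose j) * ?m j L"
          unfolding eq nonzero_mult_divide_mult_cancel_right [OF nz] by simp
      qed simp
      finally show ?case by simp
    qed
  qed
qed

section \<open>Power sums of a signature as sums over boxes\<close>

lemma antimono_sig_pos:
  assumes "lam \<in> Sign n"
  shows "antimono (sig_pos lam)"
proof (rule antimonoI)
  fix i j :: nat assume "i \<le> j"
  show "sig_pos lam j \<le> sig_pos lam i"
  proof (cases "i < j \<and> j < length lam")
    case True
    then have "lam ! j \<le> lam ! i"
      using assms by (auto simp: Sign_def sorted_wrt_iff_nth_less)
    then show ?thesis using True by (simp add: sig_pos_def)
  next
    case False
    then show ?thesis using \<open>i \<le> j\<close> by (cases "i = j") (auto simp: sig_pos_def)
  qed
qed

lemma sig_pos_support:
  assumes "lam \<in> Sign n"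
  shows "\<forall>i\<ge>n. sig_pos lam i = 0"
  using assms by (auto simp: sig_pos_def Sign_def)

lemma uminus_rev_Sign:
  assumes "lam \<in> Sign n"
  shows "map uminus (rev lam) \<in> Sign n"
  using assms by (auto simp: Sign_def sorted_wrt_map sorted_wrt_rev)

lemma sig_neg_nth:
  assumes "lam \<in> Sign n" "j < n"
  shows "sig_neg lam j = nat (- (lam ! (n - Suc j)))"
  using assms by (simp add: sig_neg_def sig_pos_def Sign_def rev_nth)

text \<open>Every row telescopes. A box of content c in the positive part moves a coordinate from c
  - 1 to c; one in the negative part, whose rows are counted from the bottom, moves it from -(n + c)
  to -(n + c) - 1. Both changes are written with (y - 1)^K - y^K to fit
  \<open>tendsto_sum_power_step\<close>, hence the minus sign before the positive part.\<close>

lemma signature_power_sum: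
  assumes lam: "lam \<in> Sign n" and K: "K > 0"
  shows "(\<Sum>a<n. (real_of_int (lam ! a) - real (Suc a)) ^ K) - (\<Sum>a<n. (- real (Suc a)) ^ K) =
    (\<Sum>b\<in>Sigma {..<n} (\<lambda>j. {..<sig_neg lam j}).
       (- (real n + (real (snd b) - real (fst b))) - 1) ^ K - (- (real n + (real (snd b) - real (fst b)))) ^ K)
    - (\<Sum>b\<in>Sigma {..<n} (\<lambda>i. {..<sig_pos lam i}).
       (real (snd b) - real (fst b) - 1) ^ K - (real (snd b) - real (fst b)) ^ K)"
proof -
  let ?neg = "\<lambda>j m. (- (real n + (real m - real j)) - 1) ^ K - (- (real n + (real m - real j))) ^ K"
  let ?p = "\<lambda>a. real (nat (lam ! a))" and ?q = "\<lambda>a. real (nat (- (lam ! a)))"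
  have len: "length lam = n" using lam by (simp add: Sign_def)
  \<comment> \<open>At each index at most one of \<open>?p a\<close> and \<open>?q a\<close> is
    nonzero, so one of the two differences on the right is 0 and the other is the original
    one.\<close>
  have "(\<Sum>a<n. (real_of_int (lam ! a) - real (Suc a)) ^ K) - (\<Sum>a<n. (- real (Suc a)) ^ K)
     = (\<Sum>a<n. ((?p a - real (Suc a)) ^ K - (- real (Suc a)) ^ K) + ((- ?q a - real (Suc a)) ^ K - (- real (Suc a)) ^ K))"
    unfolding sum_subtractf [symmetric]
    by (intro sum.cong refl, rename_tac a, case_tac "lam ! a \<ge> 0") auto
  also have "\<dots> = (\<Sum>a<n. (?p a - real (Suc a)) ^ K - (- real (Suc a)) ^ K)
     + (\<Sum>a<n. (- ?q a - real (Suc a)) ^ K - (- real (Suc a)) ^ K)"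
    by (rule sum.distrib)
  also have "(\<Sum>a<n. (?p a - real (Suc a)) ^ K - (- real (Suc a)) ^ K)
     = (\<Sum>a<n. \<Sum>m<sig_pos lam a. - ((real m - real a - 1) ^ K - (real m - real a) ^ K))"
  proof (rule sum.cong)
    fix a assume "a \<in> {..<n}"
    then have "sig_pos lam a = nat (lam ! a)" by (simp add: sig_pos_def len)
    moreover have "(\<Sum>m<sig_pos lam a. - ((real m - real a - 1) ^ K - (real m - real a) ^ K))
       = (\<Sum>m<sig_pos lam a. (real (Suc m) - real (Suc a)) ^ K - (real m - real (Suc a)) ^ K)"
      by (intro sum.cong refl) (simp add: algebra_simps)
    moreover have "\<dots> = (real (sig_pos lam a) - real (Suc a)) ^ K - (real 0 - real (Suc a)) ^ K"
      by (rule sum_lessThan_telescope)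
    ultimately show "(?p a - real (Suc a)) ^ K - (- real (Suc a)) ^ K
       = (\<Sum>m<sig_pos lam a. - ((real m - real a - 1) ^ K - (real m - real a) ^ K))"
      by simp
  qed simp
  also have "\<dots> = - (\<Sum>b\<in>Sigma {..<n} (\<lambda>i. {..<sig_pos lam i}).
       (real (snd b) - real (fst b) - 1) ^ K - (real (snd b) - real (fst b)) ^ K)"
    by (simp only: sum_negf) (simp add: sum.Sigma split_beta)
  also have "(\<Sum>a<n. (- ?q a - real (Suc a)) ^ K - (- real (Suc a)) ^ K)
     = (\<Sum>j<n. (- ?q (n - Suc j) - real (Suc (n - Suc j))) ^ K - (- real (Suc (n - Suc j))) ^ K)"
    by (rule sum.nat_diff_reindex [symmetric])
  also have "\<dots> = (\<Sum>j<n. \<Sum>m<sig_neg lam j.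
       ?neg j m)"
  proof (rule sum.cong)
    fix j assume "j \<in> {..<n}"
    then have j: "j < n" by simp
    then have s: "real (Suc (n - Suc j)) = real n - real j" by (simp add: of_nat_diff)
    have "(\<Sum>m<sig_neg lam j. ?neg j m)
       = (\<Sum>m<sig_neg lam j. (- (real n + (real (Suc m) - real j))) ^ K - (- (real n + (real m - real j))) ^ K)"
      by (intro sum.cong refl arg_cong2 [where f = "(-)"] arg_cong [where f = "\<lambda>x. x ^ K"]) simp
    also have "\<dots> = (- (real n + (real (sig_neg lam j) - real j))) ^ K - (- (real n + (real 0 - real j))) ^ K"
      by (rule sum_lessThan_telescope)
    finally show "(- ?q (n - Suc j) - real (Suc (n - Suc j))) ^ K - (- real (Suc (n - Suc j))) ^ K
       = (\<Sum>m<sig_neg lam j. ?neg j m)"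
      unfolding s sig_neg_nth [OF lam j] by (simp add: algebra_simps)
  qed simp
  also have "\<dots> = (\<Sum>b\<in>Sigma {..<n} (\<lambda>j. {..<sig_neg lam j}).
       (- (real n + (real (snd b) - real (fst b))) - 1) ^ K - (- (real n + (real (snd b) - real (fst b)))) ^ K)"
    by (simp add: sum.Sigma split_beta)
  finally show ?thesis by simp
qed

lemma tendsto_signature_power_sum:
  fixes n :: "nat \<Rightarrow> nat"
  assumes lam: "\<And>L. L \<ge> 1 \<Longrightarrow> lam L \<in> Sign (n L)"
    and n: "filterlim (\<lambda>L. real (n L)) at_top sequentially"
    and Mp: "\<And>q. (\<lambda>L. (\<Sum>i<n L. \<Sum>m<sig_pos (lam L) i. (real m - real i) ^ q) / real (n L) ^ Suc q) \<longlonglongrightarrow> Mp q"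
    and Mm: "\<And>q. (\<lambda>L. (\<Sum>i<n L. \<Sum>m<sig_neg (lam L) i. (real m - real i) ^ q) / real (n L) ^ Suc q) \<longlonglongrightarrow> Mm q"
  shows "(\<lambda>L. ((\<Sum>a<n L. (real_of_int (lam L ! a) - real (Suc a)) ^ Suc k) - (\<Sum>a<n L. (- real (Suc a)) ^ Suc k))
      / real (n L) ^ Suc k) \<longlonglongrightarrow>
    real (Suc k) * (Mp k + (-1) ^ Suc k * (\<Sum>j\<le>k. real (k choose j) * Mm j))"
proof -
  define Bp where "Bp = (\<lambda>L. Sigma {..<n L} (\<lambda>i. {..<sig_pos (lam L) i}))"
  define Bm where "Bm = (\<lambda>L. Sigma {..<n L} (\<lambda>i. {..<sig_neg (lam L) i}))"
  let ?neg = "\<lambda>L. (\<Sum>b\<in>Bm L. (- (real (n L) + (real (snd b) - real (fst b))) - 1) ^ Suc k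
       - (- (real (n L) + (real (snd b) - real (fst b)))) ^ Suc k) / real (n L) ^ Suc k"
  let ?pos = "\<lambda>L. (\<Sum>b\<in>Bp L. (real (snd b) - real (fst b) - 1) ^ Suc k - (real (snd b) - real (fst b)) ^ Suc k) / real (n L) ^ Suc k"
  have Mp': "(\<lambda>L. (\<Sum>b\<in>Bp L. (real (snd b) - real (fst b)) ^ q) / real (n L) ^ Suc q) \<longlonglongrightarrow> Mp q" for q
    using Mp [of q] by (simp add: Bp_def sum.Sigma split_beta)
  have Mm': "(\<lambda>L. (\<Sum>b\<in>Bm L. (real (snd b) - real (fst b)) ^ q) / real (n L) ^ Suc q) \<longlonglongrightarrow> Mm q" for q
    using Mm [of q] by (simp add: Bm_def sum.Sigma split_beta)
  have 1: "(\<lambda>L. ?pos L)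
    \<longlonglongrightarrow> - real (Suc k) * Mp k"
    by (rule tendsto_sum_power_step [OF n Mp'])
  have 2: "(\<lambda>L. ?neg L)
    \<longlonglongrightarrow> - real (Suc k) * ((-1) ^ k * (\<Sum>j\<le>k. real (k choose j) * Mm j))"
    by (rule tendsto_sum_power_step [OF n tendsto_sum_power_shift [OF n Mm']])
  have "(\<lambda>L. ?neg L
     - ?pos L)
    \<longlonglongrightarrow> - real (Suc k) * ((-1) ^ k * (\<Sum>j\<le>k. real (k choose j) * Mm j)) - (- real (Suc k) * Mp k)"
    by (rule tendsto_diff [OF 2 1])
  also have "- real (Suc k) * ((-1) ^ k * (\<Sum>j\<le>k. real (k choose j) * Mm j)) - (- real (Suc k) * Mp k)
    = real (Suc k) * (Mp k + (-1) ^ Suc k * (\<Sum>j\<le>k. real (k choose j) * Mm j))"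
    by (simp add: algebra_simps)
  finally show ?thesis
  proof (rule Lim_transform_eventually)
    show "\<forall>\<^sub>F L in sequentially. ?neg L
     - ?pos L
     = ((\<Sum>a<n L. (real_of_int (lam L ! a) - real (Suc a)) ^ Suc k) - (\<Sum>a<n L. (- real (Suc a)) ^ Suc k))
      / real (n L) ^ Suc k"
      using eventually_ge_at_top [of "1::nat"]
    proof eventually_elim
      case (elim L)
      show ?case
        unfolding signature_power_sum [OF lam [OF elim] zero_less_Suc] Bp_def Bm_def diff_divide_distrib ..
    qed
  qed
qed

text \<open>Both sums consist of the powers (i - n)^K, taken up to n and up to n + p - q. Beyond the
  common part i < n - q at most p + q terms remain, all with \<bar>i - n\<bar> \<le> p + q. Column j
  of the determinant uses p = \<open>part \<mu> j\<close> and q = \<open>Suc j\<close>, so the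
  correction stays bounded as n grows.\<close>

lemma power_sum_correction:
  assumes "q \<le> n"
  shows "\<bar>(\<Sum>a<n. (- real (Suc a)) ^ K) - (\<Sum>i<p + (n - q). (real i - real n) ^ K)\<bar> \<le> real (p + q) ^ Suc K"
proof -
  let ?f = "\<lambda>i. (real i - real n) ^ K"
  have "(\<Sum>a<n. (- real (Suc a)) ^ K) = (\<Sum>i<n. (- real (Suc (n - Suc i))) ^ K)"
    by (rule sum.nat_diff_reindex [symmetric])
  also have "\<dots> = sum ?f {..<n}"
    by (intro sum.cong refl arg_cong [where f = "\<lambda>x. x ^ K"]) (auto simp: of_nat_diff)
  also have "\<dots> = sum ?f {..<n - q} + sum ?f {n - q..<n}"
    using sum.atLeastLessThan_concat [of 0 "n - q" n ?f] by (simp add: lessThan_atLeast0)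
  finally have 1: "(\<Sum>a<n. (- real (Suc a)) ^ K) = sum ?f {..<n - q} + sum ?f {n - q..<n}" .
  have 2: "sum ?f {..<p + (n - q)} = sum ?f {..<n - q} + sum ?f {n - q..<p + (n - q)}"
    using sum.atLeastLessThan_concat [of 0 "n - q" "p + (n - q)" ?f] by (simp add: lessThan_atLeast0)
  have bd: "\<bar>?f i\<bar> \<le> real (p + q) ^ K" if "n - q \<le> i" "i < n + p" for i
    using that assms unfolding power_abs by (intro power_mono) auto
  have A: "\<bar>sum ?f {n - q..<n}\<bar> \<le> real q * real (p + q) ^ K"
  proof -
    have "\<bar>sum ?f {n - q..<n}\<bar> \<le> (\<Sum>i\<in>{n - q..<n}. real (p + q) ^ K)"
      by (intro order_trans [OF sum_abs] sum_mono bd) auto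
    then show ?thesis using assms by simp
  qed
  have B: "\<bar>sum ?f {n - q..<p + (n - q)}\<bar> \<le> real p * real (p + q) ^ K"
  proof -
    have "\<bar>sum ?f {n - q..<p + (n - q)}\<bar> \<le> (\<Sum>i\<in>{n - q..<p + (n - q)}. real (p + q) ^ K)"
      by (intro order_trans [OF sum_abs] sum_mono bd) (use assms in auto)
    then show ?thesis by simp
  qed
  have "\<bar>sum ?f {n - q..<n} - sum ?f {n - q..<p + (n - q)}\<bar> \<le> real q * real (p + q) ^ K + real p * real (p + q) ^ K"
    using A B by linarith
  then show ?thesis
    unfolding 1 2 by (simp add: algebra_simps)
qed

lemma tendsto_log_coefficients:
  fixes n :: "nat \<Rightarrow> nat"
  assumes n: "filterlim (\<lambda>L. real (n L)) at_top sequentially"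
    and Q: "(\<lambda>L. ((\<Sum>a<n L. (real_of_int (lam L ! a) - real (Suc a)) ^ Suc k) - (\<Sum>a<n L. (- real (Suc a)) ^ Suc k))
      / real (n L) ^ Suc k) \<longlonglongrightarrow> l"
  shows "(\<lambda>L. ((\<Sum>a<n L. (real_of_int (lam L ! a) - real (Suc a)) ^ Suc k)
      - (\<Sum>i<p + (n L - q). (real i - real (n L)) ^ Suc k)) / real (n L) ^ Suc k) \<longlonglongrightarrow> l"
proof -
  let ?corr = "\<lambda>L. (\<Sum>a<n L. (- real (Suc a)) ^ Suc k) - (\<Sum>i<p + (n L - q). (real i - real (n L)) ^ Suc k)"
  have inv: "(\<lambda>L. 1 / real (n L)) \<longlonglongrightarrow> 0"
    by (rule tendsto_divide_0 [OF tendsto_const filterlim_at_top_imp_at_infinity [OF n]])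
  have "(\<lambda>L. real (p + q) ^ Suc (Suc k) * (1 / real (n L)) ^ Suc k) \<longlonglongrightarrow> real (p + q) ^ Suc (Suc k) * 0 ^ Suc k"
    by (intro tendsto_intros inv)
  then have lim0: "(\<lambda>L. real (p + q) ^ Suc (Suc k) * (1 / real (n L)) ^ Suc k) \<longlonglongrightarrow> 0" by simp
  have "(\<lambda>L. ?corr L / real (n L) ^ Suc k)
    \<longlonglongrightarrow> 0"
  proof (rule tendsto_rabs_zero_cancel, rule tendsto_sandwich [OF _ _ tendsto_const lim0])
    have "eventually (\<lambda>L. real q < real (n L)) sequentially"
      using n unfolding filterlim_at_top_dense by blast
    then show "\<forall>\<^sub>F L in sequentially. \<bar>?corr L / real (n L) ^ Suc k\<bar>
      \<le> real (p + q) ^ Suc (Suc k) * (1 / real (n L)) ^ Suc k"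
    proof eventually_elim
      case (elim L)
      then have "\<bar>?corr L\<bar> / real (n L) ^ Suc k
         \<le> real (p + q) ^ Suc (Suc k) / real (n L) ^ Suc k"
        by (intro divide_right_mono power_sum_correction) auto
      moreover have "\<bar>real (n L) ^ Suc k\<bar> = real (n L) ^ Suc k" by (intro abs_of_nonneg) simp
      ultimately show ?case by (simp only: abs_divide power_divide power_one times_divide_eq_right mult_1_right)
    qed
  qed simp
  from tendsto_add [OF Q this] show ?thesis
    by (simp only: add_divide_distrib [symmetric]) simp
qed

section \<open>Expansion of the limit function\<close>

text \<open>The limit of $N^{-q-1} \sum c^q$, summed over the contents $c$ of the boxes of $\lambda^\pm$.\<close>

definition limit_moment :: "real \<Rightarrow> (nat \<Rightarrow> real) \<Rightarrow> (nat \<Rightarrow> real) \<Rightarrow> nat \<Rightarrow> real" where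
  "limit_moment g \<alpha> \<beta> q =
    (if q = 0 then g else 0) + (\<Sum>i. \<alpha> i ^ Suc q + (-1) ^ q * \<beta> i ^ Suc q) / real (Suc q)"

lemma sums_Ln_quotient:
  assumes "cmod (complex_of_real a * x) < 1" "cmod (complex_of_real b * x) < 1"
  shows "(\<lambda>q. complex_of_real ((a ^ Suc q + (-1) ^ q * b ^ Suc q) / real (Suc q)) * x ^ Suc q) sums
    (Ln (1 + complex_of_real b * x) - Ln (1 - complex_of_real a * x))"
proof -
  have series: "(\<lambda>q. (-1) ^ q / of_nat (Suc q) * z ^ Suc q) sums Ln (1 + z)" if "cmod z < 1" for z :: complex
  proof -
    have "(\<lambda>n. (- 1) ^ Suc n / of_nat n * z ^ n) sums Ln (1 + z)"
      by (rule Ln_series) fact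
    then have "(\<lambda>n. (- 1) ^ Suc (Suc n) / of_nat (Suc n) * z ^ Suc n) sums Ln (1 + z)"
      by (subst sums_Suc_iff) simp
    then show ?thesis by simp
  qed
  have "(\<lambda>q. (-1) ^ q / of_nat (Suc q) * (of_real b * x) ^ Suc q - (-1) ^ q / of_nat (Suc q) * (- (of_real a * x)) ^ Suc q)
     sums (Ln (1 + complex_of_real b * x) - Ln (1 + - (of_real a * x)))"
    using assms by (intro sums_diff series) auto
  also have "(\<lambda>q. (-1) ^ q / of_nat (Suc q) * (of_real b * x) ^ Suc q - (-1) ^ q / of_nat (Suc q) * (- (of_real a * x)) ^ Suc q)
     = (\<lambda>q. complex_of_real ((a ^ Suc q + (-1) ^ q * b ^ Suc q) / real (Suc q)) * x ^ Suc q)"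
  proof
    fix q
    have "(-1) ^ q * (- (of_real a * x)) ^ Suc q = - ((of_real a * x) ^ Suc q)"
      by (simp add: power_minus' power_mult_distrib)
    then have eq: "(-1) ^ q / of_nat (Suc q) * (- (of_real a * x)) ^ Suc q = - ((of_real a * x) ^ Suc q / of_nat (Suc q))"
      by (simp only: times_divide_eq_left minus_divide_left)
    show "(-1) ^ q / of_nat (Suc q) * (of_real b * x) ^ Suc q - (-1) ^ q / of_nat (Suc q) * (- (of_real a * x)) ^ Suc q
     = complex_of_real ((a ^ Suc q + (-1) ^ q * b ^ Suc q) / real (Suc q)) * x ^ Suc q"
      unfolding eq by (simp add: power_mult_distrib add_divide_distrib ring_distribs mult_ac del: of_nat_Suc)
  qed
  finally show ?thesis by simp
qed

text \<open>Taking logarithms factor by factor gives a double series in the factor j and the power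
  q. The order of summation is exchanged by dominated convergence with the bound
  \<open>(\<alpha> j + \<beta> j) * R ^ q\<close>; here \<open>R = 1 + T\<close> exceeds every
  single parameter, and the assumption on \<open>x\<close> makes the geometric series of ratio
  \<open>R * cmod x\<close> converge.\<close>

lemma sums_log_param:
  fixes \<alpha> \<beta> :: "nat \<Rightarrow> real" and x :: complex and g :: real
  assumes nonneg: "\<And>i. \<alpha> i \<ge> 0" "\<And>i. \<beta> i \<ge> 0" and summ: "summable (\<lambda>i. \<alpha> i + \<beta> i)"
    and x: "cmod x * (1 + (\<Sum>i. \<alpha> i + \<beta> i)) < 1"
  defines "t \<equiv> \<lambda>j. Ln (1 + complex_of_real (\<beta> j) * x) - Ln (1 - complex_of_real (\<alpha> j) * x)"
  shows "summable t"
    and "(\<lambda>q. complex_of_real (limit_moment g \<alpha> \<beta> q) * x ^ Suc q) sums (complex_of_real g * x + suminf t)"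
    and "exp (t j) = (1 + complex_of_real (\<beta> j) * x) / (1 - complex_of_real (\<alpha> j) * x)"
proof -
  define T where "T = (\<Sum>i. \<alpha> i + \<beta> i)"
  define R where "R = 1 + T"
  define c where "c = (\<lambda>j q. (\<alpha> j ^ Suc q + (-1) ^ q * \<beta> j ^ Suc q) / real (Suc q))"
  let ?a = "\<lambda>j q. complex_of_real (c j q) * x ^ Suc q" and ?b = "\<lambda>q. complex_of_real (\<Sum>j. c j q) * x ^ Suc q"
  have le_T: "\<alpha> j + \<beta> j \<le> T" for j
    unfolding T_def using sum_le_suminf [OF summ, of "{j}"] nonneg by (simp add: add_nonneg_nonneg)
  have ab: "\<alpha> j \<le> R" "\<beta> j \<le> R" for j
    using le_T [of j] nonneg [of j] by (auto simp: R_def)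
  have T: "T \<ge> 0" using le_T [of 0] nonneg [of 0] by linarith
  have xR: "cmod x * R < 1" using x by (simp add: R_def T_def)
  have small: "cmod (complex_of_real a * x) < 1" if "0 \<le> a" "a \<le> R" for a
  proof -
    have "cmod (complex_of_real a * x) \<le> cmod x * R"
      using that by (simp add: norm_mult mult.commute mult_right_mono)
    then show ?thesis using xR by simp
  qed
  have t: "(\<lambda>q. ?a j q) sums t j" for j
    unfolding c_def t_def using small ab nonneg by (intro sums_Ln_quotient) auto
  have c_bound: "\<bar>c j q\<bar> \<le> (\<alpha> j + \<beta> j) * R ^ q" for j q
  proof -
    have "\<bar>c j q\<bar> \<le> \<bar>\<alpha> j ^ Suc q + (-1) ^ q * \<beta> j ^ Suc q\<bar> / 1"
      unfolding c_def abs_divide by (intro divide_left_mono) auto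
    also have "\<dots> \<le> \<bar>\<alpha> j ^ Suc q\<bar> + \<bar>(-1) ^ q * \<beta> j ^ Suc q\<bar>"
      using abs_triangle_ineq by simp
    also have "\<dots> = \<alpha> j * \<alpha> j ^ q + \<beta> j * \<beta> j ^ q"
      using nonneg [of j] by (simp add: abs_mult power_abs)
    also have "\<dots> \<le> \<alpha> j * R ^ q + \<beta> j * R ^ q"
      using nonneg ab by (intro add_mono mult_left_mono power_mono) auto
    finally show ?thesis by (simp add: distrib_right)
  qed
  have c_summ: "summable (\<lambda>j. c j q)" for q
    by (rule summable_comparison_test' [where N = 0, OF summable_mult2 [OF summ, of "R ^ q"]]) (use c_bound in auto)
  have "(\<forall>\<^sub>F n in sequentially. summable (\<lambda>q. norm (\<Sum>j<n. ?a j q)))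
     \<and> summable (\<lambda>q. norm (?b q))
     \<and> (\<lambda>n. \<Sum>q. \<Sum>j<n. ?a j q) \<longlonglongrightarrow> (\<Sum>q. ?b q)"
  proof (rule tannerys_theorem)
    fix q
    have "(\<lambda>j. ?a j q) sums (?b q)"
      by (intro sums_mult2 sums_of_real summable_sums c_summ)
    then show "(\<lambda>n. \<Sum>j<n. ?a j q) \<longlonglongrightarrow> ?b q"
      by (simp only: sums_def)
  next
    have "norm (\<Sum>j<n. ?a j q) \<le> T * cmod x * (R * cmod x) ^ q" for n q
    proof -
      have "norm (\<Sum>j<n. ?a j q) \<le> (\<Sum>j<n. (\<alpha> j + \<beta> j) * (R ^ q * cmod x ^ Suc q))"
      proof (rule sum_norm_le)
        fix j
        show "norm (?a j q) \<le> (\<alpha> j + \<beta> j) * (R ^ q * cmod x ^ Suc q)"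
          using mult_right_mono [OF c_bound [of j q], of "cmod x ^ Suc q"]
          by (simp add: norm_mult norm_power mult.assoc del: power_Suc)
      qed
      also have "\<dots> = (\<Sum>j<n. \<alpha> j + \<beta> j) * (R ^ q * cmod x ^ Suc q)"
        by (simp only: sum_distrib_right)
      also have "\<dots> \<le> T * (R ^ q * cmod x ^ Suc q)"
        unfolding T_def using nonneg T
        by (intro mult_right_mono sum_le_suminf summ) (auto simp: R_def add_nonneg_nonneg)
      finally show ?thesis by (simp add: power_mult_distrib mult_ac)
    qed
    then show "\<forall>\<^sub>F (q, n) in sequentially \<times>\<^sub>F sequentially. norm (\<Sum>j<n. ?a j q)
        \<le> T * cmod x * (R * cmod x) ^ q"
      by (simp add: case_prod_unfold)
    show "summable (\<lambda>q. T * cmod x * (R * cmod x) ^ q)"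
      using xR T by (intro summable_mult summable_geometric) (simp add: R_def mult.commute abs_mult)
  qed simp
  then have summ_b: "summable (\<lambda>q. norm (?b q))"
    and lim: "(\<lambda>n. \<Sum>q. \<Sum>j<n. ?a j q) \<longlonglongrightarrow> (\<Sum>q. ?b q)"
    by auto
  have "(\<Sum>q. \<Sum>j<n. ?a j q) = (\<Sum>j<n. t j)" for n
    by (intro sums_unique [symmetric] sums_sum t)
  with lim have sums_t: "t sums (\<Sum>q. ?b q)"
    by (simp add: sums_def)
  then show "summable t" by (rule sums_summable)
  have M: "limit_moment g \<alpha> \<beta> q = (if q = 0 then g else 0) + (\<Sum>j. c j q)" for q
  proof -
    have "summable (\<lambda>j. real (Suc q) * c j q)" by (rule summable_mult [OF c_summ])
    then have "summable (\<lambda>j. \<alpha> j ^ Suc q + (-1) ^ q * \<beta> j ^ Suc q)"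
      unfolding c_def times_divide_eq_right nonzero_mult_div_cancel_left [OF of_nat_neq_0] .
    then show ?thesis unfolding limit_moment_def c_def by (simp only: suminf_divide)
  qed
  have 1: "(\<lambda>q. complex_of_real (if q = 0 then g else 0) * x ^ Suc q) sums (complex_of_real g * x)"
  proof -
    have "(\<lambda>q. complex_of_real (if q = 0 then g else 0) * x ^ Suc q) = (\<lambda>q. if q = 0 then complex_of_real g * x else 0)"
      by auto
    then show ?thesis using sums_single [of 0 "\<lambda>q. complex_of_real g * x"] by simp
  qed
  have 2: "(\<lambda>q. ?b q) sums suminf t"
    using summable_sums [OF summable_norm_cancel [OF summ_b]] sums_unique [OF sums_t] by simp
  show "(\<lambda>q. complex_of_real (limit_moment g \<alpha> \<beta> q) * x ^ Suc q) sums (complex_of_real g * x + suminf t)"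
    using sums_add [OF 1 2] by (simp only: M of_real_add distrib_right)
  have "1 + complex_of_real (\<beta> j) * x \<noteq> 0" "1 - complex_of_real (\<alpha> j) * x \<noteq> 0"
  proof -
    show "1 + complex_of_real (\<beta> j) * x \<noteq> 0"
      using small [of "\<beta> j"] nonneg ab by (metis add.inverse_inverse add_eq_0_iff less_irrefl norm_minus_cancel norm_one)
    show "1 - complex_of_real (\<alpha> j) * x \<noteq> 0"
      using small [of "\<alpha> j"] nonneg ab by (metis eq_iff_diff_eq_0 less_irrefl norm_one)
  qed
  then show "exp (t j) = (1 + complex_of_real (\<beta> j) * x) / (1 - complex_of_real (\<alpha> j) * x)"
    by (simp add: t_def exp_diff)
qed

text \<open>\<open>M q\<close> is the coefficient of the power q + 1. The constant term 0 allows the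
  series to be substituted into the exponential series.\<close>

definition log_fps :: "(nat \<Rightarrow> real) \<Rightarrow> complex fps" where
  "log_fps M = Abs_fps (\<lambda>n. case n of 0 \<Rightarrow> 0 | Suc q \<Rightarrow> complex_of_real (M q))"

lemma has_fps_expansion_log_param:
  fixes \<alpha> \<beta> :: "nat \<Rightarrow> real" and g :: real
  assumes "\<And>i. \<alpha> i \<ge> 0" "\<And>i. \<beta> i \<ge> 0" "summable (\<lambda>i. \<alpha> i + \<beta> i)"
  shows "(\<lambda>x. complex_of_real g * x +
      (\<Sum>j. Ln (1 + complex_of_real (\<beta> j) * x) - Ln (1 - complex_of_real (\<alpha> j) * x)))
    has_fps_expansion log_fps (limit_moment g \<alpha> \<beta>)"
proof -
  let ?s = "\<lambda>x. \<Sum>j. Ln (1 + complex_of_real (\<beta> j) * x) - Ln (1 - complex_of_real (\<alpha> j) * x)"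
  let ?F = "log_fps (limit_moment g \<alpha> \<beta>)"
  define R where "R = 1 + (\<Sum>i. \<alpha> i + \<beta> i)"
  have R: "R > 0"
    unfolding R_def using assms by (intro add_pos_nonneg suminf_nonneg add_nonneg_nonneg) auto
  have "(\<lambda>n. fps_nth ?F n * x ^ n) sums
      (complex_of_real g * x + ?s x)"
    if "cmod x < 1 / R" for x
  proof -
    have "cmod x * R < 1" using that R by (simp add: field_simps)
    then have "(\<lambda>q. complex_of_real (limit_moment g \<alpha> \<beta> q) * x ^ Suc q) sums
       (complex_of_real g * x + ?s x)"
      using assms by (intro sums_log_param(2)) (auto simp: R_def)
    then show ?thesis
      using sums_Suc_iff [of "\<lambda>n. fps_nth ?F n * x ^ n"]
      by (simp add: log_fps_def)
  qed
  note sums = this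
  \<comment> \<open>A point strictly inside the disc of radius 1/R on which the expansion has just
    been summed.\<close>
  have "cmod (complex_of_real (1 / (2 * R))) \<le> conv_radius (fps_nth ?F)"
    using R by (intro conv_radius_geI sums_summable [OF sums]) (auto simp: norm_divide field_simps)
  moreover have "0 < cmod (complex_of_real (1 / (2 * R)))" using R by simp
  ultimately have "fps_conv_radius ?F > 0"
    unfolding fps_conv_radius_def using less_le_trans by (metis ereal_less(2))
  moreover have "eventually (\<lambda>x. x \<in> ball 0 (1 / R)) (nhds (0::complex))"
    using R by (intro eventually_nhds_in_open) auto
  then have "eventually (\<lambda>x. eval_fps ?F x = complex_of_real g * x +
      ?s x) (nhds 0)"
    by eventually_elim (use sums_unique [OF sums] in \<open>simp add: eval_fps_def\<close>)
  ultimately show ?thesis by (simp add: has_fps_expansion_def)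
qed

text \<open>\<open>Y\<close> is -X/(1+X), the substitution that turns z - 1 into 1/z - 1. Multiplied
  by a power of \<open>Y\<close>, its equation becomes Pascal's rule with alternating signs. The
  binomial coefficients are those of \<open>tendsto_sum_power_shift\<close>: inverting z corresponds
  to the shift by n on the negative parts.\<close>

lemma fps_nth_inversion_power:
  fixes Y :: "complex fps"
  assumes "Y * (1 + fps_X) = - fps_X"
  shows "fps_nth (Y ^ Suc i) (Suc k) = (-1) ^ Suc k * of_nat (k choose i)"
proof (induction k arbitrary: i)
  have "fps_nth (Y * (1 + fps_X)) 0 = 0" unfolding assms by simp
  then have Y0: "fps_nth Y 0 = 0" by (simp add: fps_mult_nth_0)
  have "Y ^ Suc i + Y ^ Suc i * fps_X = - (Y ^ i * fps_X)" for i
  proof -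
    have "Y ^ Suc i + Y ^ Suc i * fps_X = Y ^ i * (Y * (1 + fps_X))"
      by (simp add: algebra_simps)
    then show ?thesis unfolding assms by simp
  qed
  then have *: "fps_nth (Y ^ Suc i + Y ^ Suc i * fps_X) (Suc k) = fps_nth (- (Y ^ i * fps_X)) (Suc k)" for i k
    by (rule arg_cong)
  then have rec: "fps_nth (Y ^ Suc i) (Suc k) = - fps_nth (Y ^ Suc i) k - fps_nth (Y ^ i) k" for i k
  proof -
    have "fps_nth (Y ^ Suc i) (Suc k) + fps_nth (Y ^ Suc i) k = - fps_nth (Y ^ i) k"
      using * [of i k] by simp
    then show ?thesis by (metis add_diff_cancel_right' minus_diff_commute)
  qed
  {
    case 0
    show ?case unfolding rec by (cases i) (auto simp: Y0 fps_mult_nth_0 fps_nth_power_0)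
  next
    case (Suc k)
    show ?case
    proof (cases i)
      case 0
      then show ?thesis unfolding rec [of _ "Suc k"] Suc.IH by simp
    next
      case (Suc j)
      then show ?thesis unfolding rec [of _ "Suc k"] Suc Suc.IH by (simp add: algebra_simps)
    qed
  }
qed

text \<open>Near 0 the function \<Phi>(1+x) is the exponential of
  \<open>Lp x + Lm (inverse (1 + x) - 1)\<close>, so \<open>h\<close> is the exponential series
  composed with the expansion \<open>F\<close> of the exponent, and \<open>Q\<close> is the
  derivative of \<open>F\<close>. Its coefficients have the form in which the limits of the power
  sums appear.\<close>

lemma h_param_eq_fps_nth:
  assumes "\<omega> \<in> Omega"
  obtains h Q :: "complex fps" where "\<And>k. h_param \<omega> (int k) = fps_nth h k"
    "fps_deriv h = h * Q" "fps_nth h 0 = 1"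
    "\<And>k. fps_nth Q k = complex_of_real (real (Suc k) * (limit_moment (gamma_p \<omega>) (alpha_p \<omega>) (beta_p \<omega>) k
       + (-1) ^ Suc k * (\<Sum>j\<le>k. real (k choose j) * limit_moment (gamma_m \<omega>) (alpha_m \<omega>) (beta_m \<omega>) j)))"
proof -
  let ?t = "\<lambda>\<alpha> \<beta> x j. Ln (1 + complex_of_real (\<beta> j) * x) - Ln (1 - complex_of_real (\<alpha> j) * x)"
  define Lp where "Lp = (\<lambda>x. complex_of_real (gamma_p \<omega>) * x + suminf (?t (alpha_p \<omega>) (beta_p \<omega>) x))"
  define Lm where "Lm = (\<lambda>x. complex_of_real (gamma_m \<omega>) * x + suminf (?t (alpha_m \<omega>) (beta_m \<omega>) x))"
  define Mp where "Mp = limit_moment (gamma_p \<omega>) (alpha_p \<omega>) (beta_p \<omega>)"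
  define Mm where "Mm = limit_moment (gamma_m \<omega>) (alpha_m \<omega>) (beta_m \<omega>)"
  have nonneg: "\<And>i. alpha_p \<omega> i \<ge> 0" "\<And>i. beta_p \<omega> i \<ge> 0" "\<And>i. alpha_m \<omega> i \<ge> 0" "\<And>i. beta_m \<omega> i \<ge> 0"
    and summ: "summable (\<lambda>i. alpha_p \<omega> i + beta_p \<omega> i)" "summable (\<lambda>i. alpha_m \<omega> i + beta_m \<omega> i)"
    using assms by (auto simp: Omega_def)
  define Y :: "complex fps" where "Y = inverse (1 + fps_X) - 1"
  define F where "F = log_fps Mp + (log_fps Mm oo Y)"
  have Y: "Y * (1 + fps_X) = - fps_X"
    unfolding Y_def left_diff_distrib by (subst inverse_mult_eq_1) (auto simp: algebra_simps)
  have Y0: "fps_nth Y 0 = 0" by (simp add: Y_def)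
  have expY: "(\<lambda>x. inverse (1 + x) - 1) has_fps_expansion Y"
    unfolding Y_def by (intro fps_expansion_intros) simp
  have F0: "fps_nth F 0 = 0" by (simp add: F_def log_fps_def)
  have "(\<lambda>x. Lp x + (Lm \<circ> (\<lambda>x. inverse (1 + x) - 1)) x) has_fps_expansion F"
    unfolding F_def Lp_def Lm_def Mp_def Mm_def
    by (intro has_fps_expansion_add has_fps_expansion_compose has_fps_expansion_log_param nonneg summ expY Y0)
  then have exp: "(exp \<circ> (\<lambda>x. Lp x + (Lm \<circ> (\<lambda>x. inverse (1 + x) - 1)) x)) has_fps_expansion (fps_exp 1 oo F)"
    by (intro has_fps_expansion_compose has_fps_expansion_exp1 F0)
  have small: "eventually (\<lambda>x. cmod x * c < 1) (nhds 0)" for c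
  proof -
    have "((\<lambda>x. cmod x * c) \<longlongrightarrow> cmod 0 * c) (nhds 0)"
      by (intro tendsto_intros filterlim_ident)
    then show ?thesis by (intro order_tendstoD(2)) auto
  qed
  have small': "eventually (\<lambda>x. cmod (inverse (1 + x) - 1) * c < 1) (nhds 0)" for c
  proof -
    have "((\<lambda>x::complex. cmod (inverse (1 + x) - 1) * c) \<longlongrightarrow> cmod (inverse (1 + 0) - 1) * c) (nhds 0)"
      by (intro tendsto_intros filterlim_ident) auto
    then show ?thesis by (intro order_tendstoD(2)) auto
  qed
  \<comment> \<open>Both \<open>x\<close> and \<open>inverse (1 + x) - 1\<close> tend to 0, so
    eventually both lie in the discs where the logarithmic series are available.\<close>
  have ev: "eventually (\<lambda>x. (exp \<circ> (\<lambda>x. Lp x + (Lm \<circ> (\<lambda>x. inverse (1 + x) - 1)) x)) x = Phi \<omega> (1 + x)) (nhds 0)"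
    using small [of "1 + (\<Sum>i. alpha_p \<omega> i + beta_p \<omega> i)"]
      small' [of "1 + (\<Sum>i. alpha_m \<omega> i + beta_m \<omega> i)"]
  proof eventually_elim
    case (elim x)
    let ?y = "inverse (1 + x) - 1"
    note p = sums_log_param [OF nonneg(1,2) summ(1) elim(1)]
    note m = sums_log_param [OF nonneg(3,4) summ(2) elim(2)]
    have "prodinf (\<lambda>j. (1 + of_real (beta_p \<omega> j) * x) / (1 - of_real (alpha_p \<omega> j) * x) *
      ((1 + of_real (beta_m \<omega> j) * ?y) / (1 - of_real (alpha_m \<omega> j) * ?y)))
      = prodinf (\<lambda>j. exp (?t (alpha_p \<omega>) (beta_p \<omega>) x j + ?t (alpha_m \<omega>) (beta_m \<omega>) ?y j))"
      by (simp only: exp_add p(3) m(3))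
    also have "\<dots> = exp (\<Sum>j. ?t (alpha_p \<omega>) (beta_p \<omega>) x j + ?t (alpha_m \<omega>) (beta_m \<omega>) ?y j)"
      by (intro prodinf_exp summable_add p(1) m(1))
    also have "\<dots> = exp (suminf (?t (alpha_p \<omega>) (beta_p \<omega>) x)) * exp (suminf (?t (alpha_m \<omega>) (beta_m \<omega>) ?y))"
      by (simp only: suminf_add [OF p(1) m(1), symmetric] exp_add)
    finally show ?case
      by (simp add: Phi_def Lp_def Lm_def exp_add)
  qed
  have "(\<lambda>x. Phi \<omega> (1 + x)) has_fps_expansion (fps_exp 1 oo F)"
    using exp unfolding has_fps_expansion_cong [OF ev refl] .
  then have "fps_expansion (\<lambda>x. Phi \<omega> (1 + x)) 0 = fps_exp 1 oo F"
    by (rule fps_expansion_eqI)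
  then have h: "h_param \<omega> (int k) = fps_nth (fps_exp 1 oo F) k" for k
    by (simp add: h_param_def)
  have der: "fps_deriv (fps_exp 1 oo F) = (fps_exp 1 oo F) * fps_deriv F"
    by (simp add: fps_compose_deriv [OF F0])
  have Q: "fps_nth (fps_deriv F) k = complex_of_real (real (Suc k) * (Mp k + (-1) ^ Suc k * (\<Sum>j\<le>k. real (k choose j) * Mm j)))" for k
  proof -
    have "fps_nth (log_fps Mm oo Y) (Suc k) = (\<Sum>i=0..Suc k. fps_nth (log_fps Mm) i * fps_nth (Y ^ i) (Suc k))"
      by (rule fps_compose_nth)
    also have "\<dots> = (\<Sum>i\<le>k. fps_nth (log_fps Mm) (Suc i) * fps_nth (Y ^ Suc i) (Suc k))"
      by (subst sum.atLeast0_atMost_Suc_shift) (simp add: log_fps_def atMost_atLeast0)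
    also have "\<dots> = (\<Sum>i\<le>k. complex_of_real (Mm i) * ((-1) ^ Suc k * of_nat (k choose i)))"
      by (simp only: fps_nth_inversion_power [OF Y]) (simp add: log_fps_def)
    also have "\<dots> = complex_of_real ((-1) ^ Suc k * (\<Sum>j\<le>k. real (k choose j) * Mm j))"
      by (simp add: sum_distrib_left mult_ac sum_negf)
    finally have "fps_nth F (Suc k) = complex_of_real (Mp k + (-1) ^ Suc k * (\<Sum>j\<le>k. real (k choose j) * Mm j))"
      by (simp add: F_def log_fps_def)
    then show ?thesis
      by (simp only: fps_deriv_nth Suc_eq_plus1 [symmetric] of_real_mult of_real_of_nat_eq)
  qed
  show ?thesis
    by (rule that [OF h der _ Q [unfolded Mp_def Mm_def]]) simp
qed

section \<open>The limit of the shifted Schur polynomials\<close>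

lemma prod_power_int:
  fixes x :: "'a::field"
  assumes "x \<noteq> 0"
  shows "(\<Prod>i\<in>A. x powi f i) = x powi (\<Sum>i\<in>A. f i)"
  using assms by (induction A rule: infinite_finite_induct) (auto simp: power_int_add)

lemma strict_mono_on_ge_id:
  fixes N :: "nat \<Rightarrow> nat"
  assumes "strict_mono_on {1..} N" "N 1 > 0" "L \<ge> 1"
  shows "L \<le> N L"
  using assms(3)
proof (induction L rule: dec_induct)
  case (step L)
  then have "N L < N (Suc L)" using assms(1) by (auto simp: strict_mono_on_def)
  then show ?case using step by simp
qed (use assms(2) in simp)

text \<open>The moment of order 0 is the number of boxes, whose limit \<delta> equals \<gamma> plus
  the sum of all \<alpha> and \<beta>; this is \<open>limit_moment\<close> at 0 by definition. From
  order 1 on \<gamma> no longer appears and dominated convergence applies.\<close>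

lemma tendsto_signature_log_coefficients:
  fixes N :: "nat \<Rightarrow> nat"
  assumes N: "filterlim (\<lambda>L. real (N L)) at_top sequentially"
    and lam: "\<And>L. L \<ge> 1 \<Longrightarrow> lam L \<in> Sign (N L)"
    and \<omega>: "\<omega> \<in> Omega" and vk: "vershik_kerov N lam \<omega>"
  shows "(\<lambda>L. ((\<Sum>a<N L. (real_of_int (lam L ! a) - real (Suc a)) ^ Suc k) - (\<Sum>a<N L. (- real (Suc a)) ^ Suc k))
      / real (N L) ^ Suc k) \<longlonglongrightarrow>
    real (Suc k) * (limit_moment (gamma_p \<omega>) (alpha_p \<omega>) (beta_p \<omega>) k
       + (-1) ^ Suc k * (\<Sum>j\<le>k. real (k choose j) * limit_moment (gamma_m \<omega>) (alpha_m \<omega>) (beta_m \<omega>) j))"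
proof -
  have moments: "(\<lambda>L. (\<Sum>i<N L. \<Sum>m<p L i. (real m - real i) ^ q) / real (N L) ^ Suc q) \<longlonglongrightarrow> limit_moment g \<alpha> \<beta> q"
    if "\<And>L. L \<ge> 1 \<Longrightarrow> antimono (p L)" "\<And>L. L \<ge> 1 \<Longrightarrow> \<forall>i\<ge>N L. p L i = 0"
      "\<And>i. (\<lambda>L. half_coord (p L) i / real (N L)) \<longlonglongrightarrow> \<alpha> i" "\<And>i. \<alpha> i \<ge> 0"
      "\<And>i. (\<lambda>L. half_coord (transposed (p L)) i / real (N L)) \<longlonglongrightarrow> \<beta> i" "\<And>i. \<beta> i \<ge> 0"
      "(\<lambda>L. real (\<Sum>i<N L. p L i) / real (N L)) \<longlonglongrightarrow> g + (\<Sum>i. \<alpha> i + \<beta> i)"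
    for p :: "nat \<Rightarrow> nat \<Rightarrow> nat" and \<alpha> \<beta> g q
  proof (cases "q = 0")
    case True
    then show ?thesis using that(7) by (simp add: limit_moment_def)
  next
    case False
    then have "q \<ge> 1" by simp
    from tendsto_contents_moment [OF that(1,2) N that(3-7) this] False show ?thesis
      by (simp add: limit_moment_def)
  qed
  have nonneg: "\<And>i. alpha_p \<omega> i \<ge> 0" "\<And>i. beta_p \<omega> i \<ge> 0" "\<And>i. alpha_m \<omega> i \<ge> 0" "\<And>i. beta_m \<omega> i \<ge> 0"
    using \<omega> by (auto simp: Omega_def)
  obtain \<delta>p \<delta>m where vk':
    "\<And>i. (\<lambda>L. half_coord (sig_pos (lam L)) i / real (N L)) \<longlonglongrightarrow> alpha_p \<omega> i"
    "\<And>i. (\<lambda>L. half_coord (sig_neg (lam L)) i / real (N L)) \<longlonglongrightarrow> alpha_m \<omega> i"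
    "\<And>i. (\<lambda>L. half_coord (transposed (sig_pos (lam L))) i / real (N L)) \<longlonglongrightarrow> beta_p \<omega> i"
    "\<And>i. (\<lambda>L. half_coord (transposed (sig_neg (lam L))) i / real (N L)) \<longlonglongrightarrow> beta_m \<omega> i"
    and \<delta>: "(\<lambda>L. real (\<Sum>i<N L. sig_pos (lam L) i) / real (N L)) \<longlonglongrightarrow> \<delta>p"
      "(\<lambda>L. real (\<Sum>i<N L. sig_neg (lam L) i) / real (N L)) \<longlonglongrightarrow> \<delta>m"
      "gamma_p \<omega> = \<delta>p - (\<Sum>i. alpha_p \<omega> i + beta_p \<omega> i)"
      "gamma_m \<omega> = \<delta>m - (\<Sum>i. alpha_m \<omega> i + beta_m \<omega> i)"
    using vk unfolding vershik_kerov_def by blast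
  have \<delta>': "\<delta>p = gamma_p \<omega> + (\<Sum>i. alpha_p \<omega> i + beta_p \<omega> i)"
    "\<delta>m = gamma_m \<omega> + (\<Sum>i. alpha_m \<omega> i + beta_m \<omega> i)"
    using \<delta>(3,4) by simp_all
  have neg: "antimono (sig_neg (lam L))" "\<forall>i\<ge>N L. sig_neg (lam L) i = 0" if "L \<ge> 1" for L
    unfolding sig_neg_def using antimono_sig_pos sig_pos_support uminus_rev_Sign [OF lam [OF that]] by blast+
  show ?thesis
  proof (rule tendsto_signature_power_sum [OF lam N])
    show "(\<lambda>L. (\<Sum>i<N L. \<Sum>m<sig_pos (lam L) i. (real m - real i) ^ q) / real (N L) ^ Suc q)
        \<longlonglongrightarrow> limit_moment (gamma_p \<omega>) (alpha_p \<omega>) (beta_p \<omega>) q" for q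
      by (rule moments [OF antimono_sig_pos [OF lam] sig_pos_support [OF lam] vk'(1) nonneg(1) vk'(3) nonneg(2)
            \<delta>(1) [unfolded \<delta>']])
    show "(\<lambda>L. (\<Sum>i<N L. \<Sum>m<sig_neg (lam L) i. (real m - real i) ^ q) / real (N L) ^ Suc q)
        \<longlonglongrightarrow> limit_moment (gamma_m \<omega>) (alpha_m \<omega>) (beta_m \<omega>) q" for q
      by (rule moments [OF neg vk'(2) nonneg(3) vk'(4) nonneg(4) \<delta>(2) [unfolded \<delta>']])
  qed
qed

text \<open>Entry (i, j) of the collapsed determinant is the coefficient of index
  \<open>d i j\<close> of a series, so it is scaled by that power of \<open>N L\<close>. Along a
  permutation the shifts by i and by j cancel and the exponents add up to
  \<open>sum_list \<mu>\<close>; the Leibniz expansion has a fixed number of terms and passes to the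
  limit.\<close>

lemma tendsto_shifted_schur:
  fixes N :: "nat \<Rightarrow> nat"
  assumes N: "filterlim (\<lambda>L. real (N L)) at_top sequentially"
    and lam: "\<And>L. L \<ge> 1 \<Longrightarrow> lam L \<in> Sign (N L)"
    and \<omega>: "\<omega> \<in> Omega" and vk: "vershik_kerov N lam \<omega>"
  shows "(\<lambda>L. complex_of_real (shifted_schur (N L) \<mu> (\<lambda>i. real_of_int (lam L ! i))) / of_nat (N L ^ sum_list \<mu>))
    \<longlonglongrightarrow> schur_param \<mu> \<omega>"
proof -
  define n where "n = length \<mu>"
  define x where "x = (\<lambda>L i. real_of_int (lam L ! i))"
  define m where "m = (\<lambda>L j. part \<mu> j + (N L - Suc j))"
  define E where "E = (\<lambda>i j L. fps_nth (fps_X ^ (N L - 1) * shifted_schur_series (N L) (x L) (m L j)) (i + m L j))"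
  define d where "d = (\<lambda>i j. int (part \<mu> j) - int j + int i)"
  let ?E = "\<lambda>i j L. complex_of_real (E i j L / real (N L) powi d i j)"
  let ?s = "\<lambda>j k L. complex_of_real (fps_nth (shifted_schur_series (N L) (x L) (m L j)) k / real (N L) ^ k)"
  obtain h Q where h: "\<And>k. h_param \<omega> (int k) = fps_nth h k"
    "fps_deriv h = h * Q" "fps_nth h 0 = 1"
    and Q: "\<And>k. fps_nth Q k = complex_of_real (real (Suc k) * (limit_moment (gamma_p \<omega>) (alpha_p \<omega>) (beta_p \<omega>) k
       + (-1) ^ Suc k * (\<Sum>j\<le>k. real (k choose j) * limit_moment (gamma_m \<omega>) (alpha_m \<omega>) (beta_m \<omega>) j)))"
    using h_param_eq_fps_nth [OF \<omega>] by blast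
  have large: "eventually (\<lambda>L. real n < real (N L)) sequentially"
    using N unfolding filterlim_at_top_dense by blast
  have series: "(\<lambda>L. ?s j k L) \<longlonglongrightarrow> fps_nth h k" for j k
  proof (rule tendsto_fps_nth_logarithmic [OF fps_deriv_shifted_schur_series fps_nth_0_shifted_schur_series h(2,3)])
    show "\<forall>\<^sub>F L in sequentially. real (N L) \<noteq> 0"
      using large by eventually_elim auto
    show "(\<lambda>L. complex_of_real (fps_nth (Abs_fps (\<lambda>k. (\<Sum>a<N L. (x L a - real (Suc a)) ^ Suc k)
        - (\<Sum>i<m L j. (real i - real (N L)) ^ Suc k))) k / real (N L) ^ Suc k)) \<longlonglongrightarrow> fps_nth Q k" for k
      unfolding Q fps_nth_Abs_fps x_def m_def
      by (intro tendsto_of_real tendsto_log_coefficients N tendsto_signature_log_coefficients lam \<omega> vk)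
  qed
  have entry: "(\<lambda>L. ?E i j L) \<longlonglongrightarrow> h_param \<omega> (d i j)" if "j < n" for i j
  proof (cases "d i j < 0")
    \<comment> \<open>A negative index falls below the factor X^(N-1). The entry is 0 as soon as
      \<open>N L > n\<close>, in agreement with \<open>h_param\<close> at negative arguments. Such
      indices are the reason for the integer powers.\<close>
    case True
    have "\<forall>\<^sub>F L in sequentially. 0 = ?E i j L"
      using large
    proof eventually_elim
      case (elim L)
      then have "i + m L j < N L - 1" using True that by (simp add: m_def d_def)
      then show ?case by (simp add: E_def fps_X_power_mult_nth)
    qed
    then show ?thesis
      using True by (intro Lim_transform_eventually [OF tendsto_const]) (auto simp: h_param_def)
  next
    case False
    define k where "k = nat (d i j)"
    have k: "d i j = int k" using False by (simp add: k_def)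
    show ?thesis
    proof (rule Lim_transform_eventually)
      show "(\<lambda>L. ?s j k L) \<longlonglongrightarrow> h_param \<omega> (d i j)"
        unfolding k h(1) by (rule series)
      show "\<forall>\<^sub>F L in sequentially. ?s j k L
         = ?E i j L"
        using large
      proof eventually_elim
        case (elim L)
        then have "i + m L j = (N L - 1) + k" using k that by (simp add: m_def d_def)
        then show ?case by (simp add: E_def fps_X_power_mult_nth k)
      qed
    qed
  qed
  have "(\<lambda>L. \<Sum>p | p permutes {0..<n}. signof p * (\<Prod>i = 0..<n. ?E i (p i) L))
    \<longlonglongrightarrow> (\<Sum>p | p permutes {0..<n}. signof p * (\<Prod>i = 0..<n. h_param \<omega> (d i (p i))))"
    by (intro tendsto_sum tendsto_mult tendsto_const tendsto_prod entry)
      (metis atLeastLessThan_iff mem_Collect_eq permutes_in_image)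
  also have "(\<Sum>p | p permutes {0..<n}. signof p * (\<Prod>i = 0..<n. h_param \<omega> (d i (p i))))
     = Determinant.det (Matrix.mat n n (\<lambda>(i, j). h_param \<omega> (d i j)))"
    by (subst det_def' [where n = n]) (auto intro!: sum.cong prod.cong dest: permutes_in_image)
  \<comment> \<open>Here \<open>\<mu>\<close> is attached to the column index, in
    \<open>schur_param\<close> to the row index.\<close>
  also have "\<dots> = Determinant.det (transpose_mat (Matrix.mat n n (\<lambda>(i, j). h_param \<omega> (d i j))))"
    by (rule det_transpose [symmetric, OF mat_carrier])
  also have "\<dots> = schur_param \<mu> \<omega>"
    unfolding schur_param_def n_def [symmetric] d_def
    by (intro arg_cong [where f = Determinant.det] eq_matI) auto
  finally show ?thesis
  proof (rule Lim_transform_eventually)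
    show "\<forall>\<^sub>F L in sequentially. (\<Sum>p | p permutes {0..<n}. signof p * (\<Prod>i = 0..<n. ?E i (p i) L))
      = complex_of_real (shifted_schur (N L) \<mu> (\<lambda>i. real_of_int (lam L ! i))) / of_nat (N L ^ sum_list \<mu>)"
      using large eventually_ge_at_top [of "1::nat"]
    proof eventually_elim
      case (elim L)
      have anti: "lam L ! b \<le> lam L ! a" if "a < b" "b < N L" for a b
        using lam [OF elim(2)] that by (auto simp: Sign_def sorted_wrt_iff_nth_less)
      have inj: "inj_on (\<lambda>a. x L a - real (Suc a)) {..<N L}"
      proof (rule linorder_inj_onI)
        fix a b assume "a < b" "b \<in> {..<N L}"
        then show "x L a - real (Suc a) \<noteq> x L b - real (Suc b)"
          using anti [of a b] by (auto simp: x_def)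
      qed auto
      have "shifted_schur (N L) \<mu> (x L) = Determinant.det (Matrix.mat n n (\<lambda>(i, j). E i j L))"
        unfolding n_def E_def m_def using elim by (intro shifted_schur_eq_det inj) (auto simp: n_def)
      also have "\<dots> = (\<Sum>p | p permutes {0..<n}. signof p * (\<Prod>i = 0..<n. E i (p i) L))"
        by (subst det_def' [where n = n]) (auto intro!: sum.cong prod.cong dest: permutes_in_image)
      finally have "shifted_schur (N L) \<mu> (x L) / real (N L) ^ sum_list \<mu>
         = (\<Sum>p | p permutes {0..<n}. signof p * ((\<Prod>i = 0..<n. E i (p i) L) / real (N L) ^ sum_list \<mu>))"
        by (simp add: sum_divide_distrib)
      also have "\<dots> = (\<Sum>p | p permutes {0..<n}. signof p * (\<Prod>i = 0..<n. E i (p i) L / real (N L) powi d i (p i)))"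
      proof (intro sum.cong refl)
        fix p assume "p \<in> {p. p permutes {0..<n}}"
        then have p: "p permutes {0..<n}" by simp
        have "(\<Sum>i = 0..<n. d i (p i)) = (\<Sum>i = 0..<n. int (part \<mu> (p i)) - int (p i)) + (\<Sum>i = 0..<n. int i)"
          by (simp only: d_def sum.distrib)
        also have "(\<Sum>i = 0..<n. int (part \<mu> (p i)) - int (p i)) = (\<Sum>i = 0..<n. int (part \<mu> i) - int i)"
          using sum.permute [OF p, of "\<lambda>i. int (part \<mu> i) - int i"] by (simp add: o_def)
        also have "\<dots> + (\<Sum>i = 0..<n. int i) = int (\<Sum>i = 0..<n. part \<mu> i)"
          by (simp add: sum_subtractf)
        also have "(\<Sum>i = 0..<n. part \<mu> i) = sum_list \<mu>"
          by (simp add: sum_list_sum_nth n_def part_def)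
        finally have "(\<Prod>i = 0..<n. real (N L) powi d i (p i)) = real (N L) ^ sum_list \<mu>"
          using elim by (simp add: prod_power_int)
        then show "signof p * ((\<Prod>i = 0..<n. E i (p i) L) / real (N L) ^ sum_list \<mu>)
          = signof p * (\<Prod>i = 0..<n. E i (p i) L / real (N L) powi d i (p i))"
          by (simp add: prod_dividef)
      qed
      finally have *: "shifted_schur (N L) \<mu> (x L) / real (N L) ^ sum_list \<mu> =
        (\<Sum>p | p permutes {0..<n}. signof p * (\<Prod>i = 0..<n. E i (p i) L / real (N L) powi d i (p i)))" .
      have "complex_of_real (shifted_schur (N L) \<mu> (x L)) / of_nat (N L ^ sum_list \<mu>)
         = complex_of_real (shifted_schur (N L) \<mu> (x L) / real (N L) ^ sum_list \<mu>)" by simp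
      also have "\<dots> = (\<Sum>p | p permutes {0..<n}. signof p * (\<Prod>i = 0..<n. ?E i (p i) L))"
        unfolding * of_real_sum of_real_mult of_real_prod by (intro sum.cong refl) simp
      finally show ?case by (simp add: x_def)
    qed
  qed
qed

section \<open>Inner product spaces\<close>

text \<open>The pre-Hilbert axioms; every limit taken later is exhibited explicitly. Further laws,
  such as associativity of scaling, follow from nondegeneracy by testing against all vectors, as in
  \<open>ip_eqI\<close>.\<close>

locale inner_space = abelian_group H for H :: "'a hilb" (structure) +
  assumes smult_closed [simp, intro]: "x \<in> carrier H \<Longrightarrow> c \<odot> x \<in> carrier H"
    and smult_add_left: "x \<in> carrier H \<Longrightarrow> (c + d) \<odot> x = c \<odot> x \<oplus> d \<odot> x"
    and smult_one: "x \<in> carrier H \<Longrightarrow> 1 \<odot> x = x"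
    and ip_add_left: "\<lbrakk>x \<in> carrier H; y \<in> carrier H; z \<in> carrier H\<rbrakk> \<Longrightarrow> ip H (x \<oplus> y) z = ip H x z + ip H y z"
    and ip_smult_left: "\<lbrakk>x \<in> carrier H; z \<in> carrier H\<rbrakk> \<Longrightarrow> ip H (c \<odot> x) z = c * ip H x z"
    and ip_commute: "\<lbrakk>x \<in> carrier H; y \<in> carrier H\<rbrakk> \<Longrightarrow> ip H y x = cnj (ip H x y)"
    and ip_nonneg: "x \<in> carrier H \<Longrightarrow> 0 \<le> Re (ip H x x)"
    and ip_eq_0: "\<lbrakk>x \<in> carrier H; ip H x x = 0\<rbrakk> \<Longrightarrow> x = \<zero>"
begin

lemma ip_add_right: "\<lbrakk>x \<in> carrier H; y \<in> carrier H; z \<in> carrier H\<rbrakk> \<Longrightarrow> ip H z (x \<oplus> y) = ip H z x + ip H z y"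
  by (metis add.m_closed complex_cnj_add ip_add_left ip_commute)

lemma ip_smult_right: "\<lbrakk>x \<in> carrier H; z \<in> carrier H\<rbrakk> \<Longrightarrow> ip H z (c \<odot> x) = cnj c * ip H z x"
  by (metis complex_cnj_mult ip_commute ip_smult_left smult_closed)

lemma smult_zero_left: "x \<in> carrier H \<Longrightarrow> 0 \<odot> x = \<zero>"
  by (rule ip_eq_0) (simp_all add: ip_smult_left)

lemma hdiff_closed [simp, intro]: "\<lbrakk>x \<in> carrier H; y \<in> carrier H\<rbrakk> \<Longrightarrow> hdiff H x y \<in> carrier H"
  by (simp add: hdiff_def)

lemma ip_hdiff_left:
  "\<lbrakk>x \<in> carrier H; y \<in> carrier H; z \<in> carrier H\<rbrakk> \<Longrightarrow> ip H (hdiff H x y) z = ip H x z - ip H y z"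
  by (simp add: hdiff_def ip_add_left ip_smult_left)

lemma ip_hdiff_right:
  "\<lbrakk>x \<in> carrier H; y \<in> carrier H; z \<in> carrier H\<rbrakk> \<Longrightarrow> ip H z (hdiff H x y) = ip H z x - ip H z y"
  by (simp add: hdiff_def ip_add_right ip_smult_right)

lemmas ip_simps = ip_add_left ip_add_right ip_smult_left ip_smult_right ip_hdiff_left ip_hdiff_right

lemma hdiff_eq_zeroD:
  assumes "x \<in> carrier H" "y \<in> carrier H" "hdiff H x y = \<zero>"
  shows "x = y"
proof -
  have "(-1) \<odot> y \<oplus> y = \<zero>"
    using smult_add_left [of y "-1" 1] assms by (simp add: smult_one smult_zero_left)
  then have "x = x \<oplus> ((-1) \<odot> y \<oplus> y)" using assms(1) by simp
  also have "\<dots> = hdiff H x y \<oplus> y" using assms(1,2) by (simp add: hdiff_def a_assoc)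
  finally show ?thesis using assms by simp
qed

lemma ip_self: "x \<in> carrier H \<Longrightarrow> ip H x x = complex_of_real (Re (ip H x x))"
  using ip_commute [of x x] by (simp add: complex_eq_iff)

lemma eqI_hdiff:
  assumes "x \<in> carrier H" "y \<in> carrier H" "Re (ip H (hdiff H x y) (hdiff H x y)) = 0"
  shows "x = y"
proof (rule hdiff_eq_zeroD [OF assms(1,2)], rule ip_eq_0)
  let ?z = "hdiff H x y"
  show "ip H ?z ?z = 0" using ip_self [of ?z] assms by simp
qed (use assms in simp)

lemma ip_eqI:
  assumes "x \<in> carrier H" "y \<in> carrier H" "\<And>z. z \<in> carrier H \<Longrightarrow> ip H x z = ip H y z"
  shows "x = y"
  by (rule eqI_hdiff) (use assms in \<open>simp_all add: ip_hdiff_left\<close>)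

lemma ip_zero_left [simp]: "x \<in> carrier H \<Longrightarrow> ip H \<zero> x = 0"
  using ip_smult_left [of "\<zero>" x 0] by (simp add: smult_zero_left)

lemma smult_smult: "x \<in> carrier H \<Longrightarrow> c \<odot> (d \<odot> x) = (c * d) \<odot> x"
  by (rule ip_eqI) (simp_all add: ip_simps)

lemma hadjoint_eqI:
  assumes "z \<in> carrier H" "\<And>x. x \<in> carrier H \<Longrightarrow> A x \<in> carrier H"
    and "\<And>x. x \<in> carrier H \<Longrightarrow> ip H (A x) y = ip H x z"
  shows "hadjoint H A y = z"
  unfolding hadjoint_def
proof (rule the_equality)
  fix z' assume z': "z' \<in> carrier H \<and> (\<forall>x\<in>carrier H. ip H (A x) y = ip H x z')"
  show "z' = z"
  proof (rule ip_eqI)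
    fix x assume "x \<in> carrier H"
    then show "ip H z' x = ip H z x"
      using z' assms by (metis ip_commute)
  qed (use z' assms in auto)
qed (use assms in auto)

lemma hnorm_power2: "x \<in> carrier H \<Longrightarrow> (hnorm H x)\<^sup>2 = Re (ip H x x)"
  by (simp add: hnorm_def ip_nonneg)

text \<open>The parallelogram law for f i - x and f i - y, whose difference is y - x; the norm of
  their sum is nonnegative and is dropped.\<close>

lemma hlim_unique:
  assumes "F \<noteq> bot" "\<And>i. f i \<in> carrier H" "x \<in> carrier H" "y \<in> carrier H"
    and "hlim H f x F" "hlim H f y F"
  shows "x = y"
proof (rule eqI_hdiff [OF assms(3,4)])
  have le: "Re (ip H (hdiff H x y) (hdiff H x y)) \<le> 2 * (hnorm H (hdiff H (f i) x))\<^sup>2 + 2 * (hnorm H (hdiff H (f i) y))\<^sup>2" for i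
  proof -
    let ?s = "hdiff H (f i) x \<oplus> hdiff H (f i) y"
    have "Re (ip H (hdiff H x y) (hdiff H x y)) + Re (ip H ?s ?s) = 2 * (hnorm H (hdiff H (f i) x))\<^sup>2 + 2 * (hnorm H (hdiff H (f i) y))\<^sup>2"
      using assms(2-4) by (simp add: hnorm_power2 ip_simps)
    then show ?thesis using ip_nonneg [of ?s] assms(2-4) by simp
  qed
  have "((\<lambda>i. 2 * (hnorm H (hdiff H (f i) x))\<^sup>2 + 2 * (hnorm H (hdiff H (f i) y))\<^sup>2) \<longlongrightarrow> 2 * 0\<^sup>2 + 2 * 0\<^sup>2) F"
    using assms(5,6) unfolding hlim_def by (intro tendsto_intros)
  then have "Re (ip H (hdiff H x y) (hdiff H x y)) \<le> 2 * 0\<^sup>2 + 2 * 0\<^sup>2"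
    using le by (intro tendsto_lowerbound [OF _ _ assms(1)]) auto
  then show "Re (ip H (hdiff H x y) (hdiff H x y)) = 0"
    using ip_nonneg [of "hdiff H x y"] assms by simp
qed

subsection \<open>Gram--Schmidt orthogonalization\<close>

inductive_set lspan :: "'a set \<Rightarrow> 'a set" for E where
  base: "x \<in> E \<Longrightarrow> x \<in> lspan E"
| zero: "\<zero> \<in> lspan E"
| add: "x \<in> lspan E \<Longrightarrow> y \<in> lspan E \<Longrightarrow> x \<oplus> y \<in> lspan E"
| smult: "x \<in> lspan E \<Longrightarrow> c \<odot> x \<in> lspan E"

lemma lspan_closed:
  assumes "E \<subseteq> carrier H" "x \<in> lspan E"
  shows "x \<in> carrier H"
  using assms(2) by induction (use assms(1) in auto)

lemma lspan_mono:
  assumes "E \<subseteq> E'" "x \<in> lspan E"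
  shows "x \<in> lspan E'"
  using assms(2) by induction (use assms(1) in \<open>auto intro: lspan.intros\<close>)

text \<open>The projection is built by adding one vector at a time. The last clause is there for the
  induction: it makes the new vector orthogonal to the projection found so far. The two identities
  for \<open>ip H p p\<close> and \<open>ip H x p\<close> are what Bessel's inequality uses.\<close>

lemma ex_orthogonal_projection:
  assumes "finite E" "orthonormal H E" "x \<in> carrier H"
  shows "\<exists>p\<in>lspan E. (\<forall>e\<in>E. ip H p e = ip H x e) \<and>
    ip H p p = complex_of_real (\<Sum>e\<in>E. (cmod (ip H x e))\<^sup>2) \<and> ip H x p = complex_of_real (\<Sum>e\<in>E. (cmod (ip H x e))\<^sup>2) \<and>
    (\<forall>z\<in>carrier H. (\<forall>e\<in>E. ip H z e = 0) \<longrightarrow> ip H p z = 0)"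
  using assms(1,2)
proof (induction E rule: finite_induct)
  case empty
  then show ?case using assms(3) ip_smult_right [of "\<zero>" x 0]
    by (intro bexI [of _ "\<zero>"]) (auto intro: lspan.intros simp: smult_zero_left)
next
  case (insert e E)
  have on: "orthonormal H E" using insert.prems by (auto simp: orthonormal_def)
  obtain p where p: "p \<in> lspan E" "\<And>e. e \<in> E \<Longrightarrow> ip H p e = ip H x e"
    "ip H p p = complex_of_real (\<Sum>e\<in>E. (cmod (ip H x e))\<^sup>2)" "ip H x p = complex_of_real (\<Sum>e\<in>E. (cmod (ip H x e))\<^sup>2)"
    "\<And>z. z \<in> carrier H \<Longrightarrow> (\<And>e. e \<in> E \<Longrightarrow> ip H z e = 0) \<Longrightarrow> ip H p z = 0"
    using insert.IH [OF on] by blast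
  have e: "e \<in> carrier H" "ip H e e = 1" and E: "E \<subseteq> carrier H"
    and orth: "\<And>e'. e' \<in> E \<Longrightarrow> ip H e e' = 0"
    using insert by (auto simp: orthonormal_def)
  have pc: "p \<in> carrier H" using lspan_closed [OF E p(1)] .
  have pe: "ip H p e = 0" using p(5) [OF e(1) orth] .
  have ep: "ip H e p = 0" using ip_commute [OF pc e(1)] pe by simp
  have xe: "cnj (ip H x e) * ip H x e = complex_of_real ((cmod (ip H x e))\<^sup>2)"
    by (simp only: complex_norm_square mult.commute)
  let ?p = "p \<oplus> ip H x e \<odot> e"
  show ?case
  proof (intro bexI [of _ ?p] conjI ballI impI)
    show "?p \<in> lspan (insert e E)"
      using lspan_mono [OF _ p(1), of "insert e E"] by (auto intro: lspan.intros)
    show "ip H ?p e' = ip H x e'" if "e' \<in> insert e E" for e'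
      using that insert.hyps(2) e E pc pe p(2) orth by (auto simp: ip_simps subset_iff)
    show "ip H ?p ?p = complex_of_real (\<Sum>e\<in>insert e E. (cmod (ip H x e))\<^sup>2)"
      using insert.hyps e pc pe ep p(3) by (simp add: ip_simps xe del: of_real_power)
    show "ip H x ?p = complex_of_real (\<Sum>e\<in>insert e E. (cmod (ip H x e))\<^sup>2)"
      using insert.hyps e pc assms(3) p(4) by (simp add: ip_simps xe del: of_real_power)
    show "ip H ?p z = 0" if "z \<in> carrier H" "\<forall>e\<in>insert e E. ip H z e = 0" for z
    proof -
      have "ip H e z = 0" using that ip_commute [of z e] e by simp
      then show ?thesis using that p(5) [of z] e pc by (simp add: ip_simps)
    qed
  qed
qed

lemma bessel_inequality:
  assumes "finite E" "orthonormal H E" "x \<in> carrier H"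
  shows "(\<Sum>e\<in>E. (cmod (ip H x e))\<^sup>2) \<le> Re (ip H x x)"
proof -
  obtain p where p: "p \<in> lspan E" 
    "ip H p p = complex_of_real (\<Sum>e\<in>E. (cmod (ip H x e))\<^sup>2)" "ip H x p = complex_of_real (\<Sum>e\<in>E. (cmod (ip H x e))\<^sup>2)"
    using ex_orthogonal_projection [OF assms] by blast
  have pc: "p \<in> carrier H"
    using lspan_closed [OF _ p(1)] assms(2) by (simp add: orthonormal_def)
  have "ip H p x = complex_of_real (\<Sum>e\<in>E. (cmod (ip H x e))\<^sup>2)"
    using ip_commute [OF assms(3) pc] p(3) by simp
  then have "Re (ip H (hdiff H x p) (hdiff H x p)) = Re (ip H x x) - (\<Sum>e\<in>E. (cmod (ip H x e))\<^sup>2)"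
    using p(2,3) pc assms(3) by (simp add: ip_simps)
  then show ?thesis using ip_nonneg [of "hdiff H x p"] pc assms(3) by simp
qed

text \<open>Needed for definiteness of the Hilbert--Schmidt norm, where the entries of a given tuple
  must be expanded in one finite orthonormal system. A vector that equals its projection adds
  nothing; otherwise the normalized residue is adjoined.\<close>

lemma ex_orthonormal_lspan:
  assumes "finite Y" "Y \<subseteq> carrier H"
  shows "\<exists>E. finite E \<and> orthonormal H E \<and> Y \<subseteq> lspan E"
  using assms
proof (induction Y rule: finite_induct)
  case empty
  then show ?case by (intro exI [of _ "{}"]) (simp add: orthonormal_def)
next
  case (insert y Y)
  then obtain E where E: "finite E" "orthonormal H E" "Y \<subseteq> lspan E" by auto
  have y: "y \<in> carrier H" using insert by simp
  have EH: "E \<subseteq> carrier H" using E by (simp add: orthonormal_def)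
  obtain p where p: "p \<in> lspan E" "\<And>e. e \<in> E \<Longrightarrow> ip H p e = ip H y e"
    using ex_orthogonal_projection [OF E(1,2) y] by blast
  have pc: "p \<in> carrier H" using lspan_closed [OF EH p(1)] .
  define z where "z = hdiff H y p"
  have z: "z \<in> carrier H" using y pc by (simp add: z_def)
  show ?case
  proof (cases "Re (ip H z z) = 0")
    case True
    then have "y = p" using eqI_hdiff [OF y pc] by (simp add: z_def)
    then show ?thesis using E p by blast
  next
    case False
    define s where "s = sqrt (Re (ip H z z))"
    have s: "s > 0" "s\<^sup>2 = Re (ip H z z)" using False ip_nonneg [OF z] by (auto simp: s_def)
    define e where "e = complex_of_real (1 / s) \<odot> z"
    have e: "e \<in> carrier H" using z by (simp add: e_def)
    have "ip H e e = complex_of_real ((1 / s) * (1 / s) * s\<^sup>2)"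
      using z ip_self [OF z] s by (simp add: e_def ip_simps)
    then have ee: "ip H e e = 1" using s by (simp add: power2_eq_square)
    have orth: "ip H e e' = 0" if "e' \<in> E" for e'
      using that z y pc EH p(2) by (auto simp: e_def z_def ip_simps subset_iff)
    have orth': "ip H e' e = 0" if "e' \<in> E" for e'
      using that orth ip_commute [of e e'] e EH by auto
    have on: "orthonormal H (insert e E)"
      using E(2) e ee orth orth' by (auto simp: orthonormal_def)
    have "y = p \<oplus> complex_of_real s \<odot> e"
      by (rule ip_eqI) (use s y pc z in \<open>simp_all add: e_def z_def ip_simps\<close>)
    then have "y \<in> lspan (insert e E)"
      using lspan_mono [OF _ p(1), of "insert e E"] by (auto intro: lspan.intros)
    moreover have "Y \<subseteq> lspan (insert e E)" using E(3) lspan_mono [of E "insert e E"] by auto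
    ultimately show ?thesis using E(1) on by blast
  qed
qed

end

section \<open>Hilbert--Schmidt norms and the Fock space\<close>

context inner_space begin

lemma hs_sums_nonempty: "hs_sums H n F \<noteq> {}"
proof -
  have "finite {} \<and> orthonormal H {}" by (simp add: orthonormal_def)
  then show ?thesis unfolding hs_sums_def by blast
qed

lemma hs_norm2_le:
  assumes "\<And>E. finite E \<Longrightarrow> orthonormal H E \<Longrightarrow> (\<Sum>b\<in>tuples E n. (cmod (F b))\<^sup>2) \<le> K"
  shows "bdd_above (hs_sums H n F)" "hs_norm2 H n F \<le> K"
proof -
  show "bdd_above (hs_sums H n F)"
    by (rule bdd_aboveI [of _ K]) (use assms in \<open>auto simp: hs_sums_def\<close>)
  show "hs_norm2 H n F \<le> K"
    unfolding hs_norm2_def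
    by (rule cSup_least [OF hs_sums_nonempty]) (use assms in \<open>auto simp: hs_sums_def\<close>)
qed

lemma hs_norm2_ge:
  assumes "bdd_above (hs_sums H n F)" "finite E" "orthonormal H E"
  shows "(\<Sum>b\<in>tuples E n. (cmod (F b))\<^sup>2) \<le> hs_norm2 H n F"
  unfolding hs_norm2_def
  by (rule cSup_upper [OF _ assms(1)]) (use assms in \<open>auto simp: hs_sums_def\<close>)

lemma hs_norm2_nonneg:
  assumes "bdd_above (hs_sums H n F)"
  shows "0 \<le> hs_norm2 H n F"
proof -
  have "0 \<le> (\<Sum>b\<in>tuples {} n. (cmod (F b))\<^sup>2)" by (rule sum_nonneg) simp
  also have "\<dots> \<le> hs_norm2 H n F"
    by (rule hs_norm2_ge [OF assms]) (simp_all add: orthonormal_def)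
  finally show ?thesis .
qed

text \<open>The upper bound holds for every scalar; applied to \<open>inverse c\<close> and the
  functional scaled by \<open>c\<close>, it gives the reverse inequality.\<close>

lemma hs_norm2_smult:
  assumes "bdd_above (hs_sums H n F)"
  shows "bdd_above (hs_sums H n (\<lambda>xs. c * F xs))" "hs_norm2 H n (\<lambda>xs. c * F xs) = (cmod c)\<^sup>2 * hs_norm2 H n F"
proof -
  have le: "(\<Sum>b\<in>tuples E n. (cmod (c * F b))\<^sup>2) \<le> (cmod c)\<^sup>2 * hs_norm2 H n F"
    if "bdd_above (hs_sums H n F)" "finite E" "orthonormal H E" for c F E
  proof -
    have "(\<Sum>b\<in>tuples E n. (cmod (c * F b))\<^sup>2) = (cmod c)\<^sup>2 * (\<Sum>b\<in>tuples E n. (cmod (F b))\<^sup>2)"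
      by (simp add: norm_mult power_mult_distrib sum_distrib_left)
    also have "\<dots> \<le> (cmod c)\<^sup>2 * hs_norm2 H n F"
      by (intro mult_left_mono hs_norm2_ge that) auto
    finally show ?thesis .
  qed
  have upper: "bdd_above (hs_sums H n (\<lambda>xs. c * F xs))" "hs_norm2 H n (\<lambda>xs. c * F xs) \<le> (cmod c)\<^sup>2 * hs_norm2 H n F"
    if "bdd_above (hs_sums H n F)" for c F
    by (rule hs_norm2_le; erule (1) le [OF that])+
  show bdd: "bdd_above (hs_sums H n (\<lambda>xs. c * F xs))" by (rule upper) fact
  show "hs_norm2 H n (\<lambda>xs. c * F xs) = (cmod c)\<^sup>2 * hs_norm2 H n F"
  proof (rule antisym)
    show "hs_norm2 H n (\<lambda>xs. c * F xs) \<le> (cmod c)\<^sup>2 * hs_norm2 H n F" by (rule upper) fact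
    show "(cmod c)\<^sup>2 * hs_norm2 H n F \<le> hs_norm2 H n (\<lambda>xs. c * F xs)"
    proof (cases "c = 0")
      case True
      then show ?thesis using hs_norm2_nonneg [OF bdd] by simp
    next
      case False
      have "hs_norm2 H n (\<lambda>xs. inverse c * (c * F xs)) \<le> (cmod (inverse c))\<^sup>2 * hs_norm2 H n (\<lambda>xs. c * F xs)"
        by (rule upper) (fact bdd)
      moreover have "(\<lambda>xs. inverse c * (c * F xs)) = F" using False by (simp add: fun_eq_iff)
      ultimately have "hs_norm2 H n F \<le> (cmod (inverse c))\<^sup>2 * hs_norm2 H n (\<lambda>xs. c * F xs)" by simp
      then have "(cmod c)\<^sup>2 * hs_norm2 H n F \<le> (cmod c)\<^sup>2 * ((cmod (inverse c))\<^sup>2 * hs_norm2 H n (\<lambda>xs. c * F xs))"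
        by (intro mult_left_mono) auto
      also have "\<dots> = hs_norm2 H n (\<lambda>xs. c * F xs)"
        using False by (simp add: norm_inverse power_inverse)
      finally show ?thesis .
    qed
  qed
qed

text \<open>Cauchy--Schwarz over \<open>W\<close> in each value of the functional. The constant is
  crude, but the bound tends to 0 with the coefficients \<open>c v\<close>, which is what continuity
  requires.\<close>

lemma hs_norm2_sum_le:
  assumes "finite W" and G: "\<And>v. v \<in> W \<Longrightarrow> bdd_above (hs_sums H n (G v))" "\<And>v. v \<in> W \<Longrightarrow> hs_norm2 H n (G v) \<le> K"
  shows "bdd_above (hs_sums H n (\<lambda>xs. \<Sum>v\<in>W. c v * G v xs))"
    "hs_norm2 H n (\<lambda>xs. \<Sum>v\<in>W. c v * G v xs) \<le> real (card W) * (\<Sum>v\<in>W. (cmod (c v))\<^sup>2) * K"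
proof -
  have le: "(\<Sum>b\<in>tuples E n. (cmod (\<Sum>v\<in>W. c v * G v b))\<^sup>2) \<le> real (card W) * (\<Sum>v\<in>W. (cmod (c v))\<^sup>2) * K"
    if "finite E" "orthonormal H E" for E
  proof -
    have "(cmod (\<Sum>v\<in>W. c v * G v b))\<^sup>2 \<le> real (card W) * (\<Sum>v\<in>W. (cmod (c v))\<^sup>2 * (cmod (G v b))\<^sup>2)" for b
    proof -
      have "(cmod (\<Sum>v\<in>W. c v * G v b))\<^sup>2 \<le> (\<Sum>v\<in>W. cmod (c v * G v b))\<^sup>2"
        by (intro power_mono norm_sum) auto
      also have "\<dots> = (\<Sum>v\<in>W. 1 * cmod (c v * G v b))\<^sup>2" by simp
      also have "\<dots> \<le> (\<Sum>v\<in>W. 1\<^sup>2) * (\<Sum>v\<in>W. (cmod (c v * G v b))\<^sup>2)"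
        by (rule Cauchy_Schwarz_ineq_sum)
      finally show ?thesis by (simp add: norm_mult power_mult_distrib)
    qed
    then have "(\<Sum>b\<in>tuples E n. (cmod (\<Sum>v\<in>W. c v * G v b))\<^sup>2)
        \<le> (\<Sum>b\<in>tuples E n. real (card W) * (\<Sum>v\<in>W. (cmod (c v))\<^sup>2 * (cmod (G v b))\<^sup>2))"
      by (intro sum_mono)
    also have "\<dots> = real (card W) * (\<Sum>v\<in>W. (cmod (c v))\<^sup>2 * (\<Sum>b\<in>tuples E n. (cmod (G v b))\<^sup>2))"
      unfolding sum_distrib_left by (rule sum.swap)
    also have "\<dots> \<le> real (card W) * (\<Sum>v\<in>W. (cmod (c v))\<^sup>2 * K)"
      using that G order_trans [OF hs_norm2_ge]
      by (intro mult_left_mono sum_mono) auto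
    finally show ?thesis by (simp add: sum_distrib_right mult.assoc)
  qed
  show "bdd_above (hs_sums H n (\<lambda>xs. \<Sum>v\<in>W. c v * G v xs))"
    "hs_norm2 H n (\<lambda>xs. \<Sum>v\<in>W. c v * G v xs) \<le> real (card W) * (\<Sum>v\<in>W. (cmod (c v))\<^sup>2) * K"
    by (rule hs_norm2_le; erule (1) le)+
qed

lemma hs_norm2_add_le:
  assumes "bdd_above (hs_sums H n F)" "bdd_above (hs_sums H n G)"
  shows "bdd_above (hs_sums H n (\<lambda>xs. F xs + G xs))"
    "hs_norm2 H n (\<lambda>xs. F xs + G xs) \<le> 2 * hs_norm2 H n F + 2 * hs_norm2 H n G"
proof -
  have sq: "(cmod (a + b))\<^sup>2 \<le> 2 * (cmod a)\<^sup>2 + 2 * (cmod b)\<^sup>2" for a b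
    using sum_squares_bound [of "cmod a" "cmod b"]
      power_mono [OF norm_triangle_ineq [of a b] norm_ge_zero, of 2]
    by (simp add: power2_sum)
  have le: "(\<Sum>x\<in>tuples E n. (cmod (F x + G x))\<^sup>2) \<le> 2 * hs_norm2 H n F + 2 * hs_norm2 H n G"
    if "finite E" "orthonormal H E" for E
  proof -
    have "(\<Sum>x\<in>tuples E n. (cmod (F x + G x))\<^sup>2) \<le> (\<Sum>x\<in>tuples E n. 2 * (cmod (F x))\<^sup>2 + 2 * (cmod (G x))\<^sup>2)"
      by (intro sum_mono sq)
    also have "\<dots> = 2 * (\<Sum>x\<in>tuples E n. (cmod (F x))\<^sup>2) + 2 * (\<Sum>x\<in>tuples E n. (cmod (G x))\<^sup>2)"
      by (simp add: sum.distrib sum_distrib_left)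
    also have "\<dots> \<le> 2 * hs_norm2 H n F + 2 * hs_norm2 H n G"
      using that assms by (intro add_mono mult_left_mono hs_norm2_ge) auto
    finally show ?thesis .
  qed
  show "bdd_above (hs_sums H n (\<lambda>xs. F xs + G xs))"
    "hs_norm2 H n (\<lambda>xs. F xs + G xs) \<le> 2 * hs_norm2 H n F + 2 * hs_norm2 H n G"
    by (rule hs_norm2_le; erule (1) le)+
qed

lemma hs_norm2_diff_le:
  assumes "bdd_above (hs_sums H n F)" "bdd_above (hs_sums H n G)"
  shows "bdd_above (hs_sums H n (\<lambda>xs. F xs - G xs))"
    "hs_norm2 H n (\<lambda>xs. F xs - G xs) \<le> 2 * hs_norm2 H n F + 2 * hs_norm2 H n G"
  using hs_norm2_add_le [OF assms(1) hs_norm2_smult(1) [OF assms(2), of "-1"]]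
    hs_norm2_smult(2) [OF assms(2), of "-1"] by simp_all

lemma conj_multilinearI:
  assumes "\<And>xs. xs \<notin> tuples (carrier H) n \<Longrightarrow> F xs = 0"
    and "\<And>xs i x y. \<lbrakk>xs \<in> tuples (carrier H) n; i < n; x \<in> carrier H; y \<in> carrier H\<rbrakk> \<Longrightarrow>
      F (xs[i := x \<oplus> y]) = F (xs[i := x]) + F (xs[i := y])"
    and "\<And>xs i c x. \<lbrakk>xs \<in> tuples (carrier H) n; i < n; x \<in> carrier H\<rbrakk> \<Longrightarrow>
      F (xs[i := c \<odot> x]) = cnj c * F (xs[i := x])"
  shows "conj_multilinear H n F"
  unfolding conj_multilinear_def by (intro conjI allI ballI impI assms)

lemma conj_multilinearD:
  assumes "conj_multilinear H n F"
  shows "xs \<notin> tuples (carrier H) n \<Longrightarrow> F xs = 0"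
    and "\<lbrakk>xs \<in> tuples (carrier H) n; i < n; x \<in> carrier H; y \<in> carrier H\<rbrakk> \<Longrightarrow>
      F (xs[i := x \<oplus> y]) = F (xs[i := x]) + F (xs[i := y])"
    and "\<lbrakk>xs \<in> tuples (carrier H) n; i < n; x \<in> carrier H\<rbrakk> \<Longrightarrow>
      F (xs[i := c \<odot> x]) = cnj c * F (xs[i := x])"
  using assms unfolding conj_multilinear_def by blast+

text \<open>The entries are released from \<open>E\<close> into its span one position at a time; in
  a single position, additivity and conjugate homogeneity lead back to elements of
  \<open>E\<close>.\<close>

lemma conj_multilinear_vanish:
  assumes F: "conj_multilinear H n F" and E: "E \<subseteq> carrier H"
    and F0: "\<And>xs. xs \<in> tuples E n \<Longrightarrow> F xs = 0"
    and xs: "xs \<in> tuples (lspan E) n"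
  shows "F xs = 0"
proof -
  have lsc: "lspan E \<subseteq> carrier H" using lspan_closed [OF E] by auto
  \<comment> \<open>\<open>m\<close> counts the leading positions whose entries may be arbitrary
    elements of the span.\<close>
  have "F xs = 0" if "m \<le> n" "length xs = n" "\<And>i. i < m \<Longrightarrow> xs ! i \<in> lspan E" "\<And>i. m \<le> i \<Longrightarrow> i < n \<Longrightarrow> xs ! i \<in> E" for m xs
    using that
  proof (induction m arbitrary: xs)
    case 0
    then have "xs \<in> tuples E n" by (auto simp: tuples_def in_set_conv_nth)
    then show ?case by (rule F0)
  next
    case (Suc m)
    have m: "m < n" using Suc.prems by simp
    have xsc: "xs \<in> tuples (carrier H) n"
      using Suc.prems lsc E by (auto simp: tuples_def in_set_conv_nth subset_iff) (metis not_less_eq_eq not_le)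
    have "F (xs[m := a]) = 0" if "a \<in> lspan E" for a
      using that
    proof induction
      case (base x)
      show ?case
      proof (rule Suc.IH)
        show "xs[m := x] ! i \<in> lspan E" if "i < m" for i using that Suc.prems by simp
        show "xs[m := x] ! i \<in> E" if "m \<le> i" "i < n" for i
          using that Suc.prems base by (cases "i = m") auto
      qed (use m Suc.prems in auto)
    next
      case zero
      have "F (xs[m := 0 \<odot> \<zero>]) = cnj 0 * F (xs[m := \<zero>])"
        using F m xsc unfolding conj_multilinear_def by blast
      then show ?case by (simp add: smult_zero_left)
    next
      case (add x y)
      have "F (xs[m := x \<oplus> y]) = F (xs[m := x]) + F (xs[m := y])"
        using F m xsc add.hyps lsc unfolding conj_multilinear_def by blast
      then show ?case using add.IH by simp
    next
      case (smult x c)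
      have "F (xs[m := c \<odot> x]) = cnj c * F (xs[m := x])"
        using F m xsc smult.hyps lsc unfolding conj_multilinear_def by blast
      then show ?case using smult.IH by simp
    qed
    from this [of "xs ! m"] show ?case using Suc.prems by simp
  qed
  note * = this
  show ?thesis
    by (rule * [of n]) (use xs in \<open>auto simp: tuples_def subset_iff\<close>)
qed

text \<open>Any tuple lies in the span of some finite orthonormal system, and on tuples from that
  system \<open>F\<close> vanishes because its sum of squares is at most the supremum 0.\<close>

lemma hs_norm2_eq_0:
  assumes F: "conj_multilinear H n F" "bdd_above (hs_sums H n F)" "hs_norm2 H n F = 0"
  shows "F xs = 0"
proof (cases "xs \<in> tuples (carrier H) n")
  case False
  then show ?thesis using F by (auto simp: conj_multilinear_def)
next
  case True
  obtain E where E: "finite E" "orthonormal H E" "set xs \<subseteq> lspan E"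
    using ex_orthonormal_lspan [of "set xs"] True by (auto simp: tuples_def)
  have fin: "finite (tuples E n)"
    unfolding tuples_def using finite_lists_length_eq [OF E(1), of n] by simp
  have "(\<Sum>b\<in>tuples E n. (cmod (F b))\<^sup>2) \<le> 0"
    using hs_norm2_ge [OF F(2) E(1,2)] F(3) by simp
  then have "(\<Sum>b\<in>tuples E n. (cmod (F b))\<^sup>2) = 0"
    by (intro antisym sum_nonneg) auto
  then have F0: "F b = 0" if "b \<in> tuples E n" for b
    using that fin by (simp add: sum_nonneg_eq_0_iff)
  show ?thesis
  proof (rule conj_multilinear_vanish [OF F(1)])
    show "E \<subseteq> carrier H" using E(2) by (simp add: orthonormal_def)
    show "F b = 0" if "b \<in> tuples E n" for b using that by (rule F0)
    show "xs \<in> tuples (lspan E) n" using E(3) True by (simp add: tuples_def)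
  qed
qed

lemma sym_power_simps [simp]:
  "\<zero>\<^bsub>sym_power H n\<^esub> = (\<lambda>xs. 0)"
  "F \<oplus>\<^bsub>sym_power H n\<^esub> G = (\<lambda>xs. F xs + G xs)"
  "c \<odot>\<^bsub>sym_power H n\<^esub> F = (\<lambda>xs. c * F xs)"
  by (simp_all add: sym_power_def)

lemma sym_power_carrier:
  "F \<in> carrier (sym_power H n) \<longleftrightarrow> conj_multilinear H n F \<and> bdd_above (hs_sums H n F) \<and>
    (\<forall>xs ys. mset xs = mset ys \<longrightarrow> F xs = F ys)"
  by (simp add: sym_power_def)

lemma sym_powerD:
  assumes "F \<in> carrier (sym_power H n)"
  shows "conj_multilinear H n F" "bdd_above (hs_sums H n F)" "mset xs = mset ys \<Longrightarrow> F xs = F ys"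
proof -
  note * = assms [unfolded sym_power_carrier]
  show "conj_multilinear H n F" by (rule * [THEN conjunct1])
  show "bdd_above (hs_sums H n F)" by (rule * [THEN conjunct2, THEN conjunct1])
  show "F xs = F ys" if "mset xs = mset ys"
    using * [THEN conjunct2, THEN conjunct2] that by blast
qed

lemma sym_power_add_closed:
  assumes "F \<in> carrier (sym_power H n)" "G \<in> carrier (sym_power H n)"
  shows "(\<lambda>xs. F xs + G xs) \<in> carrier (sym_power H n)"
proof -
  note F = sym_powerD [OF assms(1)] and G = sym_powerD [OF assms(2)]
  have "conj_multilinear H n (\<lambda>xs. F xs + G xs)"
    by (rule conj_multilinearI)
      (simp_all only: conj_multilinearD [OF F(1)] conj_multilinearD [OF G(1)] distrib_left add_ac add_0 simp_thms)
  then show ?thesis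
    unfolding sym_power_carrier by (intro conjI allI impI arg_cong2 [where f = "(+)"] hs_norm2_add_le F G)
qed

lemma sym_power_smult_closed:
  assumes "F \<in> carrier (sym_power H n)"
  shows "(\<lambda>xs. c * F xs) \<in> carrier (sym_power H n)"
proof -
  note F = sym_powerD [OF assms]
  have "conj_multilinear H n (\<lambda>xs. c * F xs)"
    by (rule conj_multilinearI) (simp_all only: conj_multilinearD [OF F(1)] distrib_left mult_ac mult_zero_right mult_zero_left simp_thms)
  then show ?thesis
    unfolding sym_power_carrier using hs_norm2_smult(1) [OF F(2)] by (metis F(3))
qed

lemma sym_power_diff_closed:
  assumes "F \<in> carrier (sym_power H n)" "G \<in> carrier (sym_power H n)"
  shows "(\<lambda>xs. F xs - G xs) \<in> carrier (sym_power H n)"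
  using sym_power_add_closed [OF assms(1) sym_power_smult_closed [OF assms(2), of "-1"]] by simp

text \<open>For general arguments, sesquilinearity of the polarized form would require a
  parallelogram law for suprema. On multiples of one functional all four norms are explicit, and
  this case covers the norm of the Fock space and the expectation.\<close>

lemma ip_sym_power_smult:
  assumes "bdd_above (hs_sums H n F)"
  shows "ip (sym_power H n) (\<lambda>xs. c * F xs) (\<lambda>xs. d * F xs) = c * cnj d * complex_of_real (hs_norm2 H n F)"
proof -
  have hs: "complex_of_real (hs_norm2 H n (\<lambda>xs. c * F xs + w * (d * F xs)))
     = (c + w * d) * cnj (c + w * d) * complex_of_real (hs_norm2 H n F)" for w
  proof -
    have "(\<lambda>xs. c * F xs + w * (d * F xs)) = (\<lambda>xs. (c + w * d) * F xs)"
      by (simp add: distrib_right mult.assoc)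
    then show ?thesis
      by (simp only: hs_norm2_smult(2) [OF assms] of_real_mult complex_norm_square)
  qed
  have "(\<Sum>k<4. \<i> ^ k * ((c + \<i> ^ k * d) * cnj (c + \<i> ^ k * d) * z)) = 4 * (c * cnj d * z)" for z
    by (simp add: eval_nat_numeral algebra_simps)
  then show ?thesis by (simp add: sym_power_def hs)
qed

lemma hnorm_sym_power:
  assumes "F \<in> carrier (sym_power H n)"
  shows "(hnorm (sym_power H n) F)\<^sup>2 = hs_norm2 H n F" "ip (sym_power H n) F F = complex_of_real (hs_norm2 H n F)"
proof -
  note bdd = sym_powerD(2) [OF assms]
  show "ip (sym_power H n) F F = complex_of_real (hs_norm2 H n F)"
    using ip_sym_power_smult [OF bdd, of 1 1] by simp
  then show "(hnorm (sym_power H n) F)\<^sup>2 = hs_norm2 H n F"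
    using hs_norm2_nonneg [OF bdd] by (simp add: hnorm_def)
qed

lemma fock_simps [simp]:
  "F \<oplus>\<^bsub>fock H\<^esub> G = (\<lambda>n xs. F n xs + G n xs)"
  "c \<odot>\<^bsub>fock H\<^esub> F = (\<lambda>n xs. c * F n xs)"
  "hdiff (fock H) F G = (\<lambda>n xs. F n xs - G n xs)"
  "ip (fock H) F G = (\<Sum>n. ip (sym_power H n) (F n) (G n))"
  by (simp_all add: hdiff_def fock_def hilb_sum_def)

lemma fock_carrier:
  "F \<in> carrier (fock H) \<longleftrightarrow> (\<forall>n. F n \<in> carrier (sym_power H n)) \<and> summable (\<lambda>n. hs_norm2 H n (F n))"
proof -
  have "(\<lambda>n. (hnorm (sym_power H n) (F n))\<^sup>2) = (\<lambda>n. hs_norm2 H n (F n))" if "\<forall>n. F n \<in> carrier (sym_power H n)"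
    using that hnorm_sym_power(1) by auto
  then show ?thesis by (auto simp: fock_def hilb_sum_def)
qed

lemma fock_diff_closed:
  assumes "F \<in> carrier (fock H)" "G \<in> carrier (fock H)"
  shows "(\<lambda>n xs. F n xs - G n xs) \<in> carrier (fock H)"
  unfolding fock_carrier
proof (intro conjI allI)
  have bound: "summable (\<lambda>n. 2 * hs_norm2 H n (F n) + 2 * hs_norm2 H n (G n))"
    using assms by (intro summable_add summable_mult) (simp_all add: fock_carrier)
  show "(\<lambda>xs. F n xs - G n xs) \<in> carrier (sym_power H n)" for n
    using assms by (intro sym_power_diff_closed) (auto simp: fock_carrier)
  then have "0 \<le> hs_norm2 H n (\<lambda>xs. F n xs - G n xs)" for n
    by (intro hs_norm2_nonneg sym_powerD(2))
  moreover have "hs_norm2 H n (\<lambda>xs. F n xs - G n xs) \<le> 2 * hs_norm2 H n (F n) + 2 * hs_norm2 H n (G n)" for n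
    using assms by (intro hs_norm2_diff_le sym_powerD(2)) (auto simp: fock_carrier)
  ultimately show "summable (\<lambda>n. hs_norm2 H n (\<lambda>xs. F n xs - G n xs))"
    by (intro summable_comparison_test' [OF bound, of 0]) auto
qed

lemma hnorm_fock:
  assumes "F \<in> carrier (fock H)"
  shows "hnorm (fock H) F = sqrt (\<Sum>n. hs_norm2 H n (F n))" "hs_norm2 H n (F n) \<le> (hnorm (fock H) F)\<^sup>2"
proof -
  have S: "F n \<in> carrier (sym_power H n)" for n using assms by (simp add: fock_carrier)
  have summ: "summable (\<lambda>n. hs_norm2 H n (F n))" using assms by (simp add: fock_carrier)
  have nn: "0 \<le> hs_norm2 H n (F n)" for n
    using S by (intro hs_norm2_nonneg sym_powerD(2))
  have "(\<Sum>n. ip (sym_power H n) (F n) (F n)) = complex_of_real (\<Sum>n. hs_norm2 H n (F n))"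
    unfolding hnorm_sym_power(2) [OF S] by (rule suminf_of_real [OF summ, symmetric])
  then show *: "hnorm (fock H) F = sqrt (\<Sum>n. hs_norm2 H n (F n))"
    by (simp add: hnorm_def)
  show "hs_norm2 H n (F n) \<le> (hnorm (fock H) F)\<^sup>2"
    unfolding * using sum_le_suminf [OF summ, of "{n}"] nn suminf_nonneg [OF summ] by simp
qed

text \<open>Uniqueness is reduced to one particle number at a time: the squared norm of a component
  is bounded by that of the whole vector, and \<open>hs_norm2\<close> is definite on each symmetric
  power.\<close>

lemma hlim_fock_unique:
  assumes "L \<noteq> bot" "\<And>r. f r \<in> carrier (fock H)" "F \<in> carrier (fock H)" "G \<in> carrier (fock H)"
    and "hlim (fock H) f F L" "hlim (fock H) f G L"
  shows "F = G"
proof (intro ext)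
  fix n xs
  have S: "F n \<in> carrier (sym_power H n)" "G n \<in> carrier (sym_power H n)" "f r n \<in> carrier (sym_power H n)" for r
    using assms(2-4) by (auto simp: fock_carrier)
  let ?N = "\<lambda>F r. hnorm (fock H) (hdiff (fock H) (f r) F)"
  have le: "hs_norm2 H n (\<lambda>xs. F n xs - G n xs) \<le> 2 * (?N G r)\<^sup>2 + 2 * (?N F r)\<^sup>2" for r
  proof -
    have "hs_norm2 H n (\<lambda>xs. F n xs - G n xs) = hs_norm2 H n (\<lambda>xs. (f r n xs - G n xs) - (f r n xs - F n xs))"
      by simp
    also have "\<dots> \<le> 2 * hs_norm2 H n (\<lambda>xs. f r n xs - G n xs) + 2 * hs_norm2 H n (\<lambda>xs. f r n xs - F n xs)"
      using S by (intro hs_norm2_diff_le sym_powerD(2) sym_power_diff_closed)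
    also have "\<dots> \<le> 2 * (?N G r)\<^sup>2 + 2 * (?N F r)\<^sup>2"
      using hnorm_fock(2) [OF fock_diff_closed [OF assms(2,3)], of n r] hnorm_fock(2) [OF fock_diff_closed [OF assms(2,4)], of n r]
      by simp
    finally show ?thesis .
  qed
  have "((\<lambda>r. 2 * (?N G r)\<^sup>2 + 2 * (?N F r)\<^sup>2) \<longlongrightarrow> 2 * 0\<^sup>2 + 2 * 0\<^sup>2) L"
    using assms(5,6) unfolding hlim_def by (intro tendsto_intros)
  then have "hs_norm2 H n (\<lambda>xs. F n xs - G n xs) \<le> 2 * 0\<^sup>2 + 2 * 0\<^sup>2"
    using le by (intro tendsto_lowerbound [OF _ _ assms(1)]) auto
  moreover have D: "(\<lambda>xs. F n xs - G n xs) \<in> carrier (sym_power H n)"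
    by (rule sym_power_diff_closed [OF S(1,2)])
  ultimately have "hs_norm2 H n (\<lambda>xs. F n xs - G n xs) = 0"
    using hs_norm2_nonneg [OF sym_powerD(2) [OF D]] by simp
  from hs_norm2_eq_0 [OF sym_powerD(1,2) [OF D] this, of xs] show "F n xs = G n xs" by simp
qed

end

section \<open>Second quantization\<close>

text \<open>The orthogonal projection is encoded by idempotence and self-adjointness. Its linearity
  follows by testing with \<open>ip_eqI\<close>, which is how the laws of \<open>scale_range\<close>
  are obtained.\<close>

locale projection_space = inner_space H for H :: "'a hilb" (structure) +
  fixes P :: "'a \<Rightarrow> 'a"
  assumes P_closed [simp, intro]: "x \<in> carrier H \<Longrightarrow> P x \<in> carrier H"
    and P_idem: "x \<in> carrier H \<Longrightarrow> P (P x) = P x"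
    and P_self_adjoint: "\<lbrakk>x \<in> carrier H; y \<in> carrier H\<rbrakk> \<Longrightarrow> ip H (P x) y = ip H x (P y)"
begin

text \<open>$1 + (w - 1) P$, which is $e^{\mathrm{i} r P}$ for $w = e^{\mathrm{i} r}$.\<close>

definition scale_range :: "complex \<Rightarrow> 'a \<Rightarrow> 'a" where
  "scale_range w x = x \<oplus> (w - 1) \<odot> P x"

lemma scale_range_closed [simp, intro]: "x \<in> carrier H \<Longrightarrow> scale_range w x \<in> carrier H"
  by (simp add: scale_range_def)

lemma scale_range_add:
  "\<lbrakk>x \<in> carrier H; y \<in> carrier H\<rbrakk> \<Longrightarrow> scale_range w (x \<oplus> y) = scale_range w x \<oplus> scale_range w y"
  by (rule ip_eqI) (simp_all add: scale_range_def ip_simps P_self_adjoint algebra_simps)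

lemma scale_range_smult:
  "x \<in> carrier H \<Longrightarrow> scale_range w (c \<odot> x) = c \<odot> scale_range w x"
  by (rule ip_eqI) (simp_all add: scale_range_def ip_simps P_self_adjoint algebra_simps)

lemma scale_range_mult:
  "x \<in> carrier H \<Longrightarrow> scale_range w (scale_range v x) = scale_range (w * v) x"
  by (rule ip_eqI) (simp_all add: scale_range_def ip_simps P_self_adjoint P_idem algebra_simps)

lemma scale_range_1: "x \<in> carrier H \<Longrightarrow> scale_range 1 x = x"
  by (simp add: scale_range_def smult_zero_left)

lemma ip_scale_range:
  "\<lbrakk>x \<in> carrier H; y \<in> carrier H\<rbrakk> \<Longrightarrow> ip H (scale_range w x) y = ip H x (scale_range (cnj w) y)"
  by (simp add: scale_range_def ip_simps P_self_adjoint)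

lemma ip_scale_range_unitary:
  assumes "w * cnj w = 1" "x \<in> carrier H" "y \<in> carrier H"
  shows "ip H (scale_range w x) (scale_range w y) = ip H x y"
  using assms by (simp add: ip_scale_range scale_range_mult scale_range_1 mult.commute)

lemma inj_on_scale_range:
  assumes "w * cnj w = 1"
  shows "inj_on (scale_range w) (carrier H)"
proof (rule inj_on_inverseI)
  fix x assume "x \<in> carrier H"
  then show "scale_range (cnj w) (scale_range w x) = x"
    using assms by (simp add: scale_range_mult scale_range_1 mult.commute)
qed

lemma orthonormal_scale_range:
  assumes "w * cnj w = 1" "orthonormal H E"
  shows "orthonormal H (scale_range w ` E)"
proof -
  have E: "E \<subseteq> carrier H" using assms(2) by (simp add: orthonormal_def)
  then have inj: "inj_on (scale_range w) E"
    using inj_on_scale_range [OF assms(1)] inj_on_subset by blast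
  have "ip H (scale_range w x) (scale_range w y) = (if scale_range w x = scale_range w y then 1 else 0)"
    if "x \<in> E" "y \<in> E" for x y
  proof -
    have "ip H (scale_range w x) (scale_range w y) = ip H x y"
      using that E by (intro ip_scale_range_unitary assms(1)) auto
    then show ?thesis using that assms(2) inj by (simp add: orthonormal_def inj_on_eq_iff)
  qed
  then show ?thesis using E by (auto simp: orthonormal_def)
qed

text \<open>On the functional y \<mapsto> \<Prod> \<langle>x_i, y_i\<rangle> an operator applied to
  the x_i acts through its adjoint on the y_i. The adjoint of \<open>scale_range w\<close> is
  \<open>scale_range (cnj w)\<close>, whence the conjugate.\<close>

definition tensor_op :: "nat \<Rightarrow> complex \<Rightarrow> ('a list \<Rightarrow> complex) \<Rightarrow> 'a list \<Rightarrow> complex" where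
  "tensor_op n w F xs = (if xs \<in> tuples (carrier H) n then F (map (scale_range (cnj w)) xs) else 0)"

lemma map_scale_range_tuples:
  "xs \<in> tuples (carrier H) n \<Longrightarrow> map (scale_range w) xs \<in> tuples (carrier H) n"
  by (auto simp: tuples_def)

lemma tensor_op_mult: "tensor_op n w (tensor_op n v F) = tensor_op n (w * v) F"
proof
  fix xs
  have "map (scale_range (cnj v)) (map (scale_range (cnj w)) xs) = map (scale_range (cnj (w * v))) xs"
    if "xs \<in> tuples (carrier H) n"
    using that by (auto simp: tuples_def scale_range_mult mult.commute)
  then show "tensor_op n w (tensor_op n v F) xs = tensor_op n (w * v) F xs"
    unfolding tensor_op_def using map_scale_range_tuples [of xs n "cnj w"] by presburger
qed

lemma tensor_op_1:
  assumes "conj_multilinear H n F"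
  shows "tensor_op n 1 F = F"
proof
  fix xs
  have "map (scale_range 1) xs = xs" if "xs \<in> tuples (carrier H) n"
    using that by (auto simp: tuples_def scale_range_1 intro!: map_idI)
  then show "tensor_op n 1 F xs = F xs"
    using conj_multilinearD(1) [OF assms] by (simp add: tensor_op_def)
qed

text \<open>For \<bar>w\<bar> = 1 the map on \<open>H\<close> preserves inner products, so it
  carries orthonormal systems to orthonormal systems; each sum for the transformed functional is a
  sum for \<open>F\<close> over the image system.\<close>

lemma hs_sums_tensor_op_subset:
  assumes "w * cnj w = 1"
  shows "hs_sums H n (tensor_op n w F) \<subseteq> hs_sums H n F"
proof
  fix s assume "s \<in> hs_sums H n (tensor_op n w F)"
  then obtain E where s: "s = (\<Sum>b\<in>tuples E n. (cmod (tensor_op n w F b))\<^sup>2)"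
    and E: "finite E" "orthonormal H E" by (auto simp: hs_sums_def)
  let ?v = "scale_range (cnj w)"
  have w': "cnj w * cnj (cnj w) = 1" using assms by (simp add: mult.commute)
  have EH: "E \<subseteq> carrier H" using E by (simp add: orthonormal_def)
  then have inj: "inj_on ?v E"
    using inj_on_scale_range [OF w'] inj_on_subset by blast
  have img: "tuples (?v ` E) n = map ?v ` tuples E n"
  proof (intro equalityI subsetI)
    fix ys assume ys: "ys \<in> tuples (?v ` E) n"
    then have "ys \<in> lists (?v ` E)" by (auto simp: tuples_def lists_eq_set)
    then have "ys \<in> map ?v ` lists E" by (simp only: lists_image)
    then show "ys \<in> map ?v ` tuples E n" using ys by (auto simp: tuples_def lists_eq_set)
  qed (auto simp: tuples_def intro!: imageI)
  have injm: "inj_on (map ?v) (tuples E n)"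
    by (intro inj_on_mapI inj_on_subset [OF inj]) (auto simp: tuples_def)
  have "s = (\<Sum>b\<in>tuples E n. (cmod (F (map ?v b)))\<^sup>2)"
    unfolding s using EH by (intro sum.cong refl) (auto simp: tensor_op_def tuples_def)
  also have "\<dots> = (\<Sum>b\<in>tuples (?v ` E) n. (cmod (F b))\<^sup>2)"
    unfolding img by (simp add: sum.reindex [OF injm])
  finally show "s \<in> hs_sums H n F"
    unfolding hs_sums_def using E orthonormal_scale_range [OF w' E(2)] by blast
qed

lemma hs_sums_tensor_op:
  assumes "w * cnj w = 1" "conj_multilinear H n F"
  shows "hs_sums H n (tensor_op n w F) = hs_sums H n F"
proof
  have w': "cnj w * cnj (cnj w) = 1" using assms by (simp add: mult.commute)
  have "hs_sums H n (tensor_op n (cnj w) (tensor_op n w F)) \<subseteq> hs_sums H n (tensor_op n w F)"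
    by (rule hs_sums_tensor_op_subset [OF w'])
  then show "hs_sums H n F \<subseteq> hs_sums H n (tensor_op n w F)"
    using assms by (simp add: tensor_op_mult tensor_op_1 mult.commute)
qed (rule hs_sums_tensor_op_subset [OF assms(1)])

lemma hs_norm2_tensor_op:
  assumes "w * cnj w = 1" "conj_multilinear H n F"
  shows "hs_norm2 H n (tensor_op n w F) = hs_norm2 H n F"
  by (simp add: hs_norm2_def hs_sums_tensor_op [OF assms])

lemma tensor_op_closed:
  assumes "w * cnj w = 1" "F \<in> carrier (sym_power H n)"
  shows "tensor_op n w F \<in> carrier (sym_power H n)"
  unfolding sym_power_carrier
proof (intro conjI allI impI)
  note F = sym_powerD [OF assms(2)]
  let ?v = "scale_range (cnj w)"
  show "conj_multilinear H n (tensor_op n w F)"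
  proof (rule conj_multilinearI)
    show "tensor_op n w F xs = 0" if "xs \<notin> tuples (carrier H) n" for xs
      using that by (simp add: tensor_op_def)
    have upd: "tensor_op n w F (xs[i := x]) = F ((map ?v xs)[i := ?v x])"
      if "xs \<in> tuples (carrier H) n" "x \<in> carrier H" for xs i x
    proof -
      have "xs[i := x] \<in> tuples (carrier H) n"
        using that set_update_subset_insert [of xs i x] by (auto simp: tuples_def)
      then show ?thesis by (simp add: tensor_op_def map_update)
    qed
    show "tensor_op n w F (xs[i := x \<oplus> y]) = tensor_op n w F (xs[i := x]) + tensor_op n w F (xs[i := y])"
      if "xs \<in> tuples (carrier H) n" "i < n" "x \<in> carrier H" "y \<in> carrier H" for xs i x y
      using that conj_multilinearD(2) [OF F(1) map_scale_range_tuples [OF that(1), where w = "cnj w"]]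
      by (simp add: upd scale_range_add)
    show "tensor_op n w F (xs[i := c \<odot> x]) = cnj c * tensor_op n w F (xs[i := x])"
      if "xs \<in> tuples (carrier H) n" "i < n" "x \<in> carrier H" for xs i c x
      using that conj_multilinearD(3) [OF F(1) map_scale_range_tuples [OF that(1), where w = "cnj w"]]
      by (simp add: upd scale_range_smult)
  qed
  show "bdd_above (hs_sums H n (tensor_op n w F))"
    unfolding hs_sums_tensor_op [OF assms(1) F(1)] by (rule F)
  fix xs ys :: "'a list" assume m: "mset xs = mset ys"
  then have "xs \<in> tuples (carrier H) n \<longleftrightarrow> ys \<in> tuples (carrier H) n"
    unfolding tuples_def using mset_eq_setD [OF m] mset_eq_length [OF m] by simp
  moreover have "F (map ?v xs) = F (map ?v ys)" using m by (intro F) simp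
  ultimately show "tensor_op n w F xs = tensor_op n w F ys"
    by (simp add: tensor_op_def)
qed

definition fock_op :: "complex \<Rightarrow> (nat \<Rightarrow> 'a list \<Rightarrow> complex) \<Rightarrow> nat \<Rightarrow> 'a list \<Rightarrow> complex" where
  "fock_op w F = (\<lambda>n. tensor_op n w (F n))"

lemma fock_op_closed:
  assumes "w * cnj w = 1" "F \<in> carrier (fock H)"
  shows "fock_op w F \<in> carrier (fock H)"
proof -
  have F: "F n \<in> carrier (sym_power H n)" for n using assms(2) by (simp add: fock_carrier)
  have "hs_norm2 H n (tensor_op n w (F n)) = hs_norm2 H n (F n)" for n
    by (rule hs_norm2_tensor_op [OF assms(1) sym_powerD(1) [OF F]])
  then show ?thesis
    using assms(2) tensor_op_closed [OF assms(1) F] by (simp add: fock_carrier fock_op_def)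
qed

lemma fock_op_mult: "fock_op w (fock_op v F) = fock_op (w * v) F"
  by (simp add: fock_op_def tensor_op_mult)

lemma fock_op_1: "F \<in> carrier (fock H) \<Longrightarrow> fock_op 1 F = F"
  by (simp add: fock_op_def fock_carrier tensor_op_1 sym_powerD(1) fun_eq_iff)

text \<open>The inner product is a combination of the values of \<open>hs_norm2\<close> at F + c G.
  The action is linear in the functional, so invariance of \<open>hs_norm2\<close> suffices; the
  inverse belongs to \<open>cnj w\<close>.\<close>

lemma unitary_fock_op:
  assumes "w * cnj w = 1"
  shows "unitary_op (fock H) (fock_op w)"
  unfolding unitary_op_def
proof (intro conjI ballI allI)
  have w': "cnj w * cnj (cnj w) = 1" using assms by (simp add: mult.commute)
  show "bij_betw (fock_op w) (carrier (fock H)) (carrier (fock H))"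
    by (rule bij_betw_byWitness [where f' = "fock_op (cnj w)"])
      (use assms w' in \<open>auto simp: fock_op_mult fock_op_1 fock_op_closed mult.commute\<close>)
  show "fock_op w (F \<oplus>\<^bsub>fock H\<^esub> G) = fock_op w F \<oplus>\<^bsub>fock H\<^esub> fock_op w G" for F G
    by (auto simp: fock_op_def tensor_op_def fun_eq_iff)
  show "fock_op w (c \<odot>\<^bsub>fock H\<^esub> F) = c \<odot>\<^bsub>fock H\<^esub> fock_op w F" for c F
    by (auto simp: fock_op_def tensor_op_def fun_eq_iff)
  fix F G assume FG: "F \<in> carrier (fock H)" "G \<in> carrier (fock H)"
  have "ip (sym_power H n) (tensor_op n w (F n)) (tensor_op n w (G n)) = ip (sym_power H n) (F n) (G n)" for n
  proof -
    have lin: "conj_multilinear H n (\<lambda>xs. F n xs + c * G n xs)" for c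
      using FG by (intro sym_powerD(1) sym_power_add_closed sym_power_smult_closed) (auto simp: fock_carrier)
    have "(\<lambda>xs. tensor_op n w (F n) xs + c * tensor_op n w (G n) xs) = tensor_op n w (\<lambda>xs. F n xs + c * G n xs)" for c
      by (auto simp: tensor_op_def)
    then have "hs_norm2 H n (\<lambda>xs. tensor_op n w (F n) xs + c * tensor_op n w (G n) xs) = hs_norm2 H n (\<lambda>xs. F n xs + c * G n xs)" for c
      using hs_norm2_tensor_op [OF assms lin] by simp
    then show ?thesis by (simp add: sym_power_def)
  qed
  then show "ip (fock H) (fock_op w F) (fock_op w G) = ip (fock H) F G"
    by (simp add: fock_op_def)
qed

text \<open>Expanding x + (w - 1) P x in one argument yields one value of \<open>F\<close> plus
  \<open>cnj (w - 1)\<close> times another, so each argument raises the degree by at most one. The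
  variable is \<open>cnj w\<close> because \<open>F\<close> is conjugate linear.\<close>

lemma tensor_op_polynomial:
  assumes F: "conj_multilinear H n F" and xs: "xs \<in> tuples (carrier H) n"
  shows "\<exists>p. degree p \<le> n \<and> (\<forall>w. F (map (scale_range w) xs) = poly p (cnj w))"
proof -
  have "\<exists>p. degree p \<le> m \<and> (\<forall>w. F (map (scale_range w) (take m xs) @ drop m xs) = poly p (cnj w))"
    if "m \<le> n" "xs \<in> tuples (carrier H) n" for m xs
    using that
  proof (induction m arbitrary: xs)
    case 0
    then show ?case by (intro exI [of _ "[:F xs:]"]) auto
  next
    case (Suc m)
    then have m: "m < length xs" "length xs = n" and set: "set xs \<subseteq> carrier H" by (auto simp: tuples_def)
    have xm: "xs ! m \<in> carrier H" using m set by auto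
    let ?ys = "\<lambda>w. map (scale_range w) (take m xs) @ drop m xs"
    have ys: "?ys w \<in> tuples (carrier H) n" for w
      using m set set_take_subset [of m xs] set_drop_subset [of m xs] by (auto simp: tuples_def)
    \<comment> \<open>The induction hypothesis is used for \<open>xs\<close> and for this modified
      tuple, hence the induction generalizes over \<open>xs\<close>.\<close>
    let ?xs' = "xs[m := P (xs ! m)]"
    have xs': "?xs' \<in> tuples (carrier H) n"
      using m set xm set_update_subset_insert [of xs m] by (auto simp: tuples_def)
    obtain p where p: "degree p \<le> m" "\<And>w. F (?ys w) = poly p (cnj w)"
      using Suc.IH [of xs] Suc.prems by auto
    obtain q where q: "degree q \<le> m" "\<And>w. F (map (scale_range w) (take m ?xs') @ drop m ?xs') = poly q (cnj w)"
      using Suc.IH [OF _ xs'] Suc.prems by auto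
    have upd: "map (scale_range w) (take m xs) @ z # drop (Suc m) xs = (?ys w)[m := z]" for w z
    proof -
      have "drop m xs = xs ! m # drop (Suc m) xs" using m by (simp add: Cons_nth_drop_Suc)
      then show ?thesis using m by (simp add: list_update_append)
    qed
    have q': "F ((?ys w)[m := P (xs ! m)]) = poly q (cnj w)" for w
      unfolding q(2) [symmetric] upd [symmetric] using m
      by (simp add: drop_update_swap flip: Cons_nth_drop_Suc)
    have same: "(?ys w)[m := xs ! m] = ?ys w" for w
      unfolding upd [symmetric] using m by (simp add: Cons_nth_drop_Suc)
    have "F (map (scale_range w) (take (Suc m) xs) @ drop (Suc m) xs) = poly (p + [:-1, 1:] * q) (cnj w)" for w
    proof -
      have "map (scale_range w) (take (Suc m) xs) @ drop (Suc m) xs = (?ys w)[m := scale_range w (xs ! m)]"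
        unfolding upd [symmetric] using m by (simp add: take_Suc_conv_app_nth)
      also have "\<dots> = (?ys w)[m := xs ! m \<oplus> (w - 1) \<odot> P (xs ! m)]"
        by (simp only: scale_range_def)
      also have "F \<dots> = F ((?ys w)[m := xs ! m]) + F ((?ys w)[m := (w - 1) \<odot> P (xs ! m)])"
        using m xm by (intro conj_multilinearD(2) [OF F ys]) auto
      also have "F ((?ys w)[m := (w - 1) \<odot> P (xs ! m)]) = cnj (w - 1) * F ((?ys w)[m := P (xs ! m)])"
        using m xm by (intro conj_multilinearD(3) [OF F ys]) auto
      finally show ?thesis unfolding same q' p(2) by (simp add: algebra_simps)
    qed
    moreover have "degree (p + [:-1, 1:] * q) \<le> Suc m"
      using p(1) q(1) by (intro degree_add_le order_trans [OF degree_mult_le]) auto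
    ultimately show ?case by blast
  qed
  from this [OF order_refl xs] show ?thesis using xs by (simp add: tuples_def)
qed

end

section \<open>Interpolation and strong continuity\<close>

lemma lagrange_interpolation:
  fixes p :: "'a::field poly"
  assumes "finite W" "degree p < card W"
  shows "poly p w = (\<Sum>v\<in>W. (\<Prod>a\<in>W - {v}. (w - a) / (v - a)) * poly p v)"
proof -
  define q where "q = (\<Sum>v\<in>W. Polynomial.smult (poly p v) (\<Prod>a\<in>W - {v}. Polynomial.smult (1 / (v - a)) [:-a, 1:]))"
  have poly_q: "poly q w = (\<Sum>v\<in>W. (\<Prod>a\<in>W - {v}. (w - a) / (v - a)) * poly p v)" for w
    by (simp add: q_def poly_sum poly_prod algebra_simps diff_divide_distrib)
  have "p = q"
  proof (rule poly_eqI_degree [of W])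
    fix x assume x: "x \<in> W"
    have "poly q x = (\<Sum>v\<in>W. if v = x then poly p x else 0)"
      unfolding poly_q
    proof (rule sum.cong)
      fix v assume v: "v \<in> W"
      show "(\<Prod>a\<in>W - {v}. (x - a) / (v - a)) * poly p v = (if v = x then poly p x else 0)"
      proof (cases "v = x")
        case True
        have "(\<Prod>a\<in>W - {x}. (x - a) / (x - a)) = 1" by (intro prod.neutral) auto
        then show ?thesis using True by simp
      next
        case False
        then have "(\<Prod>a\<in>W - {v}. (x - a) / (v - a)) = 0"
          using x assms(1) by (intro prod_zero) auto
        then show ?thesis using False by simp
      qed
    qed simp
    then show "poly p x = poly q x" using x assms(1) by simp
  next
    show "degree p < card W" by fact
    have "degree (\<Prod>a\<in>W - {v}. Polynomial.smult (1 / (v - a)) [:-a, 1:]) \<le> card W - 1" if "v \<in> W" for v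
    proof -
      have "degree (\<Prod>a\<in>W - {v}. Polynomial.smult (1 / (v - a)) [:-a, 1:]) \<le> (\<Sum>a\<in>W - {v}. degree (Polynomial.smult (1 / (v - a)) [:-a, 1:]))"
        using degree_prod_sum_le [of "W - {v}" "\<lambda>a. Polynomial.smult (1 / (v - a)) [:-a, 1:]"] assms(1) by (simp add: o_def)
      also have "\<dots> \<le> (\<Sum>a\<in>W - {v}. 1)"
        by (intro sum_mono) (auto intro: order_trans [OF degree_smult_le])
      finally show ?thesis using that assms(1) by simp
    qed
    then have "degree q \<le> card W - 1"
      unfolding q_def using assms(1) by (intro degree_sum_le order_trans [OF degree_smult_le]) auto
    then show "degree q < card W" using assms(2) by linarith
  qed
  then have "poly p w = poly q w" by simp
  also have "\<dots> = (\<Sum>v\<in>W. (\<Prod>a\<in>W - {v}. (w - a) / (v - a)) * poly p v)" by (rule poly_q)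
  finally show ?thesis .
qed

context projection_space
begin

text \<open>On the $n$-th tensor power the second quantization of $1 + (w - 1) P$ is a polynomial of degree at most
  $n$ in $w$. Interpolating at roots of unity, where it is isometric, gives strong continuity without a bound
  for $P$ acting in a single tensor factor.\<close>

lemma tensor_op_interpolation:
  assumes F: "conj_multilinear H n F" and W: "finite W" "n < card W"
  shows "tensor_op n w F xs = (\<Sum>v\<in>W. (\<Prod>a\<in>W - {v}. (w - a) / (v - a)) * tensor_op n v F xs)"
proof (cases "xs \<in> tuples (carrier H) n")
  case True
  obtain p where p: "degree p \<le> n" "\<And>w. F (map (scale_range w) xs) = poly p (cnj w)"
    using tensor_op_polynomial [OF F True] by blast
  have "tensor_op n w F xs = poly p w" for w
    using True by (simp add: tensor_op_def p(2))
  then show ?thesis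
    using lagrange_interpolation [OF W(1), of p w] p(1) W(2) by simp
qed (simp add: tensor_op_def)

lemma tensor_op_tendsto:
  assumes F: "F \<in> carrier (sym_power H n)" and w: "(w \<longlongrightarrow> 1) L"
  shows "((\<lambda>r. hs_norm2 H n (\<lambda>xs. tensor_op n (w r) F xs - F xs)) \<longlongrightarrow> 0) L"
proof -
  define W where "W = {v::complex. v ^ Suc n = 1}"
  have W: "finite W" "card W = Suc n"
    unfolding W_def using card_roots_unity_eq [of "Suc n"] by (auto intro: card_ge_0_finite)
  have unit: "v * cnj v = 1" if "v \<in> W" for v
  proof -
    have "v ^ Suc n = 1" using that by (simp add: W_def)
    then have "cmod v = 1" using power_eq_1_iff by (metis nat.distinct(2))
    then show ?thesis by (simp flip: complex_norm_square)
  qed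
  note F' = sym_powerD [OF F]
  let ?l = "\<lambda>v w. \<Prod>a\<in>W - {v}. (w - a) / (v - a)"
  \<comment> \<open>At \<open>w = 1\<close> the interpolation formula reproduces \<open>F\<close>.
    Subtracting it leaves coefficients \<open>?l v w - ?l v 1\<close>, which tend to 0, in front of
    functionals of fixed norm.\<close>
  have "F xs = (\<Sum>v\<in>W. ?l v 1 * tensor_op n v F xs)" for xs
    using tensor_op_interpolation [OF F'(1) W(1), of 1 xs] tensor_op_1 [OF F'(1)] W(2) by simp
  then have eq: "(\<lambda>xs. tensor_op n w F xs - F xs) = (\<lambda>xs. \<Sum>v\<in>W. (?l v w - ?l v 1) * tensor_op n v F xs)" for w
    using tensor_op_interpolation [OF F'(1) W(1), of w] W(2)
    by (simp add: fun_eq_iff left_diff_distrib sum_subtractf)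
  have "hs_norm2 H n (\<lambda>xs. \<Sum>v\<in>W. (?l v w - ?l v 1) * tensor_op n v F xs)
     \<le> real (card W) * (\<Sum>v\<in>W. (cmod (?l v w - ?l v 1))\<^sup>2) * hs_norm2 H n F" for w
    by (rule hs_norm2_sum_le [OF W(1)])
      (simp_all add: hs_sums_tensor_op hs_norm2_tensor_op unit F')
  then have le: "hs_norm2 H n (\<lambda>xs. tensor_op n w F xs - F xs)
     \<le> real (card W) * (\<Sum>v\<in>W. (cmod (?l v w - ?l v 1))\<^sup>2) * hs_norm2 H n F" for w
    unfolding eq .
  have nn: "0 \<le> hs_norm2 H n (\<lambda>xs. tensor_op n w F xs - F xs)" for w
  proof -
    have "bdd_above (hs_sums H n (\<lambda>xs. \<Sum>v\<in>W. (?l v w - ?l v 1) * tensor_op n v F xs))"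
      by (rule hs_norm2_sum_le(1) [OF W(1), where K = "hs_norm2 H n F"])
        (simp_all add: hs_sums_tensor_op hs_norm2_tensor_op unit F')
    then show ?thesis unfolding eq by (rule hs_norm2_nonneg)
  qed
  have "((\<lambda>r. real (card W) * (\<Sum>v\<in>W. (cmod (?l v (w r) - ?l v 1))\<^sup>2) * hs_norm2 H n F) \<longlongrightarrow>
      real (card W) * (\<Sum>v\<in>W. (cmod (?l v 1 - ?l v 1))\<^sup>2) * hs_norm2 H n F) L"
    by (intro tendsto_intros w) auto
  then have "((\<lambda>r. real (card W) * (\<Sum>v\<in>W. (cmod (?l v (w r) - ?l v 1))\<^sup>2) * hs_norm2 H n F) \<longlongrightarrow> 0) L"
    by simp
  then show ?thesis
    by (rule tendsto_sandwich [OF _ _ tendsto_const, rotated 2]) (use le nn in auto)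
qed

text \<open>Dominated convergence over the particle number. In each component the transformed and
  the original vector have equal norm, so \<open>hs_norm2_diff_le\<close> gives the factor 2 + 2 = 4
  in the dominating series.\<close>

lemma fock_op_tendsto:
  assumes F: "F \<in> carrier (fock H)" and w: "(w \<longlongrightarrow> 1) L" "\<And>r. w r * cnj (w r) = 1" and L: "L \<noteq> bot"
  shows "hlim (fock H) (\<lambda>r. fock_op (w r) F) F L"
proof -
  have S: "F n \<in> carrier (sym_power H n)" for n using F by (simp add: fock_carrier)
  have D: "(\<lambda>n xs. fock_op (w r) F n xs - F n xs) \<in> carrier (fock H)" for r
    by (intro fock_diff_closed fock_op_closed w F)
  let ?a = "\<lambda>n r. hs_norm2 H n (\<lambda>xs. tensor_op n (w r) (F n) xs - F n xs)"
  have bound: "norm (?a n r) \<le> 4 * hs_norm2 H n (F n)" for n r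
  proof -
    have "?a n r \<le> 2 * hs_norm2 H n (tensor_op n (w r) (F n)) + 2 * hs_norm2 H n (F n)"
      by (intro hs_norm2_diff_le sym_powerD(2) tensor_op_closed w S)
    then have "?a n r \<le> 4 * hs_norm2 H n (F n)"
      by (simp add: hs_norm2_tensor_op [OF w(2) sym_powerD(1) [OF S]])
    moreover have "0 \<le> ?a n r"
      by (intro hs_norm2_nonneg sym_powerD(2) sym_power_diff_closed tensor_op_closed w S)
    ultimately show ?thesis by simp
  qed
  have "((\<lambda>r. \<Sum>n. ?a n r) \<longlongrightarrow> (\<Sum>n. 0)) L"
  proof (rule tannerys_theorem [THEN conjunct2, THEN conjunct2])
    show "((\<lambda>r. ?a n r) \<longlongrightarrow> 0) L" for n by (rule tensor_op_tendsto [OF S w(1)])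
    show "\<forall>\<^sub>F (n, r) in sequentially \<times>\<^sub>F L. norm (?a n r) \<le> 4 * hs_norm2 H n (F n)"
      using bound by (simp add: case_prod_unfold)
    show "summable (\<lambda>n. 4 * hs_norm2 H n (F n))"
      using F by (intro summable_mult) (simp add: fock_carrier)
  qed fact
  from tendsto_real_sqrt [OF this] show ?thesis
    unfolding hlim_def using hnorm_fock(1) [OF D] by (simp add: fock_op_def)
qed

lemma unitary_one_param_group_fock_op:
  "unitary_one_param_group (fock H) (\<lambda>r. fock_op (exp (\<i> * complex_of_real r * complex_of_real c)))"
proof -
  let ?w = "\<lambda>r. exp (\<i> * complex_of_real r * complex_of_real c)"
  have unit: "?w r * cnj (?w r) = 1" for r
    by (simp add: exp_cnj flip: exp_add)
  have lim: "((\<lambda>r. ?w r) \<longlongrightarrow> 1) (at 0)"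
  proof -
    have "((\<lambda>r. ?w r) \<longlongrightarrow> ?w 0) (at 0)"
      by (intro tendsto_intros)
    then show ?thesis by simp
  qed
  show ?thesis
    unfolding unitary_one_param_group_def
  proof (intro conjI allI ballI)
    show "unitary_op (fock H) (fock_op (?w r))" for r
      by (rule unitary_fock_op [OF unit])
    show "fock_op (?w 0) F = F" if "F \<in> carrier (fock H)" for F
      using that by (simp add: fock_op_1)
    show "fock_op (?w (r + s)) F =
        fock_op (?w r) (fock_op (?w s) F)" for r s F
      by (simp add: fock_op_mult algebra_simps flip: exp_add)
    show "hlim (fock H) (\<lambda>r. fock_op (?w r) F) F (at 0)"
      if "F \<in> carrier (fock H)" for F
      by (rule fock_op_tendsto [OF that lim unit]) simp
  qed
qed

text \<open>From the first power on, \<open>B ^^ k\<close> is \<open>c ^ k\<close> times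
  \<open>P\<close>. The partial sums of the operator exponential are thus \<open>scale_range\<close>
  at the partial sums of the scalar exponential, and differences of such vectors are multiples of
  the fixed vector \<open>P x\<close>.\<close>

lemma op_exp_scaled_projection:
  assumes B: "\<And>x. x \<in> carrier H \<Longrightarrow> B x = c \<odot> P x" and x: "x \<in> carrier H"
  shows "op_exp H B x = scale_range (exp c) x"
proof -
  let ?S = "\<lambda>n. \<Oplus>\<^bsub>H\<^esub>k\<in>{..n}. (1 / fact k) \<odot> (B ^^ k) x"
  have pow: "(B ^^ Suc k) x = c ^ Suc k \<odot> P x" for k
  proof (induction k)
    case (Suc k)
    have "(B ^^ Suc (Suc k)) x = B ((B ^^ Suc k) x)" by simp
    also have "\<dots> = c \<odot> P (c ^ Suc k \<odot> P x)" using x by (simp only: Suc B smult_closed P_closed)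
    also have "\<dots> = c ^ Suc (Suc k) \<odot> P x"
      by (rule ip_eqI) (use x in \<open>simp_all add: ip_simps P_self_adjoint P_idem\<close>)
    finally show ?case .
  qed (use B x in simp)
  have closed: "(B ^^ k) x \<in> carrier H" for k
    using pow x by (cases k) (auto simp del: funpow.simps(2))
  have partial: "?S n = scale_range (\<Sum>k\<le>n. c ^ k / fact k) x" for n
  proof (induction n)
    case 0
    show ?case using x by (simp add: scale_range_1 smult_one)
  next
    case (Suc n)
    have "?S (Suc n)
        = (1 / fact (Suc n)) \<odot> (B ^^ Suc n) x \<oplus> ?S n"
      unfolding atMost_Suc by (rule finsum_insert) (auto simp: closed simp del: funpow.simps)
    also have "\<dots> = (1 / fact (Suc n)) \<odot> (c ^ Suc n \<odot> P x) \<oplus> scale_range (\<Sum>k\<le>n. c ^ k / fact k) x"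
      by (simp only: pow Suc)
    also have "\<dots> = scale_range (\<Sum>k\<le>Suc n. c ^ k / fact k) x"
      by (rule ip_eqI) (use x in \<open>simp_all add: scale_range_def ip_simps algebra_simps del: fact_Suc\<close>)
    finally show ?case .
  qed
  have diff: "hnorm H (hdiff H (scale_range a x) (scale_range b x)) = cmod (a - b) * hnorm H (P x)" for a b
  proof -
    have eq: "hdiff H (scale_range a x) (scale_range b x) = (a - b) \<odot> P x"
      by (rule ip_eqI) (use x in \<open>simp_all add: scale_range_def ip_simps algebra_simps\<close>)
    have sq: "(hnorm H ((a - b) \<odot> P x))\<^sup>2 = (cmod (a - b) * hnorm H (P x))\<^sup>2"
    proof -
      have "ip H ((a - b) \<odot> P x) ((a - b) \<odot> P x) = complex_of_real ((cmod (a - b))\<^sup>2) * ip H (P x) (P x)"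
        using x by (simp only: ip_simps P_closed smult_closed complex_norm_square mult_ac)
      then show ?thesis using x by (simp add: hnorm_power2 power_mult_distrib)
    qed
    have "0 \<le> hnorm H ((a - b) \<odot> P x)" "0 \<le> cmod (a - b) * hnorm H (P x)"
      using x ip_nonneg by (simp_all add: hnorm_def)
    with sq show ?thesis unfolding eq by (rule power2_eq_imp_eq)
  qed
  have "(\<lambda>n. \<Sum>k\<le>n. c ^ k / fact k) \<longlonglongrightarrow> exp c"
    using exp_converges [of c] by (simp add: sums_def_le divide_inverse scaleR_conv_of_real mult.commute)
  then have "(\<lambda>n. cmod ((\<Sum>k\<le>n. c ^ k / fact k) - exp c) * hnorm H (P x)) \<longlonglongrightarrow> cmod (exp c - exp c) * hnorm H (P x)"
    by (intro tendsto_intros)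
  then have lim: "hlim H (\<lambda>n. ?S n) (scale_range (exp c) x) sequentially"
    unfolding hlim_def partial diff by simp
  show ?thesis
    unfolding op_exp_def
  proof (rule the_equality)
    fix y assume y: "y \<in> carrier H \<and> hlim H (\<lambda>n. ?S n) y sequentially"
    show "y = scale_range (exp c) x"
      by (rule hlim_unique [OF _ _ _ _ y [THEN conjunct2] lim]) (use y x in \<open>auto simp: partial\<close>)
  qed (use lim x in auto)
qed

end

section \<open>Exponential vectors in the domain of the generator\<close>

lemma tuples_Suc: "tuples A (Suc n) = (\<lambda>(x, xs). x # xs) ` (A \<times> tuples A n)"
proof (intro equalityI subsetI)
  fix ys assume "ys \<in> tuples A (Suc n)"
  then show "ys \<in> (\<lambda>(x, xs). x # xs) ` (A \<times> tuples A n)"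
    by (cases ys) (auto simp: tuples_def image_iff)
qed (auto simp: tuples_def)

lemma sum_tuples_prod_list:
  fixes f :: "'b \<Rightarrow> 'c::comm_semiring_1"
  shows "(\<Sum>b\<in>tuples E n. \<Prod>y\<leftarrow>b. f y) = (\<Sum>e\<in>E. f e) ^ n"
proof (induction n)
  case 0
  have "tuples E 0 = {[]}" by (auto simp: tuples_def)
  then show ?case by simp
next
  case (Suc n)
  have "(\<Sum>b\<in>tuples E (Suc n). \<Prod>y\<leftarrow>b. f y) = (\<Sum>(x, xs)\<in>E \<times> tuples E n. f x * (\<Prod>y\<leftarrow>xs. f y))"
    unfolding tuples_Suc by (subst sum.reindex) (auto simp: inj_on_def case_prod_unfold)
  also have "\<dots> = (\<Sum>e\<in>E. f e) * (\<Sum>b\<in>tuples E n. \<Prod>y\<leftarrow>b. f y)"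
    by (simp add: sum_product sum.cartesian_product)
  finally show ?case by (simp add: Suc)
qed

lemma prod_list_power2_cmod: "(cmod (\<Prod>y\<leftarrow>b. f y))\<^sup>2 = (\<Prod>y\<leftarrow>b. (cmod (f y))\<^sup>2)"
  by (induction b) (simp_all add: norm_mult power_mult_distrib)

text \<open>The mean of a Poisson law up to normalization. For \<open>z = ip H \<phi> \<phi>\<close>
  the terms z^n / n! are the squared norms of the components of e(\<phi>), so this evaluates the
  expectation of the particle number.\<close>

lemma sums_nat_times_exp:
  fixes z :: complex
  shows "(\<lambda>n. of_nat n * (z ^ n / fact n)) sums (z * exp z)"
proof -
  have "(\<lambda>n. z * (z ^ n / fact n)) sums (z * exp z)"
    using exp_converges [of z] by (intro sums_mult) (simp add: divide_inverse scaleR_conv_of_real mult.commute)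
  also have "(\<lambda>n. z * (z ^ n / fact n)) = (\<lambda>n. of_nat (Suc n) * (z ^ Suc n / fact (Suc n)))"
    by (simp add: fun_eq_iff divide_simps del: of_nat_Suc)
  finally show ?thesis
    using sums_Suc_iff [of "\<lambda>n. of_nat n * (z ^ n / fact n)"] by simp
qed

lemma tendsto_difference_quotient_exp:
  "((\<lambda>r. (1 / (\<i> * complex_of_real r)) * (exp (\<i> * complex_of_real r * complex_of_real a) - 1)) \<longlongrightarrow> complex_of_real a) (at 0)"
proof -
  have "((\<lambda>h. exp (h * (\<i> * complex_of_real a))) has_field_derivative exp (0 * (\<i> * complex_of_real a)) * (\<i> * complex_of_real a)) (at 0)"
    by (rule derivative_eq_intros refl | simp)+
  then have "((\<lambda>h. (exp (h * (\<i> * complex_of_real a)) - 1) / h) \<longlongrightarrow> \<i> * complex_of_real a) (at 0)"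
    by (simp add: DERIV_def)
  moreover have "filterlim complex_of_real (at 0) (at 0)"
    by (intro filterlim_atI) (auto intro!: tendsto_eq_intros simp: eventually_at_filter)
  ultimately have "((\<lambda>r. (exp (complex_of_real r * (\<i> * complex_of_real a)) - 1) / complex_of_real r) \<longlongrightarrow> \<i> * complex_of_real a) (at 0)"
    by (rule filterlim_compose)
  then have "((\<lambda>r. (1 / \<i>) * ((exp (complex_of_real r * (\<i> * complex_of_real a)) - 1) / complex_of_real r)) \<longlongrightarrow> (1 / \<i>) * (\<i> * complex_of_real a)) (at 0)"
    by (intro tendsto_intros)
  then have "((\<lambda>r. (1 / \<i>) * ((exp (complex_of_real r * (\<i> * complex_of_real a)) - 1) / complex_of_real r)) \<longlongrightarrow> complex_of_real a) (at 0)"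
    by (simp only: mult.assoc [symmetric] nonzero_divide_eq_eq [symmetric]) simp
  then show ?thesis
    by (simp only: times_divide_times_eq times_divide_eq_left divide_divide_eq_left mult_1_left mult_ac)
qed

text \<open>From \<bar>e^(ix) - 1\<bar> \<le> \<bar>x\<bar>. With \<open>a\<close> proportional to
  the particle number it gives a domination that is linear in that number and uniform in
  \<open>r\<close>; at \<open>r = 0\<close> the quotient is 0 by convention.\<close>

lemma norm_difference_quotient_exp_le:
  "cmod ((1 / (\<i> * complex_of_real r)) * (exp (\<i> * complex_of_real r * complex_of_real a) - 1)) \<le> \<bar>a\<bar>"
proof (cases "r = 0")
  case False
  have "cmod (exp (\<i> * complex_of_real r * complex_of_real a) - 1) \<le> \<bar>r * a\<bar>"
    using dist_exp_i_1 [of "r * a"] abs_sin_x_le_abs_x [of "r * a / 2"] by (simp add: mult.assoc)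
  then show ?thesis
    using False by (simp add: norm_mult norm_divide abs_mult divide_simps mult.commute)
qed simp

context inner_space
begin

lemma tensor_pow_update:
  assumes "xs \<in> tuples (carrier H) n" "i < n" "a \<in> carrier H"
  shows "tensor_pow H n x (xs[i := a]) = (\<Prod>y\<leftarrow>take i xs. ip H x y) * ip H x a * (\<Prod>y\<leftarrow>drop (Suc i) xs. ip H x y)"
proof -
  have "xs[i := a] \<in> tuples (carrier H) n"
    using assms set_update_subset_insert [of xs i a] by (auto simp: tuples_def)
  then have "tensor_pow H n x (xs[i := a]) = (\<Prod>y\<leftarrow>xs[i := a]. ip H x y)"
    by (simp add: tensor_pow_def)
  then show ?thesis
    using assms by (simp add: tuples_def upd_conv_take_nth_drop mult.assoc)
qed

text \<open>The sum over tuples factorizes into the n-th power of the sum of \<bar>\<langle>x,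
  e\<rangle>\<bar>^2 over \<open>E\<close>. Bessel's inequality bounds it, and the system consisting
  of the normalized \<open>x\<close> attains the bound.\<close>

lemma hs_norm2_tensor_pow:
  assumes x: "x \<in> carrier H"
  shows "bdd_above (hs_sums H n (tensor_pow H n x))" "hs_norm2 H n (tensor_pow H n x) = Re (ip H x x) ^ n"
proof -
  have sum: "(\<Sum>b\<in>tuples E n. (cmod (tensor_pow H n x b))\<^sup>2) = (\<Sum>e\<in>E. (cmod (ip H x e))\<^sup>2) ^ n"
    if "orthonormal H E" for E
  proof -
    have "(\<Sum>b\<in>tuples E n. (cmod (tensor_pow H n x b))\<^sup>2) = (\<Sum>b\<in>tuples E n. \<Prod>y\<leftarrow>b. (cmod (ip H x y))\<^sup>2)"
      using that by (intro sum.cong refl) (auto simp: tensor_pow_def prod_list_power2_cmod orthonormal_def tuples_def)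
    then show ?thesis by (simp add: sum_tuples_prod_list)
  qed
  have le: "(\<Sum>b\<in>tuples E n. (cmod (tensor_pow H n x b))\<^sup>2) \<le> Re (ip H x x) ^ n"
    if "finite E" "orthonormal H E" for E
    unfolding sum [OF that(2)] using bessel_inequality [OF that x] by (intro power_mono sum_nonneg) auto
  show bdd: "bdd_above (hs_sums H n (tensor_pow H n x))"
    by (rule hs_norm2_le; erule (1) le)
  show "hs_norm2 H n (tensor_pow H n x) = Re (ip H x x) ^ n"
  proof (rule antisym)
    show "hs_norm2 H n (tensor_pow H n x) \<le> Re (ip H x x) ^ n"
      by (rule hs_norm2_le; erule (1) le)
    show "Re (ip H x x) ^ n \<le> hs_norm2 H n (tensor_pow H n x)"
    proof (cases "Re (ip H x x) = 0")
      \<comment> \<open>No vector can be normalized here; the empty system gives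
        \<open>0 ^ n\<close>, the correct value also for \<open>n = 0\<close>.\<close>
      case True
      then show ?thesis
        using hs_norm2_ge [OF bdd, of "{}"] sum [of "{}"] by (simp add: orthonormal_def)
    next
      case False
      define s where "s = sqrt (Re (ip H x x))"
      have s: "s > 0" "s\<^sup>2 = Re (ip H x x)" using False ip_nonneg [OF x] by (auto simp: s_def)
      define e where "e = complex_of_real (1 / s) \<odot> x"
      have ee: "ip H e e = 1" "ip H x e = complex_of_real s"
        using x s ip_self [OF x] by (simp_all add: e_def ip_simps power2_eq_square flip: s(2))
      have "orthonormal H {e}" using x ee by (simp add: orthonormal_def e_def)
      from hs_norm2_ge [OF bdd _ this] sum [OF this] show ?thesis
        using ee s by simp
    qed
  qed
qed

lemma tensor_pow_closed:
  assumes x: "x \<in> carrier H"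
  shows "tensor_pow H n x \<in> carrier (sym_power H n)"
  unfolding sym_power_carrier
proof (intro conjI allI impI)
  show "conj_multilinear H n (tensor_pow H n x)"
  proof (rule conj_multilinearI)
    show "tensor_pow H n x xs = 0" if "xs \<notin> tuples (carrier H) n" for xs
      using that by (simp add: tensor_pow_def)
  qed (use x in \<open>simp_all add: tensor_pow_update ip_simps distrib_left distrib_right\<close>)
  show "bdd_above (hs_sums H n (tensor_pow H n x))" by (rule hs_norm2_tensor_pow [OF x])
  fix xs ys :: "'a list" assume m: "mset xs = mset ys"
  then have "xs \<in> tuples (carrier H) n \<longleftrightarrow> ys \<in> tuples (carrier H) n"
    unfolding tuples_def using mset_eq_setD [OF m] mset_eq_length [OF m] by simp
  moreover have "(\<Prod>y\<leftarrow>xs. ip H x y) = (\<Prod>y\<leftarrow>ys. ip H x y)"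
    using m by (metis mset_map prod_mset_prod_list)
  ultimately show "tensor_pow H n x xs = tensor_pow H n x ys"
    by (simp add: tensor_pow_def)
qed

lemma exp_vec_closed_sym:
  assumes "x \<in> carrier H"
  shows "exp_vec H x n \<in> carrier (sym_power H n)" "hs_norm2 H n (exp_vec H x n) = Re (ip H x x) ^ n / fact n"
proof -
  note T = tensor_pow_closed [OF assms, of n]
  show "exp_vec H x n \<in> carrier (sym_power H n)"
    unfolding exp_vec_def sym_power_simps by (rule sym_power_smult_closed [OF T])
  show "hs_norm2 H n (exp_vec H x n) = Re (ip H x x) ^ n / fact n"
    unfolding exp_vec_def sym_power_simps hs_norm2_smult(2) [OF sym_powerD(2) [OF T]] hs_norm2_tensor_pow(2) [OF assms]
    by (simp add: norm_divide power_divide)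
qed

text \<open>Differentiating in \<open>r\<close> produces weights of linear growth in the particle
  number. By \<open>n \<le> 2 ^ n\<close> a squared weight costs at most a constant times
  \<open>4 ^ n\<close>, which the factorial absorbs.\<close>

lemma weighted_exp_vec_closed:
  assumes x: "x \<in> carrier H" and w: "\<And>n. cmod (w n) \<le> C * real n + D"
  shows "(\<lambda>n xs. w n * exp_vec H x n xs) \<in> carrier (fock H)"
    "hs_norm2 H n (\<lambda>xs. w n * exp_vec H x n xs) = (cmod (w n))\<^sup>2 * (Re (ip H x x) ^ n / fact n)"
    "summable (\<lambda>n. (C * real n + D)\<^sup>2 * (Re (ip H x x) ^ n / fact n))"
proof -
  show hs: "hs_norm2 H n (\<lambda>xs. w n * exp_vec H x n xs) = (cmod (w n))\<^sup>2 * (Re (ip H x x) ^ n / fact n)" for n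
    by (simp add: hs_norm2_smult(2) [OF sym_powerD(2) [OF exp_vec_closed_sym(1) [OF x]]] exp_vec_closed_sym(2) [OF x])
  let ?z = "Re (ip H x x)"
  have z: "?z \<ge> 0" by (rule ip_nonneg [OF x])
  have le: "(C * real n + D)\<^sup>2 * (?z ^ n / fact n) \<le> (\<bar>C\<bar> + \<bar>D\<bar>)\<^sup>2 * ((4 * ?z) ^ n / fact n)" for n
  proof -
    have n: "real n \<le> 2 ^ n" by (simp add: less_exp order_less_imp_le of_nat_less_two_power)
    have "\<bar>C * real n + D\<bar> \<le> \<bar>C\<bar> * real n + \<bar>D\<bar> * 1"
      by (rule order_trans [OF abs_triangle_ineq]) (simp add: abs_mult)
    also have "\<dots> \<le> \<bar>C\<bar> * 2 ^ n + \<bar>D\<bar> * 2 ^ n"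
      using n by (intro add_mono mult_left_mono) auto
    finally have "\<bar>C * real n + D\<bar> \<le> (\<bar>C\<bar> + \<bar>D\<bar>) * 2 ^ n" by (simp add: distrib_right)
    then have "\<bar>C * real n + D\<bar>\<^sup>2 \<le> ((\<bar>C\<bar> + \<bar>D\<bar>) * 2 ^ n)\<^sup>2" by (intro power_mono) auto
    also have "\<dots> = (\<bar>C\<bar> + \<bar>D\<bar>)\<^sup>2 * 4 ^ n"
    proof -
      have "(2 ^ n)\<^sup>2 = (4::real) ^ n" by (simp add: power2_eq_square flip: power_mult_distrib)
      then show ?thesis by (simp add: power_mult_distrib)
    qed
    finally have "(C * real n + D)\<^sup>2 * (?z ^ n / fact n) \<le> (\<bar>C\<bar> + \<bar>D\<bar>)\<^sup>2 * 4 ^ n * (?z ^ n / fact n)"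
      using z by (intro mult_right_mono) auto
    then show ?thesis by (simp add: power_mult_distrib mult_ac)
  qed
  have summ: "summable (\<lambda>n. (\<bar>C\<bar> + \<bar>D\<bar>)\<^sup>2 * ((4 * ?z) ^ n / fact n))"
    using summable_exp [of "4 * ?z"] by (intro summable_mult) (simp add: divide_inverse mult.commute)
  show "summable (\<lambda>n. (C * real n + D)\<^sup>2 * (?z ^ n / fact n))"
    by (rule summable_comparison_test' [OF summ, of 0]) (use le z in auto)
  then have "summable (\<lambda>n. hs_norm2 H n (\<lambda>xs. w n * exp_vec H x n xs))"
    unfolding hs
    by (rule summable_comparison_test' [of _ 0]) (use z w in \<open>auto intro!: mult_right_mono power_mono divide_right_mono\<close>)
  then show "(\<lambda>n xs. w n * exp_vec H x n xs) \<in> carrier (fock H)"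
    unfolding fock_carrier using sym_power_smult_closed [OF exp_vec_closed_sym(1) [OF x]] by simp
qed

lemma exp_vec_smult:
  assumes "x \<in> carrier H"
  shows "exp_vec H (w \<odot> x) n xs = w ^ n * exp_vec H x n xs"
proof -
  have "(\<Prod>y\<leftarrow>xs. ip H (w \<odot> x) y) = w ^ length xs * (\<Prod>y\<leftarrow>xs. ip H x y)" if "set xs \<subseteq> carrier H" for xs
    using that by (induction xs) (use assms in \<open>auto simp: ip_simps\<close>)
  then show ?thesis by (auto simp: exp_vec_def tensor_pow_def tuples_def)
qed

lemma ip_weighted_exp_vec:
  assumes x: "x \<in> carrier H"
  shows "ip (sym_power H n) (\<lambda>xs. c * exp_vec H x n xs) (exp_vec H x n) = c * (ip H x x ^ n / fact n)"
proof -
  have "ip (sym_power H n) (\<lambda>xs. c * exp_vec H x n xs) (\<lambda>xs. 1 * exp_vec H x n xs) = c * cnj 1 * complex_of_real (hs_norm2 H n (exp_vec H x n))"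
    by (rule ip_sym_power_smult [OF sym_powerD(2) [OF exp_vec_closed_sym(1) [OF x]]])
  also have "complex_of_real (hs_norm2 H n (exp_vec H x n)) = ip H x x ^ n / fact n"
    using ip_self [OF x] by (simp add: exp_vec_closed_sym(2) [OF x])
  finally show ?thesis by simp
qed

end

context projection_space
begin

lemma fock_op_exp_vec:
  assumes x: "x \<in> carrier H"
  shows "fock_op w (exp_vec H x) = exp_vec H (scale_range w x)"
proof (intro ext)
  fix n xs
  have "(\<Prod>y\<leftarrow>map (scale_range (cnj w)) xs. ip H x y) = (\<Prod>y\<leftarrow>xs. ip H (scale_range w x) y)"
    if "set xs \<subseteq> carrier H"
    using that by (induction xs) (use x in \<open>auto simp: ip_scale_range\<close>)
  then have "tensor_op n w (tensor_pow H n x) xs = tensor_pow H n (scale_range w x) xs"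
    using map_scale_range_tuples [of xs n "cnj w"] by (auto simp: tensor_op_def tensor_pow_def tuples_def)
  then show "fock_op w (exp_vec H x) n xs = exp_vec H (scale_range w x) n xs"
    by (auto simp: fock_op_def exp_vec_def tensor_op_def split: if_splits)
qed

text \<open>For \<phi> in the range of \<open>P\<close> the orbit is e(e^(irc) \<phi>): its
  n-particle component is multiplied by e^(ircn), with derivative c n after division by the
  imaginary unit. The chosen group is known only through \<open>good\<close>, but that property
  fixes this orbit.\<close>

lemma Lambda_sa_exp_vec:
  assumes A: "\<And>x. x \<in> carrier H \<Longrightarrow> A x = complex_of_real c \<odot> P x"
    and \<phi>: "\<phi> \<in> carrier H" "P \<phi> = \<phi>"
  shows "Lambda_sa H A (exp_vec H \<phi>) = Some (\<lambda>n xs. complex_of_real (c * real n) * exp_vec H \<phi> n xs)"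
proof -
  let ?w = "\<lambda>r. exp (\<i> * complex_of_real r * complex_of_real c)"
  define good where "good = (\<lambda>U. unitary_one_param_group (fock H) U \<and> (\<forall>r. \<forall>x\<in>carrier H.
     U r (exp_vec H x) = exp_vec H (op_exp H (op_scale H (\<i> * complex_of_real r) A) x)))"
  have op_exp: "op_exp H (op_scale H (\<i> * complex_of_real r) A) x = scale_range (?w r) x" if "x \<in> carrier H" for r x
    by (rule op_exp_scaled_projection [OF _ that]) (simp add: op_scale_def A smult_smult)
  define U where "U = (SOME U. good U)"
  \<comment> \<open>The choice is meaningful only if some group qualifies; this is where unitarity
    and strong continuity of \<open>fock_op\<close> enter.\<close>
  have "good (\<lambda>r. fock_op (?w r))"
    using unitary_one_param_group_fock_op by (simp add: good_def op_exp fock_op_exp_vec)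
  then have "good U" unfolding U_def by (rule someI [of good])
  let ?e = "exp_vec H \<phi>"
  let ?lim = "hlim (fock H) (\<lambda>r. (1 / (\<i> * complex_of_real r)) \<odot>\<^bsub>fock H\<^esub> hdiff (fock H) (U r ?e) ?e)"
  let ?y = "\<lambda>n xs. complex_of_real (c * real n) * ?e n xs"
  have "scale_range w \<phi> = w \<odot> \<phi>" for w
    by (rule ip_eqI) (use \<phi> in \<open>simp_all add: scale_range_def ip_simps algebra_simps\<close>)
  then have U_e: "U r ?e = (\<lambda>n xs. ?w r ^ n * ?e n xs)" for r
    using \<open>good U\<close> \<phi>(1) by (simp add: good_def op_exp exp_vec_smult fun_eq_iff)
  let ?d = "\<lambda>r n. (1 / (\<i> * complex_of_real r)) * (exp (\<i> * complex_of_real r * complex_of_real (c * real n)) - 1)"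
  have quotient: "(1 / (\<i> * complex_of_real r)) \<odot>\<^bsub>fock H\<^esub> hdiff (fock H) (U r ?e) ?e = (\<lambda>n xs. ?d r n * ?e n xs)" for r
  proof -
    have "?w r ^ n = exp (\<i> * complex_of_real r * complex_of_real (c * real n))" for n
      by (simp add: exp_of_nat_mult [symmetric] mult_ac)
    then show ?thesis by (simp add: U_e fun_eq_iff algebra_simps)
  qed
  have e: "?e \<in> carrier (fock H)"
    using weighted_exp_vec_closed(1) [OF \<phi>(1), of "\<lambda>_. 1" 0 1] by simp
  have d_bound: "cmod (?d r n) \<le> \<bar>c\<bar> * real n + 0" for r n
    using norm_difference_quotient_exp_le [of r "c * real n"] by (simp add: abs_mult)
  have d_closed: "(\<lambda>n xs. ?d r n * ?e n xs) \<in> carrier (fock H)" for r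
    by (rule weighted_exp_vec_closed(1) [OF \<phi>(1) d_bound])
  have y_closed: "?y \<in> carrier (fock H)"
    by (rule weighted_exp_vec_closed(1) [OF \<phi>(1), of _ "\<bar>c\<bar>" 0]) (simp add: norm_mult)
  have diff_bound: "cmod (?d r n - complex_of_real (c * real n)) \<le> 2 * \<bar>c\<bar> * real n + 0" for r n
    using norm_triangle_ineq4 [of "?d r n" "complex_of_real (c * real n)"] d_bound [of r n]
    by (simp add: norm_mult)
  note diff = weighted_exp_vec_closed [OF \<phi>(1) diff_bound]
  let ?z = "Re (ip H \<phi> \<phi>)"
  let ?D = "\<lambda>r n. (cmod (?d r n - complex_of_real (c * real n)))\<^sup>2 * (?z ^ n / fact n)"
  have z: "0 \<le> ?z" by (rule ip_nonneg [OF \<phi>(1)])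
  \<comment> \<open>Convergence in each component does not suffice, since the generator requires
    convergence in the Fock norm. The linear bound on the quotients gives a summable majorant of the
    squared errors.\<close>
  have "((\<lambda>r. \<Sum>n. ?D r n) \<longlongrightarrow> (\<Sum>n. 0)) (at 0)"
  proof (rule tannerys_theorem [THEN conjunct2, THEN conjunct2])
    fix n
    have "((\<lambda>r. ?D r n) \<longlongrightarrow>
        (cmod (complex_of_real (c * real n) - complex_of_real (c * real n)))\<^sup>2 * (?z ^ n / fact n)) (at 0)"
      by (intro tendsto_mult tendsto_power tendsto_norm tendsto_diff tendsto_const tendsto_difference_quotient_exp)
    then show "((\<lambda>r. ?D r n) \<longlongrightarrow> 0) (at 0)"
      by simp
  next
    have "norm (?D r n)
        \<le> (2 * \<bar>c\<bar> * real n + 0)\<^sup>2 * (?z ^ n / fact n)" for r n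
    proof -
      have "?D r n
        \<le> (2 * \<bar>c\<bar> * real n + 0)\<^sup>2 * (?z ^ n / fact n)"
        using z by (intro mult_right_mono power_mono diff_bound) auto
      then show ?thesis using z by (simp only: real_norm_def abs_of_nonneg divide_nonneg_nonneg zero_le_power mult_nonneg_nonneg zero_le_power2 fact_ge_zero)
    qed
    then show "\<forall>\<^sub>F (n, r) in sequentially \<times>\<^sub>F at 0. norm (?D r n)
        \<le> (2 * \<bar>c\<bar> * real n + 0)\<^sup>2 * (?z ^ n / fact n)"
      by (simp only: case_prod_unfold eventually_True)
    show "summable (\<lambda>n. (2 * \<bar>c\<bar> * real n + 0)\<^sup>2 * (?z ^ n / fact n))"
      by (rule diff(3))
  qed simp
  note sqrt_lim = tendsto_real_sqrt [OF this]
  have norm_diff: "hnorm (fock H) (hdiff (fock H) (\<lambda>n xs. ?d r n * ?e n xs) ?y) =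
      sqrt (\<Sum>n. ?D r n)" for r
  proof -
    have "hdiff (fock H) (\<lambda>n xs. ?d r n * ?e n xs) ?y = (\<lambda>n xs. (?d r n - complex_of_real (c * real n)) * ?e n xs)"
      by (simp only: fock_simps left_diff_distrib)
    moreover have "hs_norm2 H n (\<lambda>xs. (?d r n - complex_of_real (c * real n)) * ?e n xs) =
        ?D r n" for n
      by (rule weighted_exp_vec_closed(2) [where w = "\<lambda>n. ?d r n - complex_of_real (c * real n)", OF \<phi>(1) diff_bound])
    ultimately show ?thesis by (simp only: hnorm_fock(1) [OF diff(1)])
  qed
  from sqrt_lim have lim: "?lim ?y (at 0)"
    unfolding hlim_def quotient norm_diff by simp
  have the: "(THE y. y \<in> carrier (fock H) \<and>
      ?lim y (at 0)) = ?y"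
  proof (rule the_equality)
    fix y assume y: "y \<in> carrier (fock H) \<and>
      ?lim y (at 0)"
    show "y = ?y"
      by (rule hlim_fock_unique [OF _ _ _ y_closed y [THEN conjunct2] lim])
        (use y d_closed in \<open>simp_all only: quotient at_neq_bot not_False_eq_True\<close>)
  qed (use y_closed lim in blast)
  have "Lambda_sa H A ?e = generator (fock H) U ?e"
    by (simp only: Lambda_sa_def U_def good_def)
  also have "\<dots> = Some ?y"
    unfolding generator_def Let_def the using e y_closed lim by auto
  finally show ?thesis .
qed

text \<open>For real \<open>c\<close> the operator agrees with its adjoint on the carrier, so its
  Hermitian part is again \<open>c\<close> times \<open>P\<close> and the other part is 0 times
  \<open>P\<close>. Treating the latter as a scaled projection too shows that e(\<phi>) lies in the
  domain of its generator, with value 0.\<close>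

lemma expect_Lambda_scaled_projection:
  assumes A: "\<And>x. x \<in> carrier H \<Longrightarrow> A x = complex_of_real c \<odot> P x"
    and \<phi>: "\<phi> \<in> carrier H" "P \<phi> = \<phi>"
  shows "expect H (Lambda H A) \<phi> = complex_of_real c * ip H \<phi> \<phi>"
proof -
  have adj: "hadjoint H A x = complex_of_real c \<odot> P x" if "x \<in> carrier H" for x
    by (rule hadjoint_eqI) (use that in \<open>simp_all add: A ip_simps P_self_adjoint\<close>)
  have re: "op_scale H (1 / 2) (op_add H A (hadjoint H A)) x = complex_of_real c \<odot> P x" if "x \<in> carrier H" for x
    by (rule ip_eqI) (use that in \<open>simp_all add: op_scale_def op_add_def A adj ip_simps\<close>)
  have im: "op_scale H (1 / (2 * \<i>)) (op_add H A (op_scale H (-1) (hadjoint H A))) x = complex_of_real 0 \<odot> P x" if "x \<in> carrier H" for x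
    by (rule ip_eqI) (use that in \<open>simp_all add: op_scale_def op_add_def A adj ip_simps\<close>)
  have L_re: "Lambda_sa H (op_scale H (1 / 2) (op_add H A (hadjoint H A))) (exp_vec H \<phi>) =
      Some (\<lambda>n xs. complex_of_real (c * real n) * exp_vec H \<phi> n xs)"
    by (rule Lambda_sa_exp_vec [OF _ \<phi>]) (erule re)
  have L_im: "Lambda_sa H (op_scale H (1 / (2 * \<i>)) (op_add H A (op_scale H (-1) (hadjoint H A)))) (exp_vec H \<phi>) =
      Some (\<lambda>n xs. complex_of_real (0 * real n) * exp_vec H \<phi> n xs)"
    by (rule Lambda_sa_exp_vec [OF _ \<phi>]) (erule im)
  let ?z = "ip H \<phi> \<phi>"
  have "Lambda H A (exp_vec H \<phi>) = Some (\<lambda>n xs. complex_of_real (c * real n) * exp_vec H \<phi> n xs)"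
    unfolding Lambda_def pop_add_def pop_scale_def L_re L_im by simp
  then have "expect H (Lambda H A) \<phi> =
      (\<Sum>n. ip (sym_power H n) (\<lambda>xs. complex_of_real (c * real n) * exp_vec H \<phi> n xs) (exp_vec H \<phi> n)) /
      (\<Sum>n. ip (sym_power H n) (\<lambda>xs. 1 * exp_vec H \<phi> n xs) (exp_vec H \<phi> n))"
    by (simp add: expect_def)
  also have "\<dots> = (\<Sum>n. complex_of_real c * (of_nat n * (?z ^ n / fact n))) / (\<Sum>n. ?z ^ n / fact n)"
    unfolding ip_weighted_exp_vec [OF \<phi>(1)] by (simp add: mult.assoc)
  also have "(\<Sum>n. complex_of_real c * (of_nat n * (?z ^ n / fact n))) = complex_of_real c * (?z * exp ?z)"
    by (intro sums_unique [symmetric] sums_mult sums_nat_times_exp)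
  also have "(\<Sum>n. ?z ^ n / fact n) = exp ?z"
    using sums_unique [OF exp_converges [of ?z]] by (simp add: divide_inverse scaleR_conv_of_real mult.commute)
  finally show ?thesis by simp
qed

end

section \<open>Square-integrable functions\<close>

text \<open>\<open>\<bullet>c\<close> sums up to the dimension of an argument. With the range fixed
  to \<open>d\<close>, the integrand is visibly a finite sum of component functions, to which
  measurability and integrability apply.\<close>

definition L2_dot :: "nat \<Rightarrow> complex vec \<Rightarrow> complex vec \<Rightarrow> complex" where
  "L2_dot d v w = (\<Sum>i<d. vec_index v i * cnj (vec_index w i))"

lemma cscalar_prod_eq_L2_dot:
  assumes "v \<in> carrier_vec d" "w \<in> carrier_vec d"
  shows "v \<bullet>c w = L2_dot d v w"
  using assms by (auto simp: scalar_prod_def L2_dot_def lessThan_atLeast0)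

lemma L2_funD:
  assumes "f \<in> L2_fun d"
  shows "f s \<in> carrier_vec d" "dim_vec (f s) = d"
    and "i < d \<Longrightarrow> (\<lambda>s. vec_index (f s) i) \<in> borel_measurable half_line"
    and "i < d \<Longrightarrow> integrable half_line (\<lambda>s. (cmod (vec_index (f s) i))\<^sup>2)"
  using assms by (auto simp: L2_fun_def carrier_vecD)

lemma integrable_mult_cnj:
  fixes f g :: "'b \<Rightarrow> complex"
  assumes "f \<in> borel_measurable M" "g \<in> borel_measurable M"
    and "integrable M (\<lambda>s. (cmod (f s))\<^sup>2)" "integrable M (\<lambda>s. (cmod (g s))\<^sup>2)"
  shows "integrable M (\<lambda>s. f s * cnj (g s))"
proof (rule Bochner_Integration.integrable_bound)
  show "integrable M (\<lambda>s. (cmod (f s))\<^sup>2 + (cmod (g s))\<^sup>2)" using assms by auto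
  show "AE s in M. norm (f s * cnj (g s)) \<le> norm ((cmod (f s))\<^sup>2 + (cmod (g s))\<^sup>2)"
  proof (rule AE_I2)
    fix s
    have "2 * cmod (f s) * cmod (g s) \<le> (cmod (f s))\<^sup>2 + (cmod (g s))\<^sup>2"
      by (rule sum_squares_bound)
    moreover have "0 \<le> cmod (f s) * cmod (g s)" by simp
    ultimately have "cmod (f s) * cmod (g s) \<le> (cmod (f s))\<^sup>2 + (cmod (g s))\<^sup>2" by linarith
    then show "norm (f s * cnj (g s)) \<le> norm ((cmod (f s))\<^sup>2 + (cmod (g s))\<^sup>2)"
      by (simp add: norm_mult)
  qed
next
  have "cnj \<in> borel_measurable borel"
    by (intro borel_measurable_continuous_onI continuous_intros)
  then show "(\<lambda>s. f s * cnj (g s)) \<in> borel_measurable M"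
    using assms(1,2) by measurable
qed

lemma L2_fun_add:
  assumes "f \<in> L2_fun d" "g \<in> L2_fun d"
  shows "(\<lambda>s. f s + g s) \<in> L2_fun d"
  unfolding L2_fun_def
proof (intro CollectI conjI allI impI)
  note f = L2_funD [OF assms(1)] and g = L2_funD [OF assms(2)]
  show "f s + g s \<in> carrier_vec d" for s by (rule add_carrier_vec [OF f(1) g(1)])
  fix i assume i: "i < d"
  have eq: "vec_index (f s + g s) i = vec_index (f s) i + vec_index (g s) i" for s
    using i g(2) by simp
  show meas: "(\<lambda>s. vec_index (f s + g s) i) \<in> borel_measurable half_line"
    unfolding eq using f(3) [OF i] g(3) [OF i] by measurable
  show "integrable half_line (\<lambda>s. (cmod (vec_index (f s + g s) i))\<^sup>2)"
  proof (rule Bochner_Integration.integrable_bound)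
    show "integrable half_line (\<lambda>s. 2 * (cmod (vec_index (f s) i))\<^sup>2 + 2 * (cmod (vec_index (g s) i))\<^sup>2)"
      using f(4) [OF i] g(4) [OF i] by auto
    show "AE s in half_line. norm ((cmod (vec_index (f s + g s) i))\<^sup>2)
        \<le> norm (2 * (cmod (vec_index (f s) i))\<^sup>2 + 2 * (cmod (vec_index (g s) i))\<^sup>2)"
    proof (rule AE_I2)
      fix s
      have "(cmod (a + b))\<^sup>2 \<le> 2 * (cmod a)\<^sup>2 + 2 * (cmod b)\<^sup>2" for a b
        using sum_squares_bound [of "cmod a" "cmod b"]
          power_mono [OF norm_triangle_ineq [of a b] norm_ge_zero, of 2]
        by (simp add: power2_sum)
      then show "norm ((cmod (vec_index (f s + g s) i))\<^sup>2)
        \<le> norm (2 * (cmod (vec_index (f s) i))\<^sup>2 + 2 * (cmod (vec_index (g s) i))\<^sup>2)"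
        unfolding eq by simp
    qed
    show "(\<lambda>s. (cmod (vec_index (f s + g s) i))\<^sup>2) \<in> borel_measurable half_line"
      using meas by measurable
  qed
qed

lemma L2_fun_smult:
  assumes "f \<in> L2_fun d"
  shows "(\<lambda>s. c \<cdot>\<^sub>v f s) \<in> L2_fun d"
  unfolding L2_fun_def
proof (intro CollectI conjI allI impI)
  note f = L2_funD [OF assms]
  show "c \<cdot>\<^sub>v f s \<in> carrier_vec d" for s by (rule smult_carrier_vec [THEN iffD2, OF f(1)])
  fix i assume i: "i < d"
  have eq: "vec_index (c \<cdot>\<^sub>v f s) i = c * vec_index (f s) i" for s
    using i f(2) by simp
  show "(\<lambda>s. vec_index (c \<cdot>\<^sub>v f s) i) \<in> borel_measurable half_line"
    unfolding eq using f(3) [OF i] by measurable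
  show "integrable half_line (\<lambda>s. (cmod (vec_index (c \<cdot>\<^sub>v f s) i))\<^sup>2)"
    unfolding eq norm_mult power_mult_distrib using f(4) [OF i] by simp
qed

lemma L2_fun_zero: "(\<lambda>s. 0\<^sub>v d) \<in> L2_fun d"
  by (simp add: L2_fun_def)

lemma sets_half_line: "{0..t} \<in> sets half_line" "{0..<t} \<in> sets half_line"
proof -
  have "{0..} \<inter> {0..t} \<in> sets half_line" "{0..} \<inter> {0..<t} \<in> sets half_line"
    unfolding sets_restrict_space by (intro imageI; simp)+
  moreover have "{0..} \<inter> {0..t} = {0..t}" "{0..} \<inter> {0..<t} = {0..<t}" by auto
  ultimately show "{0..t} \<in> sets half_line" "{0..<t} \<in> sets half_line" by simp_all
qed

lemma L2_fun_cutoff: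
  assumes "f \<in> L2_fun d"
  shows "(\<lambda>s. if s \<in> {0..t} then f s else 0\<^sub>v d) \<in> L2_fun d"
  unfolding L2_fun_def
proof (intro CollectI conjI allI impI)
  note f = L2_funD [OF assms]
  show "(if s \<in> {0..t} then f s else 0\<^sub>v d) \<in> carrier_vec d" for s using f(1) by simp
  fix i assume i: "i < d"
  have eq: "vec_index (if s \<in> {0..t} then f s else 0\<^sub>v d) i = indicator {0..t} s *\<^sub>R vec_index (f s) i" for s
    using i by (simp add: indicator_def)
  show meas: "(\<lambda>s. vec_index (if s \<in> {0..t} then f s else 0\<^sub>v d) i) \<in> borel_measurable half_line"
    unfolding eq using f(3) [OF i] sets_half_line(1) by measurable
  show "integrable half_line (\<lambda>s. (cmod (vec_index (if s \<in> {0..t} then f s else 0\<^sub>v d) i))\<^sup>2)"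
    by (rule Bochner_Integration.integrable_bound [OF f(4) [OF i]]) (use meas i in auto)
qed

lemma L2_fun_step:
  assumes "\<psi> \<in> carrier_vec d"
  shows "(\<lambda>s. if s \<in> {0..<t} then \<psi> else 0\<^sub>v d) \<in> L2_fun d"
  unfolding L2_fun_def
proof (intro CollectI conjI allI impI)
  show "(if s \<in> {0..<t} then \<psi> else 0\<^sub>v d) \<in> carrier_vec d" for s using assms by simp
  fix i assume i: "i < d"
  have eq: "vec_index (if s \<in> {0..<t} then \<psi> else 0\<^sub>v d) i = indicator {0..<t} s *\<^sub>R vec_index \<psi> i" for s
    using i by (simp add: indicator_def)
  show "(\<lambda>s. vec_index (if s \<in> {0..<t} then \<psi> else 0\<^sub>v d) i) \<in> borel_measurable half_line"
    unfolding eq using sets_half_line(2) by measurable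
  have eq': "(cmod (vec_index (if s \<in> {0..<t} then \<psi> else 0\<^sub>v d) i))\<^sup>2 = indicator {0..<t} s * (cmod (vec_index \<psi> i))\<^sup>2" for s
    unfolding eq by (simp add: indicator_def)
  have "emeasure half_line {0..<t} = emeasure lebesgue {0..<t}"
    by (rule emeasure_restrict_space) auto
  then have "emeasure half_line {0..<t} \<noteq> \<infinity>"
    by (cases "0 \<le> t") auto
  then have "integrable half_line (indicator {0..<t} :: real \<Rightarrow> real)"
    using sets_half_line(2) by (simp add: less_top)
  then show "integrable half_line (\<lambda>s. (cmod (vec_index (if s \<in> {0..<t} then \<psi> else 0\<^sub>v d) i))\<^sup>2)"
    unfolding eq' by (rule integrable_mult_left) 
qed

lemma L2_class_eqI:
  assumes "AE s in half_line. f s = g s"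
  shows "L2_class d f = L2_class d g"
proof -
  have "(AE s in half_line. h s = f s) \<longleftrightarrow> (AE s in half_line. h s = g s)" for h
    using assms by (auto elim: eventually_elim2)
  then show ?thesis by (simp add: L2_class_def)
qed

lemma L2_rep_class:
  assumes "f \<in> L2_fun d"
  shows "L2_rep (L2_class d f) \<in> L2_fun d" "AE s in half_line. L2_rep (L2_class d f) s = f s"
proof -
  have "f \<in> L2_class d f" using assms by (simp add: L2_class_def)
  then have "L2_rep (L2_class d f) \<in> L2_class d f" unfolding L2_rep_def by (rule someI [where P = "\<lambda>g. g \<in> L2_class d f"])
  then show "L2_rep (L2_class d f) \<in> L2_fun d" "AE s in half_line. L2_rep (L2_class d f) s = f s"
    by (auto simp: L2_class_def)
qed

lemma L2_carrierE:
  assumes "X \<in> carrier (L2 d)"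
  obtains f where "f \<in> L2_fun d" "X = L2_class d f"
  using assms by (auto simp: L2_def)

lemma L2_class_closed [simp]: "f \<in> L2_fun d \<Longrightarrow> L2_class d f \<in> carrier (L2 d)"
  by (simp add: L2_def)

lemma L2_zero: "\<zero>\<^bsub>L2 d\<^esub> = L2_class d (\<lambda>s. 0\<^sub>v d)"
  by (simp add: L2_def)

lemma L2_add:
  assumes "f \<in> L2_fun d" "g \<in> L2_fun d"
  shows "L2_class d f \<oplus>\<^bsub>L2 d\<^esub> L2_class d g = L2_class d (\<lambda>s. f s + g s)"
proof -
  have "AE s in half_line. L2_rep (L2_class d f) s + L2_rep (L2_class d g) s = f s + g s"
    using L2_rep_class(2) [OF assms(1)] L2_rep_class(2) [OF assms(2)] by eventually_elim simp
  from L2_class_eqI [OF this] show ?thesis by (simp add: L2_def)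
qed

lemma L2_smult:
  assumes "f \<in> L2_fun d"
  shows "c \<odot>\<^bsub>L2 d\<^esub> L2_class d f = L2_class d (\<lambda>s. c \<cdot>\<^sub>v f s)"
proof -
  have "AE s in half_line. c \<cdot>\<^sub>v L2_rep (L2_class d f) s = c \<cdot>\<^sub>v f s"
    using L2_rep_class(2) [OF assms(1)] by eventually_elim simp
  from L2_class_eqI [OF this] show ?thesis by (simp add: L2_def)
qed

lemma cutoff_class:
  assumes "f \<in> L2_fun d"
  shows "cutoff d t (L2_class d f) = L2_class d (\<lambda>s. if s \<in> {0..t} then f s else 0\<^sub>v d)"
proof -
  have "AE s in half_line. (if s \<in> {0..t} then L2_rep (L2_class d f) s else 0\<^sub>v d) = (if s \<in> {0..t} then f s else 0\<^sub>v d)"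
    using L2_rep_class(2) [OF assms(1)] by eventually_elim simp
  from L2_class_eqI [OF this] show ?thesis by (simp add: cutoff_def)
qed

lemma integrable_L2_dot:
  assumes "f \<in> L2_fun d" "g \<in> L2_fun d"
  shows "integrable half_line (\<lambda>s. L2_dot d (f s) (g s))"
  unfolding L2_dot_def
  using L2_funD(3,4) [OF assms(1)] L2_funD(3,4) [OF assms(2)]
  by (intro Bochner_Integration.integrable_sum integrable_mult_cnj) auto

lemma ip_L2:
  assumes "f \<in> L2_fun d" "g \<in> L2_fun d"
  shows "ip (L2 d) (L2_class d f) (L2_class d g) = (\<integral>s. L2_dot d (f s) (g s) \<partial>half_line)"
proof -
  let ?f = "L2_rep (L2_class d f)" and ?g = "L2_rep (L2_class d g)"
  note f = L2_rep_class [OF assms(1)] and g = L2_rep_class [OF assms(2)]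
  have "ip (L2 d) (L2_class d f) (L2_class d g) = (\<integral>s. L2_dot d (?f s) (?g s) \<partial>half_line)"
    by (simp add: L2_def cscalar_prod_eq_L2_dot [OF L2_funD(1) [OF f(1)] L2_funD(1) [OF g(1)]])
  also have "\<dots> = (\<integral>s. L2_dot d (f s) (g s) \<partial>half_line)"
  proof (rule integral_cong_AE)
    show "AE s in half_line. L2_dot d (?f s) (?g s) = L2_dot d (f s) (g s)"
      using f(2) g(2) by eventually_elim simp
  qed (intro borel_measurable_integrable integrable_L2_dot f g assms)+
  finally show ?thesis .
qed

lemma inner_space_L2: "inner_space (L2 d)"
proof -
  interpret abelian_group "L2 d"
  proof (rule abelian_groupI)
    fix X Y Z assume "X \<in> carrier (L2 d)" "Y \<in> carrier (L2 d)" "Z \<in> carrier (L2 d)"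
    then obtain f g h where [simp]: "f \<in> L2_fun d" "g \<in> L2_fun d" "h \<in> L2_fun d"
      and X: "X = L2_class d f" and Y: "Y = L2_class d g" and Z: "Z = L2_class d h"
      by (metis L2_carrierE)
    note c = L2_funD(1) [of f d] L2_funD(1) [of g d] L2_funD(1) [of h d]
    show "X \<oplus>\<^bsub>L2 d\<^esub> Y \<in> carrier (L2 d)" by (simp add: X Y L2_add L2_fun_add)
    show "X \<oplus>\<^bsub>L2 d\<^esub> Y \<oplus>\<^bsub>L2 d\<^esub> Z = X \<oplus>\<^bsub>L2 d\<^esub> (Y \<oplus>\<^bsub>L2 d\<^esub> Z)"
      unfolding X Y Z by (simp add: L2_add L2_fun_add) (rule arg_cong [where f = "L2_class d"], rule ext, rule assoc_add_vec [OF c], simp_all)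
    show "X \<oplus>\<^bsub>L2 d\<^esub> Y = Y \<oplus>\<^bsub>L2 d\<^esub> X"
      unfolding X Y by (simp add: L2_add) (rule arg_cong [where f = "L2_class d"], rule ext, rule comm_add_vec [OF c(1,2)], simp_all)
    show "\<zero>\<^bsub>L2 d\<^esub> \<oplus>\<^bsub>L2 d\<^esub> X = X"
      unfolding X L2_zero using c(1) by (simp add: L2_add L2_fun_zero)
    show "\<exists>W\<in>carrier (L2 d). W \<oplus>\<^bsub>L2 d\<^esub> X = \<zero>\<^bsub>L2 d\<^esub>"
    proof (rule bexI)
      have "-1 \<cdot>\<^sub>v f s + f s = 0\<^sub>v d" for s
        using L2_funD(2) [of f d s] by (auto simp: vec_eq_iff)
      then show "L2_class d (\<lambda>s. -1 \<cdot>\<^sub>v f s) \<oplus>\<^bsub>L2 d\<^esub> X = \<zero>\<^bsub>L2 d\<^esub>"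
        unfolding X L2_zero by (simp add: L2_add L2_fun_smult)
      show "L2_class d (\<lambda>s. -1 \<cdot>\<^sub>v f s) \<in> carrier (L2 d)" by (simp add: L2_fun_smult)
    qed
  qed (simp add: L2_zero L2_fun_zero)
  show ?thesis
  proof unfold_locales
    fix X Y Z :: L2_elem and a b :: complex
    assume X': "X \<in> carrier (L2 d)"
    then obtain f where f: "f \<in> L2_fun d" and X: "X = L2_class d f" by (rule L2_carrierE)
    note fD = L2_funD [OF f]
    show "a \<odot>\<^bsub>L2 d\<^esub> X \<in> carrier (L2 d)" by (simp add: X f L2_smult L2_fun_smult)
    have "(a + b) \<cdot>\<^sub>v f s = a \<cdot>\<^sub>v f s + b \<cdot>\<^sub>v f s" for s by (rule add_smult_distrib_vec)
    then show "(a + b) \<odot>\<^bsub>L2 d\<^esub> X = a \<odot>\<^bsub>L2 d\<^esub> X \<oplus>\<^bsub>L2 d\<^esub> b \<odot>\<^bsub>L2 d\<^esub> X"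
      by (simp add: X f L2_smult L2_fun_smult L2_add)
    show "1 \<odot>\<^bsub>L2 d\<^esub> X = X" by (simp add: X f L2_smult)
    have self: "L2_dot d (f s) (f s) = complex_of_real (\<Sum>i<d. (cmod (vec_index (f s) i))\<^sup>2)" for s
      by (simp only: L2_dot_def of_real_sum complex_norm_square)
    have int: "integrable half_line (\<lambda>s. \<Sum>i<d. (cmod (vec_index (f s) i))\<^sup>2)"
      by (rule Bochner_Integration.integrable_sum) (simp add: fD(4))
    have ip_self: "ip (L2 d) X X = complex_of_real (\<integral>s. (\<Sum>i<d. (cmod (vec_index (f s) i))\<^sup>2) \<partial>half_line)"
      unfolding X ip_L2 [OF f f] self by (rule integral_of_real [OF int])
    show "0 \<le> Re (ip (L2 d) X X)"
      unfolding ip_self Re_complex_of_real by (rule Bochner_Integration.integral_nonneg) (auto intro: sum_nonneg)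
    show "X = \<zero>\<^bsub>L2 d\<^esub>" if "ip (L2 d) X X = 0"
    proof -
      have "(\<integral>s. (\<Sum>i<d. (cmod (vec_index (f s) i))\<^sup>2) \<partial>half_line) = 0"
        using that unfolding ip_self by simp
      then have "AE s in half_line. (\<Sum>i<d. (cmod (vec_index (f s) i))\<^sup>2) = 0"
        by (subst (asm) integral_nonneg_eq_0_iff_AE [OF int]) (auto intro!: AE_I2 sum_nonneg)
      then have "AE s in half_line. f s = 0\<^sub>v d"
        by eventually_elim (use fD(2) in \<open>auto simp: vec_eq_iff sum_nonneg_eq_0_iff\<close>)
      from L2_class_eqI [OF this] show ?thesis by (simp add: X L2_zero)
    qed
    assume Z': "Z \<in> carrier (L2 d)"
    then obtain h where h: "h \<in> L2_fun d" and Z: "Z = L2_class d h" by (rule L2_carrierE)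
    have "L2_dot d (a \<cdot>\<^sub>v f s) (h s) = a * L2_dot d (f s) (h s)" for s
      using fD(2) by (simp add: L2_dot_def sum_distrib_left mult.assoc)
    then show "ip (L2 d) (a \<odot>\<^bsub>L2 d\<^esub> X) Z = a * ip (L2 d) X Z"
      unfolding X Z by (simp add: L2_smult f h ip_L2 L2_fun_smult)
    have "L2_dot d (h s) (f s) = cnj (L2_dot d (f s) (h s))" for s
      by (simp add: L2_dot_def mult.commute)
    then show "ip (L2 d) Z X = cnj (ip (L2 d) X Z)"
      unfolding X Z by (simp add: f h ip_L2)
    assume "Y \<in> carrier (L2 d)"
    then obtain g where g: "g \<in> L2_fun d" and Y: "Y = L2_class d g" by (rule L2_carrierE)
    have "L2_dot d (f s + g s) (h s) = L2_dot d (f s) (h s) + L2_dot d (g s) (h s)" for s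
      using fD(2) L2_funD(2) [OF g] by (simp add: L2_dot_def sum.distrib distrib_right)
    then show "ip (L2 d) (X \<oplus>\<^bsub>L2 d\<^esub> Y) Z = ip (L2 d) X Z + ip (L2 d) Y Z"
      unfolding X Y Z by (simp add: L2_add f g h ip_L2 L2_fun_add integrable_L2_dot)
  qed
qed

lemma projection_space_cutoff: "projection_space (L2 d) (cutoff d t)"
proof -
  interpret inner_space "L2 d" by (rule inner_space_L2)
  show ?thesis
  proof unfold_locales
    fix X assume "X \<in> carrier (L2 d)"
    then obtain f where f: "f \<in> L2_fun d" and X: "X = L2_class d f" by (rule L2_carrierE)
    show "cutoff d t X \<in> carrier (L2 d)" by (simp only: X cutoff_class [OF f] L2_class_closed L2_fun_cutoff [OF f])
    show "cutoff d t (cutoff d t X) = cutoff d t X"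
      unfolding X cutoff_class [OF f] cutoff_class [OF L2_fun_cutoff [OF f]]
      by (rule arg_cong [where f = "L2_class d"]) auto
    fix Y assume "Y \<in> carrier (L2 d)"
    then obtain g where g: "g \<in> L2_fun d" and Y: "Y = L2_class d g" by (rule L2_carrierE)
    show "ip (L2 d) (cutoff d t X) Y = ip (L2 d) X (cutoff d t Y)"
      unfolding X Y cutoff_class [OF f] cutoff_class [OF g] ip_L2 [OF L2_fun_cutoff [OF f] g] ip_L2 [OF f L2_fun_cutoff [OF g]]
      by (intro Bochner_Integration.integral_cong refl) (simp add: L2_dot_def)
  qed
qed

section \<open>Scalar operators on the half-line and the limit of the expectations\<close>

lemma expect_Lambda_t_scalar:
  assumes \<psi>: "\<psi> \<in> carrier_vec d" "\<psi> \<bullet>c \<psi> = 1" and t: "t > 0"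
  shows "expect (L2 d) (Lambda_t d t (complex_of_real c \<cdot>\<^sub>m 1\<^sub>m d)) (step_vec d t \<psi>) = complex_of_real c * complex_of_real t"
proof -
  interpret projection_space "L2 d" "cutoff d t" by (rule projection_space_cutoff)
  let ?f = "\<lambda>s. if s \<in> {0..<t} then \<psi> else 0\<^sub>v d"
  have f: "?f \<in> L2_fun d" by (rule L2_fun_step [OF \<psi>(1)])
  have step: "step_vec d t \<psi> \<in> carrier (L2 d)" unfolding step_vec_def using f by simp
  \<comment> \<open>The cutoff is over the closed interval and the step vector over the half-open
    one; as [0,t) is contained in [0,t], the equality holds pointwise.\<close>
  have fixed: "cutoff d t (step_vec d t \<psi>) = step_vec d t \<psi>"
    unfolding step_vec_def cutoff_class [OF f] by (rule arg_cong [where f = "L2_class d"]) auto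
  have scaled: "(one_tensor d (complex_of_real c \<cdot>\<^sub>m 1\<^sub>m d) \<circ> cutoff d t) X = complex_of_real c \<odot>\<^bsub>L2 d\<^esub> cutoff d t X"
    if "X \<in> carrier (L2 d)" for X
  proof -
    have "cutoff d t X \<in> carrier (L2 d)" by (rule P_closed [OF that])
    then obtain g where g: "g \<in> L2_fun d" and X: "cutoff d t X = L2_class d g"
      by (rule L2_carrierE)
    have "(complex_of_real c \<cdot>\<^sub>m 1\<^sub>m d) *\<^sub>v v = complex_of_real c \<cdot>\<^sub>v v" if "v \<in> carrier_vec d" for v
      using that by (intro eq_vecI) (auto simp: scalar_prod_def if_distrib if_distribR cong: if_cong)
    then have "(complex_of_real c \<cdot>\<^sub>m 1\<^sub>m d) *\<^sub>v L2_rep (L2_class d g) s = complex_of_real c \<cdot>\<^sub>v L2_rep (L2_class d g) s" for s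
      using L2_funD(1) [OF L2_rep_class(1) [OF g]] by blast
    then show ?thesis by (simp add: X one_tensor_def L2_def)
  qed
  have "ip (L2 d) (step_vec d t \<psi>) (step_vec d t \<psi>) = (\<integral>s. L2_dot d (?f s) (?f s) \<partial>half_line)"
    unfolding step_vec_def by (rule ip_L2 [OF f f])
  also have "\<dots> = (\<integral>s. complex_of_real (indicator {0..<t} s) \<partial>half_line)"
  proof (rule Bochner_Integration.integral_cong)
    have "L2_dot d \<psi> \<psi> = 1" using \<psi> by (simp add: cscalar_prod_eq_L2_dot [of _ d])
    then show "L2_dot d (?f s) (?f s) = complex_of_real (indicator {0..<t} s)" for s
      by (auto simp: L2_dot_def)
  qed simp
  also have "\<dots> = complex_of_real (measure half_line {0..<t})"
  proof -
    have "{0..<t} \<inter> {0..} = {0..<t}" by auto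
    then show ?thesis by simp
  qed
  also have "measure half_line {0..<t} = t"
    using t by (subst measure_restrict_space) (auto simp: measure_completion)
  finally have ip: "ip (L2 d) (step_vec d t \<psi>) (step_vec d t \<psi>) = complex_of_real t" .
  show ?thesis
    unfolding Lambda_t_def ip [symmetric]
    by (rule expect_Lambda_scaled_projection [OF _ step fixed]) (erule scaled)
qed

theorem proposition3p1:
  fixes N d :: "nat \<Rightarrow> nat"
    and lam :: "nat \<Rightarrow> int list"
    and \<omega> :: param
    and \<pi> :: "nat \<Rightarrow> complex mat \<Rightarrow> complex mat"
    and \<psi> :: "nat \<Rightarrow> complex vec"
    and \<mu> :: "nat list"
    and S :: "nat \<Rightarrow> ((nat \<times> nat) list \<Rightarrow> complex) set"
    and t :: real
  assumes "strict_mono_on {1..} N"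
    and "\<And>L. L \<ge> 1 \<Longrightarrow> N L > 0"
    and "(\<lambda>L. real L / real (N L)) \<longlonglongrightarrow> 1"
    and "\<And>L. L \<ge> 1 \<Longrightarrow> lam L \<in> Sign (N L)"
    and "\<omega> \<in> Omega"
    and "vershik_kerov N lam \<omega>"
    and "\<And>L. L \<ge> 1 \<Longrightarrow> irreducible_rep (N L) (d L) (\<pi> L)"
    and "\<And>L. L \<ge> 1 \<Longrightarrow> highest_weight (N L) (d L) (\<pi> L) (lam L)"
    and "\<And>L. L \<ge> 1 \<Longrightarrow> \<psi> L \<in> carrier_vec (d L) \<and> \<psi> L \<bullet>c \<psi> L = 1"
    and "is_partition \<mu>"
    and "\<And>L. L \<ge> 1 \<Longrightarrow> length \<mu> \<le> N L \<Longrightarrow> quantum_immanant (N L) \<mu> (S L)"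
    and "t > 0"
  shows "(\<lambda>L. expect (L2 (d L)) (Lambda_t (d L) t (U_rep (N L) (d L) (\<pi> L) (S L)))
                 (step_vec (d L) t (\<psi> L)) / of_nat (N L ^ sum_list \<mu>))
         \<longlonglongrightarrow> schur_param \<mu> \<omega> * of_real t"
proof -
  have N_ge: "L \<le> N L" if "L \<ge> 1" for L
    by (rule strict_mono_on_ge_id [OF assms(1) assms(2) [OF order_refl] that])
  then have N: "filterlim (\<lambda>L. real (N L)) at_top sequentially"
    by (intro filterlim_at_top_mono [OF filterlim_real_sequentially] eventually_sequentiallyI [of 1]) simp
  have "(\<lambda>L. complex_of_real (shifted_schur (N L) \<mu> (\<lambda>i. real_of_int (lam L ! i))) / of_nat (N L ^ sum_list \<mu>))
      \<longlonglongrightarrow> schur_param \<mu> \<omega>"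
    by (rule tendsto_shifted_schur [OF N _ assms(5,6)]) (rule assms(4))
  then have "(\<lambda>L. complex_of_real (shifted_schur (N L) \<mu> (\<lambda>i. real_of_int (lam L ! i))) / of_nat (N L ^ sum_list \<mu>) * of_real t)
      \<longlonglongrightarrow> schur_param \<mu> \<omega> * of_real t"
    by (intro tendsto_mult tendsto_const)
  then show ?thesis
  proof (rule Lim_transform_eventually)
    show "\<forall>\<^sub>F L in sequentially.
        complex_of_real (shifted_schur (N L) \<mu> (\<lambda>i. real_of_int (lam L ! i))) / of_nat (N L ^ sum_list \<mu>) * of_real t
      = expect (L2 (d L)) (Lambda_t (d L) t (U_rep (N L) (d L) (\<pi> L) (S L)))
          (step_vec (d L) t (\<psi> L)) / of_nat (N L ^ sum_list \<mu>)"
      \<comment> \<open>From here on \<open>length \<mu> \<le> L \<le> N L\<close>, so the immanant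
        is available. It acts as the scalar \<open>shifted_schur\<close>, and the expectation is
        exactly this scalar times t.\<close>
      using eventually_ge_at_top [of "max 1 (length \<mu>)"]
    proof eventually_elim
      case (elim L)
      then have L: "L \<ge> 1" "length \<mu> \<le> N L" using N_ge [of L] by auto
      have "U_rep (N L) (d L) (\<pi> L) (S L) =
          complex_of_real (shifted_schur (N L) \<mu> (\<lambda>i. real_of_int (lam L ! i))) \<cdot>\<^sub>m 1\<^sub>m (d L)"
        using assms(11) [OF L] assms(4,7,8) [OF L(1)] unfolding quantum_immanant_def by blast
      then show ?case
        using assms(9) [OF L(1)] assms(12) by (simp add: expect_Lambda_t_scalar)
    qed
  qed
qed

end
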